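(* Let $u_h^{cr}\in K_h^{cr}$ be the discrete primal solution (the unique minimizer of $I_h^{cr}$) and let $z_h^{rt}\in K_h^{rt,*}$ be a discrete dual solution (a maximizer of $D_h^{rt}$). For $v_h\in K_h^{cr}$ and $y_h\in K_h^{rt,*}$ define the discrete primal-dual total error $$\rho_{\mathrm{tot},h}^2(v_h,y_h):=\big(I_h^{cr}(v_h)-I_h^{cr}(u_h^{cr})\big)+\big(-D_h^{rt}(y_h)+D_h^{rt}(z_h^{rt})\big)$$ and the discrete primal-dual gap estimator $\eta_{\mathrm{gap},h}^2(v_h,y_h):=I_h^{cr}(v_h)-D_h^{rt}(y_h)$. Then, for every $v_h\in K_h^{cr}$ and $y_h\in K_h^{rt,*}$, $$\rho_{\mathrm{tot},h}^2(v_h,y_h)=\eta_{\mathrm{gap},h}^2(v_h,y_h).$$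
   Context: Let $\Omega\subseteq\mathbb{R}^d$, $d\in\mathbb{N}$, be a bounded simplicial Lipschitz domain with $\partial\Omega=\overline\Gamma_D\cup\overline\Gamma_N$, $\Gamma_D,\Gamma_N$ disjoint and relatively open, $|\Gamma_D|>0$. $\mathcal{T}_h$ is a (shape-regular, conforming) simplicial triangulation of $\Omega$; $\mathcal{S}_h$ is the set of its sides (($d-1$)-dimensional faces), $\mathcal{S}_h^i$ the interior sides, $\mathcal{S}_h^{\Gamma_D},\mathcal{S}_h^{\Gamma_N}$ the boundary sides whose relative interior lies in $\Gamma_D$, resp. $\Gamma_N$; every boundary side belongs to exactly one of these two sets. $(v,w)_\omega=\int_\omega v\cdot w$; $\|\cdot\|_{p,\omega}$ is the $L^p(\omega)$-norm. $\mathcal{L}^k(\mathcal{T}_h)$ are the element-wise polynomials of degree $\le k$; $\mathcal{L}^0(\mathcal{S}_h^{\gamma})$ the side-wise constant functions on $\mathcal{S}_h^\gamma$. $\Pi_h$ is the $L^2$-projection onto element-wise constants (element averages, component-wise for vector fields), $\pi_h$ the projection onto side-wise constants (side averages). $\nabla_h$ is the element-wise gradient. $\mathcal{S}^{1,cr}(\mathcal{T}_h)=\{v_h\in\mathcal{L}^1(\mathcal{T}_h):$ the side average of the jump of $v_h$ vanishes on every interior side$\}$ (Crouzeix–Raviart). $\mathcal{R}T^0(\mathcal{T}_h)=\{y_h\in(\mathcal{L}^1(\mathcal{T}_h))^d: y_h|_T\cdot n_T$ is constant on each side of each $T\in\mathcal{T}_h$ and the normal jump of $y_h$ vanishes on every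 interior side$\}$ (lowest-order Raviart–Thomas; on each $T$, $y_h(x)=a_T+b_Tx$ with $a_T\in\mathbb{R}^d,b_T\in\mathbb{R}$). $n$ is the outward unit normal on $\partial\Omega$. Data: $f_h\in\mathcal{L}^0(\mathcal{T}_h)$, $g_h\in\mathcal{L}^0(\mathcal{S}_h^{\Gamma_N})$, $\zeta_h\in\mathcal{L}^0(\mathcal{T}_h)$ with $\operatorname{ess\,inf}_\Omega\zeta_h>0$, $u_D^h\in\mathcal{L}^0(\mathcal{S}_h^{\Gamma_D})$ such that there exists $\widehat u_D^h\in\mathcal{S}^{1,cr}(\mathcal{T}_h)$ with $\pi_h\widehat u_D^h=u_D^h$ on $\Gamma_D$ and $\|\nabla_h\widehat u_D^h/\zeta_h\|_{\infty,\Omega}<1$. For a.e. $x$ and $s\in\mathbb{R}^d$: $\phi_h^*(x,s)=\frac12|s|^2$ if $|s|\le\zeta_h(x)$, $\phi_h^*(x,s)=\zeta_h(x)|s|-\frac12\zeta_h(x)^2$ if $|s|>\zeta_h(x)$. Discrete primal problem: $K_h^{cr}=\{v_h\in\mathcal{S}^{1,cr}(\mathcal{T}_h):|\nabla_hv_h|\le\zeta_h\text{ a.e. in }\Omega,\ \pi_hv_h=u_D^h\text{ a.e. on }\Gamma_D\}$; $I_h^{cr}(v_h)=\frac12\|\nabla_hv_h\|_{2,\Omega}^2-(f_h,\Pi_hv_h)_\Omega-(g_h,\pi_hv_h)_{\Gamma_N}$ if $v_h\in K_h^{cr}$ and $+\infty$ for other $v_h\in\mathcal{S}^{1,cr}(\mathcal{T}_h)$.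 It has a unique minimizer $u_h^{cr}$. Discrete dual functional: $K_h^{rt,*}=\{y_h\in\mathcal{R}T^0(\mathcal{T}_h):\operatorname{div}y_h=-f_h\text{ a.e. in }\Omega,\ y_h\cdot n=g_h\text{ a.e. on }\Gamma_N\}$; $D_h^{rt}(y_h)=-\int_\Omega\phi_h^*(\cdot,\Pi_hy_h)\,\mathrm{d}x+(y_h\cdot n,u_D^h)_{\Gamma_D}$ if $y_h\in K_h^{rt,*}$ and $-\infty$ for other $y_h\in\mathcal{R}T^0(\mathcal{T}_h)$. $D_h^{rt}$ is the Fenchel dual functional of $I_h^{cr}$. *)

theory Defs
  imports "HOL-Analysis.Analysis" "HOL-Probability.Essential_Supremum"
begin

section \<open>Domain, boundary parts and triangulation\<close>

text \<open>
  Near each boundary point the set lies strictly on one side of the graph of a Lipschitz function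
  over the hyperplane orthogonal to some unit vector \<open>e\<close>.
\<close>

definition lipschitz_domain :: "'a::euclidean_space set \<Rightarrow> bool" where
  "lipschitz_domain \<Omega> \<longleftrightarrow>
     open \<Omega> \<and> connected \<Omega> \<and> \<Omega> \<noteq> {} \<and>
     (\<forall>p\<in>frontier \<Omega>. \<exists>e r \<gamma> L.
        norm e = 1 \<and> 0 < r \<and> L-lipschitz_on {x. x \<bullet> e = 0} \<gamma> \<and>
        \<Omega> \<inter> ball p r = {x \<in> ball p r. \<gamma> (x - (x \<bullet> e) *\<^sub>R e) < x \<bullet> e})"

text \<open>
  Conformity is part of the library's \<open>triangulation\<close> (two elements meet in a common face).
  The existence of such a finite mesh is what makes the domain simplicial.  Elements are closed
  nondegenerate simplices, so a single mesh is shape-regular with some constant.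
\<close>

definition simplicial_mesh :: "'a::euclidean_space set \<Rightarrow> 'a set set \<Rightarrow> bool" where
  "simplicial_mesh \<Omega> \<T> \<longleftrightarrow>
     triangulation \<T> \<and> (\<forall>T\<in>\<T>. int DIM('a) simplex T) \<and> \<Union>\<T> = closure \<Omega>"

definition sides :: "'a::euclidean_space set set \<Rightarrow> 'a set set" where
  "sides \<T> = {S. \<exists>T\<in>\<T>. S facet_of T}"

definition interior_sides :: "'a::euclidean_space set \<Rightarrow> 'a set set \<Rightarrow> 'a set set" where
  "interior_sides \<Omega> \<T> = {S \<in> sides \<T>. rel_interior S \<subseteq> \<Omega>}"

definition boundary_sides :: "'a::euclidean_space set \<Rightarrow> 'a set set \<Rightarrow> 'a set set" where
  "boundary_sides \<Omega> \<T> = {S \<in> sides \<T>. S \<subseteq> frontier \<Omega>}"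

definition sides_in ::
    "'a::euclidean_space set \<Rightarrow> 'a set set \<Rightarrow> 'a set \<Rightarrow> 'a set set" where
  "sides_in \<Omega> \<T> \<Gamma> = {S \<in> boundary_sides \<Omega> \<T>. rel_interior S \<subseteq> \<Gamma>}"

text \<open>
  The element adjacent to a side; it is unique for boundary sides.  For an interior side either
  neighbour may be returned.
\<close>

definition adjacent :: "'a::euclidean_space set set \<Rightarrow> 'a set \<Rightarrow> 'a set" where
  "adjacent \<T> S = (SOME T. T \<in> \<T> \<and> S facet_of T)"

definition outer_normal :: "'a::euclidean_space set \<Rightarrow> 'a set \<Rightarrow> 'a" where
  "outer_normal T S = (THE n. norm n = 1 \<and> (\<forall>x\<in>S. \<forall>y\<in>T. n \<bullet> (y - x) \<le> 0))"


section \<open>Surface measure\<close>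

text \<open>
  A side \<open>S\<close> lies in the hyperplane \<open>affine hull S\<close>.  The Lebesgue measure on a hyperplane is
  characterised by: the \<open>d\<close>-dimensional measure of the right cylinder of height 1 over a set is
  the \<open>(d-1)\<close>-dimensional measure of its base.  So the surface measure on \<open>S\<close> is the image, under
  the orthogonal projection onto \<open>affine hull S\<close>, of Lebesgue measure on the cylinder of height 1
  over \<open>S\<close>.  For \<open>d = 1\<close> this is the point mass 1.
\<close>

definition side_normal :: "'a::euclidean_space set \<Rightarrow> 'a" where
  "side_normal S = (SOME n. norm n = 1 \<and> (\<forall>x\<in>S. \<forall>y\<in>S. n \<bullet> (y - x) = 0))"

definition side_cylinder :: "'a::euclidean_space set \<Rightarrow> 'a set" where
  "side_cylinder S = {x + t *\<^sub>R side_normal S | x t. x \<in> S \<and> 0 \<le> t \<and> t \<le> 1}"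

definition side_measure :: "'a::euclidean_space set \<Rightarrow> 'a measure" where
  "side_measure S =
     completion (distr (restrict_space lborel (side_cylinder S)) borel (closest_point (affine hull S)))"

definition side_avg :: "'a::euclidean_space set \<Rightarrow> ('a \<Rightarrow> real) \<Rightarrow> real" where
  "side_avg S w = (\<integral>x. w x \<partial>side_measure S) / measure (side_measure S) (space (side_measure S))"

definition bd_measure ::
    "'a::euclidean_space set \<Rightarrow> 'a set set \<Rightarrow> 'a set \<Rightarrow> real" where
  "bd_measure \<Omega> \<T> \<Gamma> = (\<Sum>S\<in>boundary_sides \<Omega> \<T>. measure (side_measure S) \<Gamma>)"

definition bd_integral ::
    "'a::euclidean_space set \<Rightarrow> 'a set set \<Rightarrow> 'a set \<Rightarrow> ('a \<Rightarrow> real) \<Rightarrow> real" where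
  "bd_integral \<Omega> \<T> \<Gamma> w = (\<Sum>S\<in>boundary_sides \<Omega> \<T>. LINT x:\<Gamma>|side_measure S. w x)"

definition bd_AE ::
    "'a::euclidean_space set \<Rightarrow> 'a set set \<Rightarrow> 'a set \<Rightarrow> ('a \<Rightarrow> bool) \<Rightarrow> bool" where
  "bd_AE \<Omega> \<T> \<Gamma> P \<longleftrightarrow> (\<forall>S\<in>boundary_sides \<Omega> \<T>. AE x in side_measure S. x \<in> \<Gamma> \<longrightarrow> P x)"

definition bd_partition ::
    "'a::euclidean_space set \<Rightarrow> 'a set set \<Rightarrow> 'a set \<Rightarrow> 'a set \<Rightarrow> bool" where
  "bd_partition \<Omega> \<T> \<Gamma>D \<Gamma>N \<longleftrightarrow>
     frontier \<Omega> = closure \<Gamma>D \<union> closure \<Gamma>N \<and> \<Gamma>D \<inter> \<Gamma>N = {} \<and>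
     openin (top_of_set (frontier \<Omega>)) \<Gamma>D \<and> openin (top_of_set (frontier \<Omega>)) \<Gamma>N \<and>
     0 < bd_measure \<Omega> \<T> \<Gamma>D \<and>
     (\<forall>S\<in>boundary_sides \<Omega> \<T>. (S \<in> sides_in \<Omega> \<T> \<Gamma>D) \<noteq> (S \<in> sides_in \<Omega> \<T> \<Gamma>N))"


section \<open>Element-wise and side-wise polynomial functions\<close>

text \<open>
  An element-wise polynomial is represented by a function on the whole space that is prescribed
  on the interiors of the elements; its values elsewhere are irrelevant.  Accordingly its
  restriction to a side of \<open>T\<close> is the limit from the interior of \<open>T\<close>.
\<close>

definition elt_const :: "'a::euclidean_space set set \<Rightarrow> ('a \<Rightarrow> 'b) \<Rightarrow> bool" where
  "elt_const \<T> v \<longleftrightarrow> (\<forall>T\<in>\<T>. \<exists>c. \<forall>x\<in>interior T. v x = c)"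

definition elt_affine ::
    "'a::euclidean_space set set \<Rightarrow> ('a \<Rightarrow> 'b::real_normed_vector) \<Rightarrow> bool" where
  "elt_affine \<T> v \<longleftrightarrow> (\<forall>T\<in>\<T>. \<exists>A c. linear A \<and> (\<forall>x\<in>interior T. v x = A x + c))"

definition side_const :: "'a::euclidean_space set set \<Rightarrow> ('a \<Rightarrow> 'b) \<Rightarrow> bool" where
  "side_const \<S> g \<longleftrightarrow> (\<forall>S\<in>\<S>. \<exists>c. \<forall>x\<in>rel_interior S. g x = c)"

definition elt_trace ::
    "'a::euclidean_space set \<Rightarrow> ('a \<Rightarrow> 'b::real_normed_vector) \<Rightarrow> 'a \<Rightarrow> 'b" where
  "elt_trace T v x = Lim (at x within interior T) v"

text \<open>
  Interiors of distinct elements are disjoint, and so are relative interiors of distinct sides;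
  hence at most one summand below is nonzero at any point.
\<close>

definition elt_proj ::
    "'a::euclidean_space set set \<Rightarrow> ('a \<Rightarrow> 'b::euclidean_space) \<Rightarrow> 'a \<Rightarrow> 'b" where
  "elt_proj \<T> v x =
     (\<Sum>T\<in>\<T>. indicator (interior T) x *\<^sub>R ((1 / measure lebesgue T) *\<^sub>R (\<integral>y. v y \<partial>lebesgue_on T)))"

definition sidewise :: "'a::euclidean_space set set \<Rightarrow> ('a set \<Rightarrow> 'a \<Rightarrow> real) \<Rightarrow> 'a \<Rightarrow> real" where
  "sidewise \<T> w x = (\<Sum>S\<in>sides \<T>. indicator (rel_interior S) x * w S x)"

text \<open>
  For Crouzeix-Raviart functions the side average does not depend on which adjacent element the
  trace is taken from, because the average of the jump vanishes.
\<close>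

definition side_proj :: "'a::euclidean_space set set \<Rightarrow> ('a \<Rightarrow> real) \<Rightarrow> 'a \<Rightarrow> real" where
  "side_proj \<T> v = sidewise \<T> (\<lambda>S x. side_avg S (elt_trace (adjacent \<T> S) v))"

text \<open>The trace \<open>y \<bullet> n\<close>; meaningful on boundary sides, where \<open>adjacent\<close> is unique.\<close>

definition normal_trace :: "'a::euclidean_space set set \<Rightarrow> ('a \<Rightarrow> 'a) \<Rightarrow> 'a \<Rightarrow> real" where
  "normal_trace \<T> y =
     sidewise \<T> (\<lambda>S x. elt_trace (adjacent \<T> S) y x \<bullet> outer_normal (adjacent \<T> S) S)"

text \<open>
  The mesh skeleton is a null set, so the element-wise gradient and divergence are almost
  everywhere the classical ones at interior points of elements.
\<close>

definition grad_h :: "('a::euclidean_space \<Rightarrow> real) \<Rightarrow> 'a \<Rightarrow> 'a" where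
  "grad_h v x = (THE D. GDERIV v x :> D)"

definition div_h :: "('a::euclidean_space \<Rightarrow> 'a) \<Rightarrow> 'a \<Rightarrow> real" where
  "div_h y x = (\<Sum>b\<in>Basis. frechet_derivative y (at x) b \<bullet> b)"

definition crouzeix_raviart ::
    "'a::euclidean_space set \<Rightarrow> 'a set set \<Rightarrow> ('a \<Rightarrow> real) set" where
  "crouzeix_raviart \<Omega> \<T> =
     {v. elt_affine \<T> v \<and>
        (\<forall>S\<in>interior_sides \<Omega> \<T>. \<forall>T\<in>\<T>. \<forall>T'\<in>\<T>. S facet_of T \<and> S facet_of T' \<and> T \<noteq> T' \<longrightarrow>
           side_avg S (\<lambda>x. elt_trace T v x - elt_trace T' v x) = 0)}"

definition raviart_thomas ::
    "'a::euclidean_space set \<Rightarrow> 'a set set \<Rightarrow> ('a \<Rightarrow> 'a) set" where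
  "raviart_thomas \<Omega> \<T> =
     {y. elt_affine \<T> y \<and>
        (\<forall>T\<in>\<T>. \<forall>S. S facet_of T \<longrightarrow> (\<exists>c. \<forall>x\<in>S. elt_trace T y x \<bullet> outer_normal T S = c)) \<and>
        (\<forall>S\<in>interior_sides \<Omega> \<T>. \<forall>T\<in>\<T>. \<forall>T'\<in>\<T>. S facet_of T \<and> S facet_of T' \<and> T \<noteq> T' \<longrightarrow>
           (\<forall>x\<in>S. elt_trace T y x \<bullet> outer_normal T S + elt_trace T' y x \<bullet> outer_normal T' S = 0))}"


section \<open>Discrete primal and dual problem\<close>

definition ess_inf :: "'a::euclidean_space set \<Rightarrow> ('a \<Rightarrow> real) \<Rightarrow> ereal" where
  "ess_inf \<Omega> \<zeta> = - esssup (lebesgue_on \<Omega>) (\<lambda>x. - ereal (\<zeta> x))"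

definition Linf_norm ::
    "'a::euclidean_space set \<Rightarrow> ('a \<Rightarrow> 'b::real_normed_vector) \<Rightarrow> ereal" where
  "Linf_norm \<Omega> w = esssup (lebesgue_on \<Omega>) (\<lambda>x. ereal (norm (w x)))"

definition phi_star :: "('a \<Rightarrow> real) \<Rightarrow> 'a \<Rightarrow> 'a::euclidean_space \<Rightarrow> real" where
  "phi_star \<zeta> x s =
     (if norm s \<le> \<zeta> x then (norm s)\<^sup>2 / 2 else \<zeta> x * norm s - (\<zeta> x)\<^sup>2 / 2)"

definition admissible_data ::
    "'a::euclidean_space set \<Rightarrow> 'a set set \<Rightarrow> 'a set \<Rightarrow> 'a set \<Rightarrow>
     ('a \<Rightarrow> real) \<Rightarrow> ('a \<Rightarrow> real) \<Rightarrow> ('a \<Rightarrow> real) \<Rightarrow> ('a \<Rightarrow> real) \<Rightarrow> bool" where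
  "admissible_data \<Omega> \<T> \<Gamma>D \<Gamma>N f g \<zeta> uD \<longleftrightarrow>
     elt_const \<T> f \<and> side_const (sides_in \<Omega> \<T> \<Gamma>N) g \<and>
     elt_const \<T> \<zeta> \<and> 0 < ess_inf \<Omega> \<zeta> \<and>
     side_const (sides_in \<Omega> \<T> \<Gamma>D) uD \<and>
     (\<exists>uhat\<in>crouzeix_raviart \<Omega> \<T>.
        bd_AE \<Omega> \<T> \<Gamma>D (\<lambda>x. side_proj \<T> uhat x = uD x) \<and>
        Linf_norm \<Omega> (\<lambda>x. grad_h uhat x /\<^sub>R \<zeta> x) < 1)"

definition K_cr ::
    "'a::euclidean_space set \<Rightarrow> 'a set set \<Rightarrow> 'a set \<Rightarrow> ('a \<Rightarrow> real) \<Rightarrow> ('a \<Rightarrow> real) \<Rightarrow>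
     ('a \<Rightarrow> real) set" where
  "K_cr \<Omega> \<T> \<Gamma>D \<zeta> uD =
     {v \<in> crouzeix_raviart \<Omega> \<T>.
        (AE x in lebesgue_on \<Omega>. norm (grad_h v x) \<le> \<zeta> x) \<and>
        bd_AE \<Omega> \<T> \<Gamma>D (\<lambda>x. side_proj \<T> v x = uD x)}"

definition I_cr ::
    "'a::euclidean_space set \<Rightarrow> 'a set set \<Rightarrow> 'a set \<Rightarrow> 'a set \<Rightarrow>
     ('a \<Rightarrow> real) \<Rightarrow> ('a \<Rightarrow> real) \<Rightarrow> ('a \<Rightarrow> real) \<Rightarrow> ('a \<Rightarrow> real) \<Rightarrow> ('a \<Rightarrow> real) \<Rightarrow> ereal" where
  "I_cr \<Omega> \<T> \<Gamma>D \<Gamma>N f g \<zeta> uD v =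
     (if v \<in> K_cr \<Omega> \<T> \<Gamma>D \<zeta> uD
      then ereal (1 / 2 * (\<integral>x. (norm (grad_h v x))\<^sup>2 \<partial>lebesgue_on \<Omega>)
                  - (\<integral>x. f x * elt_proj \<T> v x \<partial>lebesgue_on \<Omega>)
                  - bd_integral \<Omega> \<T> \<Gamma>N (\<lambda>x. g x * side_proj \<T> v x))
      else \<infinity>)"

definition K_rt ::
    "'a::euclidean_space set \<Rightarrow> 'a set set \<Rightarrow> 'a set \<Rightarrow> ('a \<Rightarrow> real) \<Rightarrow> ('a \<Rightarrow> real) \<Rightarrow>
     ('a \<Rightarrow> 'a) set" where
  "K_rt \<Omega> \<T> \<Gamma>N f g =
     {y \<in> raviart_thomas \<Omega> \<T>.
        (AE x in lebesgue_on \<Omega>. div_h y x = - f x) \<and>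
        bd_AE \<Omega> \<T> \<Gamma>N (\<lambda>x. normal_trace \<T> y x = g x)}"

definition D_rt ::
    "'a::euclidean_space set \<Rightarrow> 'a set set \<Rightarrow> 'a set \<Rightarrow> 'a set \<Rightarrow>
     ('a \<Rightarrow> real) \<Rightarrow> ('a \<Rightarrow> real) \<Rightarrow> ('a \<Rightarrow> real) \<Rightarrow> ('a \<Rightarrow> real) \<Rightarrow> ('a \<Rightarrow> 'a) \<Rightarrow> ereal" where
  "D_rt \<Omega> \<T> \<Gamma>D \<Gamma>N f g \<zeta> uD y =
     (if y \<in> K_rt \<Omega> \<T> \<Gamma>N f g
      then ereal (- (\<integral>x. phi_star \<zeta> x (elt_proj \<T> y x) \<partial>lebesgue_on \<Omega>)
                  + bd_integral \<Omega> \<T> \<Gamma>D (\<lambda>x. normal_trace \<T> y x * uD x))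
      else - \<infinity>)"

text \<open>The squared total error, relative to the primal and dual solutions \<open>u\<close> and \<open>z\<close>.\<close>

definition rho_tot_sq ::
    "'a::euclidean_space set \<Rightarrow> 'a set set \<Rightarrow> 'a set \<Rightarrow> 'a set \<Rightarrow>
     ('a \<Rightarrow> real) \<Rightarrow> ('a \<Rightarrow> real) \<Rightarrow> ('a \<Rightarrow> real) \<Rightarrow> ('a \<Rightarrow> real) \<Rightarrow>
     ('a \<Rightarrow> real) \<Rightarrow> ('a \<Rightarrow> 'a) \<Rightarrow> ('a \<Rightarrow> real) \<Rightarrow> ('a \<Rightarrow> 'a) \<Rightarrow> ereal" where
  "rho_tot_sq \<Omega> \<T> \<Gamma>D \<Gamma>N f g \<zeta> uD u z v y =
     (I_cr \<Omega> \<T> \<Gamma>D \<Gamma>N f g \<zeta> uD v - I_cr \<Omega> \<T> \<Gamma>D \<Gamma>N f g \<zeta> uD u)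
     + (- D_rt \<Omega> \<T> \<Gamma>D \<Gamma>N f g \<zeta> uD y + D_rt \<Omega> \<T> \<Gamma>D \<Gamma>N f g \<zeta> uD z)"

definition eta_gap_sq ::
    "'a::euclidean_space set \<Rightarrow> 'a set set \<Rightarrow> 'a set \<Rightarrow> 'a set \<Rightarrow>
     ('a \<Rightarrow> real) \<Rightarrow> ('a \<Rightarrow> real) \<Rightarrow> ('a \<Rightarrow> real) \<Rightarrow> ('a \<Rightarrow> real) \<Rightarrow>
     ('a \<Rightarrow> real) \<Rightarrow> ('a \<Rightarrow> 'a) \<Rightarrow> ereal" where
  "eta_gap_sq \<Omega> \<T> \<Gamma>D \<Gamma>N f g \<zeta> uD v y =
     I_cr \<Omega> \<T> \<Gamma>D \<Gamma>N f g \<zeta> uD v - D_rt \<Omega> \<T> \<Gamma>D \<Gamma>N f g \<zeta> uD y"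

end

theory Submission
  imports Defs
begin

text \<open>
  The identity says that \<open>I\<^sub>h(u) = D\<^sub>h(z)\<close>: all four functional values are finite, so the total error and
  the gap estimator differ exactly by \<open>D\<^sub>h(z) - I\<^sub>h(u)\<close>.  The content is therefore strong duality for
  the discrete problem.

  Everything rests on the discrete integration by parts formula
  \<open>(\<nabla>\<^sub>h v, \<Pi>\<^sub>h y) + (\<Pi>\<^sub>h v, div y) = (\<pi>\<^sub>h v, y \<cdot> n)\<close> for a Crouzeix-Raviart function \<open>v\<close> and a
  Raviart-Thomas field \<open>y\<close>, the right-hand side being taken over the boundary sides
  (\<open>discrete_integration_by_parts\<close>).  It turns the gap \<open>I\<^sub>h(v) - D\<^sub>h(y)\<close> into the sum over the elements
  of \<open>|T|\<close> times the Fenchel-Young defect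
  \<open>|\<nabla>v|\<^sup>2 / 2 + \<phi>\<^sup>*(\<Pi>y) - \<nabla>v \<cdot> \<Pi>y\<close> (\<open>duality_gap\<close>).  The defect is nonnegative, which is weak duality,
  and it vanishes when \<open>\<nabla>v\<close> is the derivative of \<open>\<phi>\<^sup>*\<close> at \<open>\<Pi>y\<close>, that is, the projection of \<open>\<Pi>y\<close>
  onto the ball of radius \<open>\<zeta>\<close>.

  Strong duality is obtained from the dual maximizer \<open>z\<close>, because \<open>\<phi>\<^sup>*\<close> is continuously
  differentiable while the primal problem is constrained.  Let \<open>q\<close> be the element-wise projection of
  \<open>\<Pi>z\<close> onto the ball of radius \<open>\<zeta>\<close>.  A vector field \<open>p\<close> that is constant on each element, has continuous
  normal components and vanishing normal components on \<open>\<Gamma>\<^sub>N\<close> is an admissible direction at \<open>z\<close>, and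
  stationarity together with integration by parts gives \<open>(q - \<nabla>\<^sub>h u, p) = 0\<close> (\<open>dual_stationary\<close>).
  Conversely, such fields are exactly the orthogonal complement of the gradients of the
  Crouzeix-Raviart functions with vanishing averages on \<open>\<Gamma>\<^sub>D\<close>: testing with the basis function of
  a side \<open>S\<close> yields \<open>|S|\<close> times the jump of the normal component.  Hence \<open>q - \<nabla>\<^sub>h u\<close> is itself such a
  gradient, \<open>q = \<nabla>\<^sub>h w\<close> with \<open>w\<close> admissible, and \<open>I\<^sub>h(u) \<le> I\<^sub>h(w) = D\<^sub>h(z) \<le> I\<^sub>h(u)\<close> (\<open>strong_duality\<close>).

  The integration by parts formula is reduced to algebra with values at vertices
  (\<open>vertex_integration_by_parts\<close>).  The reduction needs three facts about a nondegenerate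
  simplex \<open>T\<close> in \<open>d\<close> dimensions: the mean of an affine function over \<open>T\<close>, and over a side, is the
  average of its values at the vertices, and the side opposite to a vertex with barycentric coordinate
  \<open>\<lambda>\<close> has area \<open>d |T| |\<nabla>\<lambda>|\<close>.  The first two follow from the symmetry of \<open>T\<close> under exchanging two
  vertices, an affine involution and hence measure preserving; the third follows by mapping to the
  standard simplex.  Finally, the Lipschitz property of the domain ensures that a side has two
  neighbours exactly when it does not lie on the boundary, so the interior contributions cancel.
\<close>

section \<open>Affine changes of variables for Lebesgue measure\<close>

text \<open>
  A linear bijection changes Lebesgue measure by a constant factor.  The argument is the uniqueness
  proof for Haar measure: evaluating the double integral of \<open>1\<^sub>A(L x) 1\<^sub>B(L x + y)\<close> in both orders,
  each time using only translation and reflection invariance, gives a relation that is symmetric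
  in \<open>A\<close> and \<open>B\<close>.
\<close>

lemma emeasure_linear_vimage_symmetric:
  fixes L :: "'a::euclidean_space \<Rightarrow> 'a"
  assumes L: "linear L" "inj L" and A: "A \<in> sets borel" and B: "B \<in> sets borel"
  shows "emeasure lborel (L -` A) * emeasure lborel B = emeasure lborel (L -` B) * emeasure lborel A"
proof -
  obtain L' where L': "linear L'" "L \<circ> L' = id"
    using linear_injective_isomorphism[OF L] by (auto simp: fun_eq_iff)
  have [measurable]: "L \<in> borel_measurable borel"
    using L(1) by (intro borel_measurable_continuous_onI linear_continuous_on linear_conv_bounded_linear[THEN iffD1])
  note A[measurable] B[measurable]
  have LA: "L -` A \<in> sets borel" "L -` B \<in> sets borel"
    using measurable_sets_borel[of L borel A] measurable_sets_borel[of L borel B] by simp_all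
  note LA[measurable]
  let ?f = "\<lambda>x y. indicator A (L x) * indicator B (L x + y) :: ennreal"
  have "(\<integral>\<^sup>+x. \<integral>\<^sup>+y. ?f x y \<partial>lborel \<partial>lborel) = (\<integral>\<^sup>+x. indicator (L -` A) x * emeasure lborel B \<partial>lborel)"
  proof (rule nn_integral_cong)
    fix x
    have "(\<integral>\<^sup>+y. ?f x y \<partial>lborel) = indicator A (L x) * (\<integral>\<^sup>+y. indicator B (L x + y) \<partial>lborel)"
      by (rule nn_integral_cmult) simp
    also have "(\<integral>\<^sup>+y. indicator B (L x + y) \<partial>lborel) = (\<integral>\<^sup>+y. indicator B y \<partial>distr lborel borel ((+) (L x)))"
      by (subst nn_integral_distr) auto
    also have "\<dots> = emeasure lborel B"
      by (simp add: lborel_distr_plus)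
    finally show "(\<integral>\<^sup>+y. ?f x y \<partial>lborel) = indicator (L -` A) x * emeasure lborel B"
      by (simp add: indicator_def)
  qed
  also have "\<dots> = emeasure lborel (L -` A) * emeasure lborel B"
    by (simp add: nn_integral_multc)
  finally have 1: "(\<integral>\<^sup>+x. \<integral>\<^sup>+y. ?f x y \<partial>lborel \<partial>lborel) = emeasure lborel (L -` A) * emeasure lborel B" .
  \<comment> \<open>In the other order, the translation \<open>x \<mapsto> x - L\<inverse> y\<close> moves the shift from \<open>B\<close> to \<open>A\<close>.\<close>
  have "(\<integral>\<^sup>+x. \<integral>\<^sup>+y. ?f x y \<partial>lborel \<partial>lborel) = (\<integral>\<^sup>+y. \<integral>\<^sup>+x. ?f x y \<partial>lborel \<partial>lborel)"
    by (rule lborel_pair.Fubini') measurable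
  also have "\<dots> = (\<integral>\<^sup>+y. \<integral>\<^sup>+x. indicator A (L x - y) * indicator B (L x) \<partial>lborel \<partial>lborel)"
  proof (rule nn_integral_cong)
    fix y
    have eq: "L (x - L' y) = L x - y" for x
      using L'(2) L(1) by (simp add: linear_add linear_diff linear_neg fun_eq_iff)
    have "(\<integral>\<^sup>+x. ?f x y \<partial>lborel) = (\<integral>\<^sup>+x. ?f x y \<partial>distr lborel borel ((+) (- L' y)))"
      by (simp add: lborel_distr_plus)
    also have "\<dots> = (\<integral>\<^sup>+x. indicator A (L x - y) * indicator B (L x) \<partial>lborel)"
      by (subst nn_integral_distr) (auto simp: eq)
    finally show "(\<integral>\<^sup>+x. ?f x y \<partial>lborel) = (\<integral>\<^sup>+x. indicator A (L x - y) * indicator B (L x) \<partial>lborel)" .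
  qed
  also have "\<dots> = (\<integral>\<^sup>+x. \<integral>\<^sup>+y. indicator A (L x - y) * indicator B (L x) \<partial>lborel \<partial>lborel)"
    by (rule lborel_pair.Fubini'[symmetric]) measurable
  also have "\<dots> = (\<integral>\<^sup>+x. indicator (L -` B) x * emeasure lborel A \<partial>lborel)"
  proof (rule nn_integral_cong)
    fix x
    have d: "distr lborel borel (\<lambda>y. L x - y) = (lborel :: 'a measure)"
    proof -
      have "density (distr lborel borel (\<lambda>y. L x - y)) (\<lambda>_. 1) = (lborel :: 'a measure)"
        using lborel_affine[of "-1::real" "L x"] by simp
      then show ?thesis
        by (simp only: density_1)
    qed
    have "(\<integral>\<^sup>+y. indicator A (L x - y) * indicator B (L x) \<partial>lborel) = (\<integral>\<^sup>+y. indicator A (L x - y) \<partial>lborel) * indicator B (L x)"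
      by (rule nn_integral_multc) simp
    also have "(\<integral>\<^sup>+y. indicator A (L x - y) \<partial>lborel) = (\<integral>\<^sup>+y. indicator A y \<partial>distr lborel borel (\<lambda>y. L x - y))"
      by (subst nn_integral_distr) auto
    also have "\<dots> = emeasure lborel A"
      unfolding d by simp
    finally show "(\<integral>\<^sup>+y. indicator A (L x - y) * indicator B (L x) \<partial>lborel) = indicator (L -` B) x * emeasure lborel A"
      by (simp add: indicator_def)
  qed
  also have "\<dots> = emeasure lborel (L -` B) * emeasure lborel A"
    by (simp add: nn_integral_multc)
  finally show ?thesis
    using 1 by simp
qed

lemma emeasure_lborel_vimage_plus:
  fixes A :: "'a::euclidean_space set"
  assumes "A \<in> sets borel"
  shows "emeasure lborel ((\<lambda>x. t + x) -` A) = emeasure lborel A"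
proof -
  have "emeasure lborel A = emeasure (distr lborel borel ((+) t)) A"
    by (simp add: lborel_distr_plus)
  also have "\<dots> = emeasure lborel ((+) t -` A)"
    using assms by (subst emeasure_distr) auto
  finally show ?thesis by simp
qed

lemma emeasure_affine_vimage:
  fixes L :: "'a::euclidean_space \<Rightarrow> 'a"
  assumes L: "linear L" "inj L"
  obtains c where "\<And>A. A \<in> sets borel \<Longrightarrow> emeasure lborel ((\<lambda>x. t + L x) -` A) = c * emeasure lborel A"
proof (rule that)
  fix A :: "'a set" assume A: "A \<in> sets borel"
  have [measurable]: "(+) t \<in> borel_measurable borel"
    by simp
  let ?A = "(+) t -` A"
  have A': "?A \<in> sets borel"
    using measurable_sets_borel[OF _ A, of "(+) t"] by simp
  have "emeasure lborel (L -` ?A) * emeasure lborel (cbox 0 One :: 'a set) =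
      emeasure lborel (L -` cbox 0 One) * emeasure lborel ?A"
    by (rule emeasure_linear_vimage_symmetric[OF L A']) simp
  moreover have "emeasure lborel (cbox 0 One::'a set) = 1"
    by (subst emeasure_lborel_cbox) auto
  moreover have "L -` ?A = (\<lambda>x. t + L x) -` A"
    by auto
  ultimately show "emeasure lborel ((\<lambda>x. t + L x) -` A) = emeasure lborel (L -` cbox 0 One) * emeasure lborel A"
    using emeasure_lborel_vimage_plus[OF A, of t] by simp
qed

text \<open>
  The map is an affine involution, so its volume factor \<open>c\<close> satisfies \<open>c\<^sup>2 = 1\<close>.  Exchanging two vertices of
  a simplex is of this form.
\<close>

lemma distr_lborel_affine_reflection:
  fixes g e :: "'a::euclidean_space"
  assumes "g \<bullet> e = 2"
  shows "distr lborel borel (\<lambda>x. x - (k + g \<bullet> x) *\<^sub>R e) = lborel"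
proof -
  let ?f = "\<lambda>x. x - (k + g \<bullet> x) *\<^sub>R e" and ?L = "\<lambda>x. x - (g \<bullet> x) *\<^sub>R e"
  have lin: "linear ?L"
    by (intro linearI) (auto simp: algebra_simps)
  have inv: "?L (?L x) = x" for x
    using assms by (simp add: inner_diff_right)
  have "inj ?L"
    by (rule inj_on_inverseI[where g = ?L]) (rule inv)
  have feq: "?f = (\<lambda>x. - (k *\<^sub>R e) + ?L x)"
    by (auto simp: algebra_simps)
  have finv: "?f (?f x) = x" for x
    using assms by (simp add: inner_diff_right algebra_simps flip: scaleR_add_left)
  have meas: "?f \<in> borel_measurable borel"
    by measurable
  obtain c where c: "\<And>A. A \<in> sets borel \<Longrightarrow> emeasure lborel (?f -` A) = c * emeasure lborel A"
    using emeasure_affine_vimage[OF lin \<open>inj ?L\<close>, of "- (k *\<^sub>R e)"] unfolding feq by metis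
  have "c = 1"
  proof -
    let ?B = "cbox 0 One :: 'a set"
    have B: "emeasure lborel ?B = 1"
      by (subst emeasure_lborel_cbox) auto
    have "?f -` ?B \<in> sets borel"
      using measurable_sets_borel[OF meas, of ?B] by simp
    then have "emeasure lborel (?f -` (?f -` ?B)) = c * (c * emeasure lborel ?B)"
      using c[of "?f -` ?B"] c[of ?B] by simp
    moreover have "?f -` (?f -` ?B) = ?B"
      by (simp only: vimage_def mem_Collect_eq finv Collect_mem_eq)
    ultimately have "c * c = 1"
      using B by simp
    then show "c = 1"
      by (cases c) (auto simp: ennreal_mult[symmetric] top_unique ennreal_eq_1 square_eq_1_iff)
  qed
  show ?thesis
  proof (rule measure_eqI)
    fix A assume "A \<in> sets (distr lborel borel ?f)"
    then have "A \<in> sets borel" by simp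
    then show "emeasure (distr lborel borel ?f) A = emeasure lborel A"
      using c[of A] \<open>c = 1\<close> meas by (subst emeasure_distr) auto
  qed simp
qed

text \<open>
  A shear is the composition of two affine reflections with the same functional.
\<close>

lemma emeasure_lborel_vimage_shear:
  fixes g w :: "'a::euclidean_space"
  assumes "g \<bullet> w = 0" and "g \<noteq> 0" and X: "X \<in> sets borel"
  shows "emeasure lborel ((\<lambda>x. x + (k + g \<bullet> x) *\<^sub>R w) -` X) = emeasure lborel X"
proof -
  define e where "e = (2 / (g \<bullet> g)) *\<^sub>R g"
  have e: "g \<bullet> e = 2"
    using assms(2) by (simp add: e_def)
  let ?f = "\<lambda>v x. x - (k + g \<bullet> x) *\<^sub>R v"
  have *: "emeasure lborel (?f v -` Y) = emeasure lborel Y" if "g \<bullet> v = 2" "Y \<in> sets borel" for v Y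
    using distr_lborel_affine_reflection[OF that(1), of k] that(2)
      emeasure_distr[of "?f v" lborel borel Y] by simp
  have "(\<lambda>x. x + (k + g \<bullet> x) *\<^sub>R w) -` X = ?f e -` (?f (e + w) -` X)"
  proof -
    have "?f (e + w) (?f e x) = x + (k + g \<bullet> x) *\<^sub>R w" for x
    proof -
      have "k + g \<bullet> ?f e x = - (k + g \<bullet> x)"
        using e by (simp add: inner_diff_right)
      then show ?thesis
        by (simp only: scaleR_minus_left scaleR_add_right) simp
    qed
    then show ?thesis
      by (simp only: vimage_def mem_Collect_eq)
  qed
  moreover have "?f (e + w) -` X \<in> sets borel"
    using measurable_sets_borel[OF _ X, of "?f (e + w)"] by simp
  moreover have "g \<bullet> (e + w) = 2"
    using e assms(1) by (simp add: inner_add_right)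
  ultimately show ?thesis
    using *[OF e] *[of "e + w" X] X by simp
qed

text \<open>
  The comparison of this volume with that of the standard simplex yields the area of a side of a
  simplex.
\<close>

lemma emeasure_lborel_prism:
  fixes b0 :: "'a::euclidean_space"
  assumes b0: "b0 \<in> Basis" and lu: "l \<le> u"
  shows "emeasure lborel {x::'a. l \<le> x \<bullet> b0 \<and> x \<bullet> b0 \<le> u \<and> (\<forall>b\<in>Basis - {b0}. 0 \<le> x \<bullet> b) \<and>
           (\<Sum>b\<in>Basis - {b0}. x \<bullet> b) \<le> 1} = ennreal ((u - l) / fact (DIM('a) - 1))"
    (is "emeasure lborel ?P = _")
proof -
  interpret product_sigma_finite "\<lambda>_::'a. lborel :: real measure"
    by standard
  define A where "A = Basis - {b0}"
  have fin: "finite A" "b0 \<notin> A" and ins: "Basis = insert b0 A" and cA: "card A = DIM('a) - 1"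
    using b0 by (auto simp: A_def)
  let ?M = "\<lambda>A::'a set. Pi\<^sub>M A (\<lambda>_. lborel :: real measure)"
  let ?S = "{x::'a \<Rightarrow> real. (\<forall>b\<in>A. 0 \<le> x b) \<and> sum x A \<le> 1}"
  let ?Q = "{x::'a \<Rightarrow> real. l \<le> x b0 \<and> x b0 \<le> u \<and> (\<forall>b\<in>A. 0 \<le> x b) \<and> sum x A \<le> 1}"
  have S: "?S \<inter> space (?M A) \<in> sets (?M A)"
  proof -
    have "?S \<inter> space (?M A) = Pi\<^sub>E A (\<lambda>_. {0..}) \<inter> (\<lambda>x. sum x A) -` {..1} \<inter> space (?M A)"
      by (auto simp: space_PiM)
    also have "\<dots> \<in> sets (?M A)"
      using fin by measurable
    finally show ?thesis .
  qed
  have Q: "?Q \<inter> space (?M (insert b0 A)) \<in> sets (?M (insert b0 A))"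
  proof -
    have "?Q \<inter> space (?M (insert b0 A)) = Pi\<^sub>E (insert b0 A) (\<lambda>b. if b = b0 then {l..u} else {0..})
        \<inter> ((\<lambda>x. sum x A) -` {..1} \<inter> space (?M (insert b0 A)))"
      using fin by (auto simp: space_PiM PiE_def Pi_def split: if_splits)
    also have "\<dots> \<in> sets (?M (insert b0 A))"
    proof (rule sets.Int)
      show "Pi\<^sub>E (insert b0 A) (\<lambda>b. if b = b0 then {l..u} else {0..}) \<in> sets (?M (insert b0 A))"
        using fin by (intro sets_PiM_I_finite) auto
      have "(\<lambda>x. sum x A) \<in> borel_measurable (?M (insert b0 A))"
        by measurable
      from measurable_sets[OF this, of "{..1}"]
      show "(\<lambda>x. sum x A) -` {..1} \<inter> space (?M (insert b0 A)) \<in> sets (?M (insert b0 A))" 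
        by simp
    qed
    finally show ?thesis .
  qed
  have "?P \<in> sets borel"
    by measurable
  have "emeasure lborel ?P = emeasure (distr (?M Basis) borel (\<lambda>f. \<Sum>b\<in>Basis. f b *\<^sub>R b)) ?P"
    by (subst lborel_eq) simp
  also have "\<dots> = emeasure (?M Basis) (?Q \<inter> space (?M Basis))"
    using \<open>?P \<in> sets borel\<close> b0
    by (subst emeasure_distr) (auto simp: A_def intro!: arg_cong[where f = "emeasure _"])
  also have "\<dots> = (\<integral>\<^sup>+x. indicator (?Q \<inter> space (?M (insert b0 A))) x \<partial>?M (insert b0 A))"
    using Q unfolding ins by (subst nn_integral_indicator) auto
  also have "\<dots> = (\<integral>\<^sup>+y. \<integral>\<^sup>+x. indicator (?Q \<inter> space (?M (insert b0 A))) (x(b0 := y)) \<partial>?M A \<partial>lborel)"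
    using Q fin by (intro product_nn_integral_insert_rev) auto
  also have "\<dots> = (\<integral>\<^sup>+y. indicator {l..u} y * (\<integral>\<^sup>+x. indicator (?S \<inter> space (?M A)) x \<partial>?M A) \<partial>lborel)"
  proof (rule nn_integral_cong)
    fix y :: real
    have s: "sum (x(b0 := y)) A = sum x A" for x
      by (rule sum.cong) (use fin in auto)
    have q: "x(b0 := y) \<in> ?Q \<inter> space (?M (insert b0 A)) \<longleftrightarrow> y \<in> {l..u} \<and> x \<in> ?S \<inter> space (?M A)"
      if "x \<in> space (?M A)" for x
      using fin that unfolding Int_iff mem_Collect_eq s by (auto simp: space_PiM PiE_def extensional_def)
    have "(\<integral>\<^sup>+x. indicator (?Q \<inter> space (?M (insert b0 A))) (x(b0 := y)) \<partial>?M A) =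
        (\<integral>\<^sup>+x. indicator {l..u} y * indicator (?S \<inter> space (?M A)) x \<partial>?M A)"
      using fin by (intro nn_integral_cong) (simp add: indicator_def q del: fun_upd_apply Int_iff)
    also have "\<dots> = indicator {l..u} y * (\<integral>\<^sup>+x. indicator (?S \<inter> space (?M A)) x \<partial>?M A)"
      using S by (intro nn_integral_cmult) auto
    finally show "(\<integral>\<^sup>+x. indicator (?Q \<inter> space (?M (insert b0 A))) (x(b0 := y)) \<partial>?M A) = \<dots>" .
  qed
  also have "(\<integral>\<^sup>+x. indicator (?S \<inter> space (?M A)) x \<partial>?M A) = ennreal (1 / fact (card A))"
    using S emeasure_std_simplex_aux[OF fin(1), of 1] by (subst nn_integral_indicator) auto
  also have "(\<integral>\<^sup>+y. indicator {l..u} y * ennreal (1 / fact (card A)) \<partial>lborel) =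
      emeasure lborel {l..u} * ennreal (1 / fact (card A))"
    by (subst nn_integral_multc) auto
  also have "\<dots> = ennreal ((u - l) / fact (DIM('a) - 1))"
    using lu by (simp add: cA ennreal_mult[symmetric])
  finally show ?thesis .
qed

section \<open>Barycentric coordinates\<close>

definition verts :: "'a::euclidean_space set \<Rightarrow> 'a set" where
  "verts K = {x. x extreme_point_of K}"

text \<open>
  The gradient of the barycentric coordinate of the vertex \<open>a\<close>.  The condition fixes the gradient
  uniquely on a nondegenerate simplex, because the edges at \<open>a\<close> span the space.
\<close>

definition bary_grad :: "'a::euclidean_space set \<Rightarrow> 'a \<Rightarrow> 'a" where
  "bary_grad T a = (SOME G. \<forall>b\<in>verts T - {a}. G \<bullet> (b - a) = -1)"

definition bary :: "'a::euclidean_space set \<Rightarrow> 'a \<Rightarrow> 'a \<Rightarrow> real" where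
  "bary T a x = 1 + bary_grad T a \<bullet> (x - a)"

definition opp_face :: "'a::euclidean_space set \<Rightarrow> 'a \<Rightarrow> 'a set" where
  "opp_face T a = convex hull (verts T - {a})"

lemma verts_convex_hull:
  assumes "\<not> affine_dependent C"
  shows "verts (convex hull C) = C"
  using extreme_point_of_convex_hull_affine_independent[OF assms] by (auto simp: verts_def)

locale full_simplex =
  fixes T :: "'a::euclidean_space set"
  assumes simplex: "int DIM('a) simplex T"
begin

abbreviation "V \<equiv> verts T"

lemma affine_independent_verts: "\<not> affine_dependent V"
  and card_verts: "card V = Suc DIM('a)"
  and hull_verts: "convex hull V = T"
proof -
  obtain C where C: "\<not> affine_dependent C" "int (card C) = int DIM('a) + 1" "T = convex hull C"
    using simplex by (auto simp: simplex_def)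
  then have "V = C"
    by (simp add: verts_convex_hull)
  with C show "\<not> affine_dependent V" "card V = Suc DIM('a)" "convex hull V = T"
    by simp_all
qed

lemma finite_verts [simp]: "finite V"
  using card_verts card.infinite by fastforce

lemma affine_hull_verts: "affine hull V = UNIV"
  using affine_independent_span_eq[OF affine_independent_verts card_verts] .

lemma bary_grad_inner:
  assumes "a \<in> V" "b \<in> V" "b \<noteq> a"
  shows "bary_grad T a \<bullet> (b - a) = -1"
proof -
  let ?B = "(\<lambda>b. b - a) ` (V - {a})"
  have "insert a (V - {a}) = V"
    using assms by auto
  then have "independent ?B"
    using affine_dependent_iff_dependent2[OF assms(1)] affine_independent_verts by simp
  then obtain h :: "'a \<Rightarrow> real" where h: "linear h" "\<forall>x\<in>?B. h x = -1"
    using linear_independent_extend[of ?B "\<lambda>_. -1::real"] by auto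
  have "h x = adjoint h 1 \<bullet> x" for x
    using adjoint_works[OF h(1), of x 1] by (simp add: inner_commute)
  then have "\<exists>G. \<forall>b\<in>V - {a}. G \<bullet> (b - a) = -1"
    using h(2) by (intro exI[of _ "adjoint h 1"]) (metis imageI)
  from someI_ex[OF this] show ?thesis
    using assms by (auto simp: bary_grad_def)
qed

lemma bary_vertex: "a \<in> V \<Longrightarrow> b \<in> V \<Longrightarrow> bary T a b = (if a = b then 1 else 0)"
  by (simp add: bary_def bary_grad_inner)

lemma bary_diff: "bary T a x - bary T a y = bary_grad T a \<bullet> (x - y)"
  by (simp add: bary_def inner_diff_right)

lemma bary_affine_combination:
  assumes "a \<in> V" "sum u V = 1"
  shows "bary T a (\<Sum>b\<in>V. u b *\<^sub>R b) = u a"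
proof -
  have "bary T a (\<Sum>b\<in>V. u b *\<^sub>R b) = 1 + (\<Sum>b\<in>V. u b * (bary_grad T a \<bullet> b)) - bary_grad T a \<bullet> a"
    by (simp add: bary_def inner_diff_right inner_sum_right)
  also have "\<dots> = (\<Sum>b\<in>V. u b * bary T a b)"
  proof -
    have "(\<Sum>b\<in>V. u b * bary T a b) = (\<Sum>b\<in>V. u b * (1 - bary_grad T a \<bullet> a) + u b * (bary_grad T a \<bullet> b))"
      by (rule sum.cong) (auto simp: bary_def inner_diff_right algebra_simps)
    then show ?thesis
      using assms(2) by (simp add: sum.distrib flip: sum_distrib_right)
  qed
  also have "\<dots> = (\<Sum>b\<in>V. if a = b then u a else 0)"
    using assms(1) by (intro sum.cong) (auto simp: bary_vertex)
  finally show ?thesis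
    using assms(1) by simp
qed

lemma sum_bary: "(\<Sum>a\<in>V. bary T a x) = 1" (is ?A)
  and sum_bary_scaleR: "(\<Sum>a\<in>V. bary T a x *\<^sub>R a) = x" (is ?B)
proof -
  have "x \<in> affine hull V"
    by (simp add: affine_hull_verts)
  then obtain u where u: "sum u V = 1" "(\<Sum>b\<in>V. u b *\<^sub>R b) = x"
    by (auto simp: affine_hull_finite)
  then have "bary T a x = u a" if "a \<in> V" for a
    using bary_affine_combination[OF that u(1)] by simp
  with u show ?A ?B
    by (simp_all cong: sum.cong)
qed

lemma sum_bary_grad: "(\<Sum>a\<in>V. bary_grad T a) = 0"
proof -
  have "(\<Sum>a\<in>V. bary_grad T a) \<bullet> y = 0" for y
  proof -
    have "(\<Sum>a\<in>V. bary_grad T a) \<bullet> y = (\<Sum>a\<in>V. bary T a y - bary T a 0)"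
      by (simp add: inner_sum_left bary_diff)
    also have "\<dots> = 0"
      by (simp add: sum_subtractf sum_bary)
    finally show ?thesis .
  qed
  from this[of "\<Sum>a\<in>V. bary_grad T a"] show ?thesis
    by simp
qed

lemma affine_eq_sum_bary:
  assumes "linear A"
  shows "A x + c = (\<Sum>a\<in>V. bary T a x *\<^sub>R (A a + c))"
proof -
  have "A x = A (\<Sum>a\<in>V. bary T a x *\<^sub>R a)"
    by (simp add: sum_bary_scaleR)
  also have "\<dots> = (\<Sum>a\<in>V. bary T a x *\<^sub>R A a)"
    by (simp add: linear_sum[OF assms] linear_scale[OF assms])
  finally show ?thesis
    using sum_bary[of x] by (simp add: scaleR_add_right sum.distrib flip: scaleR_left.sum)
qed

text \<open>
  The constant \<open>c\<close> is arbitrary since the gradients of the barycentric coordinates add up to zero; it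
  allows the values of an affine function to be used directly.
\<close>

lemma linear_eq_sum_bary_grad:
  assumes "linear A"
  shows "A x = (\<Sum>a\<in>V. (bary_grad T a \<bullet> x) *\<^sub>R (A a + c))"
proof -
  have "A x = (A x + c) - (A 0 + c)"
    using linear_0[OF assms] by simp
  also have "\<dots> = (\<Sum>a\<in>V. (bary T a x - bary T a 0) *\<^sub>R (A a + c))"
    using affine_eq_sum_bary[OF assms, of x c] affine_eq_sum_bary[OF assms, of 0 c]
    by (simp only: scaleR_diff_left sum_subtractf)
  finally show ?thesis
    unfolding bary_diff diff_0_right .
qed

lemma mem_iff_bary: "x \<in> T \<longleftrightarrow> (\<forall>a\<in>V. 0 \<le> bary T a x)"
proof
  assume "x \<in> T"
  then have "x \<in> convex hull V"
    by (simp add: hull_verts)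
  then obtain u where u: "\<forall>a\<in>V. 0 \<le> u a" "sum u V = 1" "(\<Sum>b\<in>V. u b *\<^sub>R b) = x"
    by (auto simp: convex_hull_finite)
  then show "\<forall>a\<in>V. 0 \<le> bary T a x"
    using bary_affine_combination[OF _ u(2)] by metis
next
  assume "\<forall>a\<in>V. 0 \<le> bary T a x"
  then have "x \<in> convex hull V"
    using sum_bary sum_bary_scaleR by (auto simp: convex_hull_finite intro!: exI[of _ "\<lambda>a. bary T a x"])
  then show "x \<in> T"
    by (simp add: hull_verts)
qed

lemma interior_iff_bary: "x \<in> interior T \<longleftrightarrow> (\<forall>a\<in>V. 0 < bary T a x)"
proof -
  have "interior T = interior (convex hull V)"
    by (simp add: hull_verts)
  also have "\<dots> = {y. \<exists>u. (\<forall>x\<in>V. 0 < u x) \<and> sum u V = 1 \<and> (\<Sum>x\<in>V. u x *\<^sub>R x) = y}"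
    using interior_convex_hull_explicit_minimal[OF affine_independent_verts] card_verts by simp
  finally have "x \<in> interior T \<longleftrightarrow> (\<exists>u. (\<forall>x\<in>V. 0 < u x) \<and> sum u V = 1 \<and> (\<Sum>x\<in>V. u x *\<^sub>R x) = x)"
    by simp
  moreover have "(\<forall>a\<in>V. 0 < bary T a x)" if "\<forall>x\<in>V. 0 < u x" "sum u V = 1" "(\<Sum>x\<in>V. u x *\<^sub>R x) = x" for u
    using that bary_affine_combination[OF _ that(2)] by metis
  moreover have "\<exists>u. (\<forall>x\<in>V. 0 < u x) \<and> sum u V = 1 \<and> (\<Sum>x\<in>V. u x *\<^sub>R x) = x" if "\<forall>a\<in>V. 0 < bary T a x"
    using that sum_bary sum_bary_scaleR by (intro exI[of _ "\<lambda>a. bary T a x"]) auto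
  ultimately show ?thesis
    by blast
qed

lemma opp_iff_bary:
  assumes "a \<in> V"
  shows "x \<in> opp_face T a \<longleftrightarrow> bary T a x = 0 \<and> (\<forall>b\<in>V - {a}. 0 \<le> bary T b x)"
    and "x \<in> rel_interior (opp_face T a) \<longleftrightarrow> bary T a x = 0 \<and> (\<forall>b\<in>V - {a}. 0 < bary T b x)"
proof -
  have to: "bary T a x = 0 \<and> (\<forall>b\<in>V - {a}. bary T b x = u b)"
    if u: "sum u (V - {a}) = 1" "(\<Sum>b\<in>V - {a}. u b *\<^sub>R b) = x" for u
  proof -
    let ?u = "u(a := 0)"
    have "sum ?u (V - {a}) = sum u (V - {a})"
      "(\<Sum>b\<in>V - {a}. ?u b *\<^sub>R b) = (\<Sum>b\<in>V - {a}. u b *\<^sub>R b)"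
      by (rule sum.cong; simp)+
    with u have s: "sum ?u V = 1" and "(\<Sum>b\<in>V. ?u b *\<^sub>R b) = x"
      by (simp_all add: sum.remove[OF finite_verts assms])
    then have "bary T b x = ?u b" if "b \<in> V" for b
      using bary_affine_combination[OF that s] by simp
    then show ?thesis
      using assms by simp
  qed
  have coord: "sum (\<lambda>b. bary T b x) (V - {a}) = 1" "(\<Sum>b\<in>V - {a}. bary T b x *\<^sub>R b) = x"
    if "bary T a x = 0"
    using sum_bary[of x] sum_bary_scaleR[of x] that sum.remove[OF finite_verts assms, of "\<lambda>b. bary T b x"]
      sum.remove[OF finite_verts assms, of "\<lambda>b. bary T b x *\<^sub>R b"] by simp_all
  have hull: "(\<exists>u. (\<forall>b\<in>V - {a}. P (u b)) \<and> sum u (V - {a}) = 1 \<and> (\<Sum>b\<in>V - {a}. u b *\<^sub>R b) = x) \<longleftrightarrow>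
      bary T a x = 0 \<and> (\<forall>b\<in>V - {a}. P (bary T b x))" (is "?L \<longleftrightarrow> ?R") for P
  proof
    assume ?L
    then obtain u where u: "\<forall>b\<in>V - {a}. P (u b)" "sum u (V - {a}) = 1" "(\<Sum>b\<in>V - {a}. u b *\<^sub>R b) = x"
      by blast
    show ?R
      using to[OF u(2,3)] u(1) by metis
  next
    assume ?R
    then show ?L
      using coord by (intro exI[of _ "\<lambda>b. bary T b x"]) simp
  qed
  show "x \<in> opp_face T a \<longleftrightarrow> bary T a x = 0 \<and> (\<forall>b\<in>V - {a}. 0 \<le> bary T b x)"
    unfolding opp_face_def convex_hull_finite[OF finite_Diff[OF finite_verts]] using hull[of "\<lambda>r. 0 \<le> r"]
    by simp
  have indep: "\<not> affine_dependent (V - {a})"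
    using affine_independent_verts affine_independent_subset by blast
  show "x \<in> rel_interior (opp_face T a) \<longleftrightarrow> bary T a x = 0 \<and> (\<forall>b\<in>V - {a}. 0 < bary T b x)"
    unfolding opp_face_def rel_interior_convex_hull_explicit[OF indep] using hull[of "\<lambda>r. 0 < r"]
    by simp
qed

lemma opp_subset: "a \<in> V \<Longrightarrow> opp_face T a \<subseteq> T"
  by (metis Diff_subset hull_mono hull_verts opp_face_def)

lemma verts_opp: "a \<in> V \<Longrightarrow> verts (opp_face T a) = V - {a}"
  unfolding opp_face_def using affine_independent_verts affine_independent_subset
  by (intro verts_convex_hull) blast

lemma card_verts_minus: "a \<in> V \<Longrightarrow> card (V - {a}) = DIM('a)"
  by (simp add: card_verts)

lemma verts_minus_nonempty: "a \<in> V \<Longrightarrow> V - {a} \<noteq> {}"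
  using card_verts_minus[of a] by (metis card.empty DIM_positive less_irrefl)

lemma facet_iff: "S facet_of T \<longleftrightarrow> (\<exists>a\<in>V. S = opp_face T a)"
proof -
  have "S facet_of T \<longleftrightarrow> S \<noteq> {} \<and> (\<exists>a\<in>V. S = opp_face T a)"
    using facet_of_convex_hull_affine_independent[OF affine_independent_verts, of S]
    unfolding hull_verts opp_face_def by blast
  moreover have "opp_face T a \<noteq> {}" if "a \<in> V" for a
    using verts_minus_nonempty[OF that] by (simp add: opp_face_def)
  ultimately show ?thesis by auto
qed

lemma inj_on_opp: "inj_on (opp_face T) V"
proof (rule inj_onI)
  fix a b assume "a \<in> V" "b \<in> V" "opp_face T a = opp_face T b"
  then have "V - {a} = V - {b}"
    using verts_opp by metis
  with \<open>a \<in> V\<close> show "a = b" by blast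
qed

lemma facets_eq: "{S. S facet_of T} = opp_face T ` V"
  by (auto simp: facet_iff)

lemma sum_facets: "(\<Sum>S | S facet_of T. h S) = (\<Sum>a\<in>V. h (opp_face T a))"
  unfolding facets_eq by (subst sum.reindex[OF inj_on_opp]) simp

lemma verts_subset: "V \<subseteq> T"
  using hull_subset[of V convex] by (simp add: hull_verts)

lemma compact: "compact T" and closed: "closed T" and convex: "convex T"
  using simplex compact_simplex closed_simplex convex_simplex by blast+

lemma interior_nonempty: "interior T \<noteq> {}"
proof -
  have "(\<Sum>b\<in>V. (1 / card V) *\<^sub>R b) \<in> interior T"
    unfolding interior_iff_bary
  proof
    fix a assume "a \<in> V"
    then show "0 < bary T a (\<Sum>b\<in>V. (1 / card V) *\<^sub>R b)"
      by (subst bary_affine_combination) (auto simp: card_verts)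
  qed
  then show ?thesis by auto
qed

lemma closure_interior: "closure (interior T) = T"
  using convex_closure_interior[OF convex interior_nonempty] closed by simp

lemma bary_grad_nonzero: "a \<in> V \<Longrightarrow> bary_grad T a \<noteq> 0"
proof
  assume "a \<in> V" "bary_grad T a = 0"
  moreover obtain b where "b \<in> V - {a}"
    using verts_minus_nonempty[OF \<open>a \<in> V\<close>] by blast
  ultimately show False
    using bary_grad_inner[of a b] by simp
qed

lemma bary_grad_inner_opp:
  assumes "a \<in> V" "x \<in> opp_face T a" "y \<in> opp_face T a"
  shows "bary_grad T a \<bullet> (y - x) = 0"
  using assms opp_iff_bary(1)[OF assms(1)] bary_diff[of a y x] by simp

text \<open>
  The vectors orthogonal to a side form a line, spanned by the gradient of the opposite barycentric
  coordinate.  All normals of sides below are identified in this way.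
\<close>

lemma orthogonal_opp_eq_bary_grad:
  assumes a: "a \<in> V" and n: "\<And>x y. x \<in> opp_face T a \<Longrightarrow> y \<in> opp_face T a \<Longrightarrow> n \<bullet> (y - x) = 0" and b: "b \<in> V - {a}"
  shows "n = (n \<bullet> (a - b)) *\<^sub>R bary_grad T a"
proof -
  have ve: "n \<bullet> x = n \<bullet> b" if "x \<in> V - {a}" for x
    using n[of b x] b that hull_subset[of "V - {a}" convex] by (auto simp: opp_face_def inner_diff_right)
  have "n \<bullet> x = ((n \<bullet> (a - b)) *\<^sub>R bary_grad T a) \<bullet> x" for x
  proof -
    have "n \<bullet> x = (\<Sum>c\<in>V. (bary_grad T c \<bullet> x) * (n \<bullet> c - n \<bullet> b))"
      using linear_eq_sum_bary_grad[of "\<lambda>x. n \<bullet> x" x "- (n \<bullet> b)"] by (simp add: bounded_linear_inner_right bounded_linear.linear)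
    also have "\<dots> = (bary_grad T a \<bullet> x) * (n \<bullet> a - n \<bullet> b)"
      using ve by (simp add: sum.remove[OF finite_verts a])
    finally show ?thesis
      by (simp add: inner_diff_right)
  qed
  then show ?thesis
    by (metis vector_eq_rdot)
qed

lemma outer_normal_opp:
  assumes a: "a \<in> V"
  shows "outer_normal T (opp_face T a) = - bary_grad T a /\<^sub>R norm (bary_grad T a)"
  unfolding outer_normal_def
proof (rule the_equality)
  let ?n = "- bary_grad T a /\<^sub>R norm (bary_grad T a)"
  have "bary_grad T a \<bullet> (y - x) \<ge> 0" if "x \<in> opp_face T a" "y \<in> T" for x y
  proof -
    have "bary T a x = 0" "bary T a y \<ge> 0"
      using opp_iff_bary(1)[OF a, THEN iffD1, OF that(1)] mem_iff_bary[THEN iffD1, OF that(2)] a by simp_all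
    then show ?thesis
      using bary_diff[of a y x] by simp
  qed
  then show "norm ?n = 1 \<and> (\<forall>x\<in>opp_face T a. \<forall>y\<in>T. ?n \<bullet> (y - x) \<le> 0)"
    using bary_grad_nonzero[OF a] by simp
next
  fix n assume n: "norm n = 1 \<and> (\<forall>x\<in>opp_face T a. \<forall>y\<in>T. n \<bullet> (y - x) \<le> 0)"
  obtain b where b: "b \<in> V - {a}"
    using verts_minus_nonempty[OF a] by blast
  have "n \<bullet> (y - x) = 0" if "x \<in> opp_face T a" "y \<in> opp_face T a" for x y
  proof -
    have "n \<bullet> (y - x) \<le> 0" "n \<bullet> (x - y) \<le> 0"
      using n that opp_subset[OF a] by blast+
    then show ?thesis by (simp add: inner_diff_right)
  qed
  from orthogonal_opp_eq_bary_grad[OF a this b]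
  obtain r where r: "r = n \<bullet> (a - b)" "n = r *\<^sub>R bary_grad T a"
    by blast
  have "b \<in> opp_face T a"
    using b hull_subset[of "V - {a}" convex] by (auto simp: opp_face_def)
  then have "r \<le> 0"
    unfolding r(1) using n a verts_subset by blast
  moreover have "\<bar>r\<bar> * norm (bary_grad T a) = 1"
    using n r(2) by simp
  ultimately have "(- r) * norm (bary_grad T a) = 1"
    by simp
  then have "inverse (norm (bary_grad T a)) = - r"
    by (metis inverse_unique mult.commute)
  then show "n = - bary_grad T a /\<^sub>R norm (bary_grad T a)"
    unfolding r(2) by (simp only: scaleR_minus_left scaleR_minus_right minus_minus)
qed

end

section \<open>Mean values over a simplex\<close>

text \<open>
  Traces and element-wise polynomials are arbitrary on a null set, so they need not be Borel
  measurable; completeness of the measure makes an almost everywhere comparison sufficient.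
\<close>

lemma integral_completion_cong_AE:
  fixes f g :: "'a \<Rightarrow> 'b::{banach, second_countable_topology}"
  assumes g: "g \<in> borel_measurable M" and eq: "AE x in M. f x = g x"
  shows "integral\<^sup>L (completion M) f = integral\<^sup>L M g"
proof -
  have g': "g \<in> borel_measurable (completion M)"
    using g by (rule measurable_completion)
  have eq': "AE x in completion M. f x = g x"
    using eq by (rule AE_completion)
  have "f \<in> borel_measurable (completion M)"
  proof (rule measurableI)
    fix B :: "'b set" assume "B \<in> sets borel"
    then have A: "g -` B \<inter> space (completion M) \<in> sets (completion M)"
      by (rule measurable_sets[OF g'])
    have ae: "AE x in completion M. x \<in> g -` B \<inter> space (completion M) \<longleftrightarrow> x \<in> f -` B \<inter> space (completion M)"
      using eq' by eventually_elim auto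
    show "f -` B \<inter> space (completion M) \<in> sets (completion M)"
      by (rule completion.in_sets_AE[OF ae A]) (rule Int_lower2)
  qed simp
  then have "integral\<^sup>L (completion M) f = integral\<^sup>L (completion M) g"
    using g' eq' by (rule integral_cong_AE)
  then show ?thesis
    using g by (simp add: integral_completion)
qed

lemma integral_affine_reflection:
  fixes h :: "'a::euclidean_space \<Rightarrow> real"
  assumes "g \<bullet> e = 2" "h \<in> borel_measurable borel"
  shows "(\<integral>x. h (x - (k + g \<bullet> x) *\<^sub>R e) \<partial>lborel) = (\<integral>x. h x \<partial>lborel)"
proof -
  have "(\<integral>x. h x \<partial>distr lborel borel (\<lambda>x. x - (k + g \<bullet> x) *\<^sub>R e)) =
      (\<integral>x. h (x - (k + g \<bullet> x) *\<^sub>R e) \<partial>lborel)"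
    using assms(2) by (intro integral_distr) auto
  then show ?thesis
    by (simp add: distr_lborel_affine_reflection[OF assms(1)])
qed

lemma continuous_on_bary [continuous_intros]:
  "continuous_on A f \<Longrightarrow> continuous_on A (\<lambda>x. bary T a (f x))"
  unfolding bary_def by (intro continuous_intros)

lemma borel_measurable_bary [measurable]:
  "bary T a \<in> borel_measurable borel"
  by (intro borel_measurable_continuous_onI continuous_intros)

definition volume :: "'a::euclidean_space set \<Rightarrow> real" where
  "volume K = measure lebesgue K"

context full_simplex
begin

lemma borel_T [measurable]: "T \<in> sets borel"
  using closed by auto

lemma emeasure_T: "emeasure lborel T = ennreal (volume T)"
proof -
  have "emeasure lborel T < \<infinity>"
    using emeasure_bounded_finite[OF compact_imp_bounded[OF compact]] .
  then have "emeasure lborel T = ennreal (measure lborel T)"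
    by (intro emeasure_eq_ennreal_measure) auto
  then show ?thesis
    by (simp add: volume_def)
qed

lemma volume_pos: "0 < volume T"
proof -
  have "\<not> negligible T"
    using interior_nonempty negligible_subset open_not_negligible interior_subset open_interior by metis
  then have "measure lebesgue T \<noteq> 0"
    using negligible_iff_measure0 lmeasurable_compact[OF compact] by blast
  then show ?thesis
    using measure_nonneg[of lebesgue T] unfolding volume_def by linarith
qed

lemma AE_interior: "AE x in lborel. x \<in> T \<longrightarrow> x \<in> interior T"
proof -
  have "negligible (frontier T)"
    by (rule negligible_convex_frontier[OF convex])
  then have "frontier T \<in> null_sets lborel"
    using closed by (auto simp: negligible_iff_null_sets frontier_def null_sets_completion_iff)
  from AE_not_in[OF this] show ?thesis
    by eventually_elim (use closed in \<open>auto simp: frontier_def\<close>)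
qed

text \<open>
  Exchanging \<open>a\<close> and \<open>b\<close> moves points in the direction \<open>a - b\<close>, along which only the coordinates of
  \<open>a\<close> and \<open>b\<close> vary.
\<close>

lemma vertex_differences:
  assumes "a \<in> V" "b \<in> V" "a \<noteq> b" "c \<in> V"
  shows "bary_grad T c \<bullet> (a - b) = (if c = a then 1 else if c = b then -1 else 0)"
  using bary_diff[of c a b] assms by (auto simp: bary_vertex)

lemma integrable_bary: "integrable lborel (\<lambda>x. indicator T x * bary T a x)"
  using borel_integrable_compact[OF compact, of "bary T a"] continuous_on_bary[of T "\<lambda>x. x" T a]
  by simp

text \<open>
  The reflection that exchanges two vertices preserves both \<open>T\<close> and Lebesgue measure, so all
  barycentric coordinates have the same integral, and they add up to one.
\<close>

lemma integral_bary:
  assumes a: "a \<in> V"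
  shows "(\<integral>x. indicator T x * bary T a x \<partial>lborel) = volume T / (DIM('a) + 1)"
proof -
  let ?I = "\<lambda>a. \<integral>x. indicator T x * bary T a x \<partial>lborel"
  have eq: "?I b = ?I a" if b: "b \<in> V" "b \<noteq> a" for b
  proof -
    define g where "g = bary_grad T a - bary_grad T b"
    define k where "k = bary T a 0 - bary T b 0"
    let ?f = "\<lambda>x. x - (k + g \<bullet> x) *\<^sub>R (a - b)"
    have kg: "k + g \<bullet> x = bary T a x - bary T b x" for x
      by (simp add: k_def g_def bary_def inner_diff_left inner_diff_right)
    have ge: "g \<bullet> (a - b) = 2"
      using vertex_differences[of a b a] vertex_differences[of a b b] a b
      by (simp add: g_def inner_diff_left)
    have f: "bary T c (?f x) = bary T c x - (bary T a x - bary T b x) * (if c = a then 1 else if c = b then -1 else 0)"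
      if "c \<in> V" for c x
      using bary_diff[of c "?f x" x] vertex_differences[of a b c] a b that unfolding kg by (auto simp: algebra_simps)
    have "?f x \<in> T \<longleftrightarrow> x \<in> T" for x
    proof -
      have "?f x \<in> T \<longleftrightarrow> 0 \<le> bary T a (?f x) \<and> 0 \<le> bary T b (?f x) \<and> (\<forall>c\<in>V - {a,b}. 0 \<le> bary T c (?f x))"
        unfolding mem_iff_bary using a b by blast
      also have "\<dots> \<longleftrightarrow> 0 \<le> bary T b x \<and> 0 \<le> bary T a x \<and> (\<forall>c\<in>V - {a,b}. 0 \<le> bary T c x)"
        using a b by (simp add: f)
      also have "\<dots> \<longleftrightarrow> x \<in> T"
        unfolding mem_iff_bary using a b by blast
      finally show ?thesis .
    qed
    moreover have "bary T a (?f x) = bary T b x" for x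
      using a by (simp add: f)
    ultimately have "indicator T (?f x) * bary T a (?f x) = indicator T x * bary T b x" for x
      by (simp add: indicator_def)
    then show ?thesis
      using integral_affine_reflection[OF ge, of "\<lambda>x. indicator T x * bary T a x" k] by simp
  qed
  have "volume T = (\<integral>x. indicator T x \<partial>lborel)"
    by (simp add: volume_def)
  also have "\<dots> = (\<integral>x. (\<Sum>c\<in>V. indicator T x * bary T c x) \<partial>lborel)"
    by (simp add: sum_bary flip: sum_distrib_left)
  also have "\<dots> = (\<Sum>c\<in>V. ?I c)"
    by (rule Bochner_Integration.integral_sum) (rule integrable_bary)
  also have "\<dots> = (\<Sum>c\<in>V. ?I a)"
    using eq by (intro sum.cong) auto
  finally show ?thesis
    by (simp add: card_verts field_simps)
qed

lemma integral_affine: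
  fixes v :: "'a \<Rightarrow> 'b::euclidean_space"
  assumes A: "linear A" and v: "\<And>x. x \<in> interior T \<Longrightarrow> v x = A x + c"
  shows "(\<integral>x. v x \<partial>lebesgue_on T) = (volume T / (DIM('a) + 1)) *\<^sub>R (\<Sum>a\<in>V. A a + c)"
proof -
  have [measurable]: "A \<in> borel_measurable borel"
    using A by (intro borel_measurable_continuous_onI linear_continuous_on linear_conv_bounded_linear[THEN iffD1])
  have "(\<integral>x. v x \<partial>lebesgue_on T) = (\<integral>x. indicator T x *\<^sub>R v x \<partial>lebesgue)"
    by (rule integral_restrict_space) simp
  also have "\<dots> = (\<integral>x. indicator T x *\<^sub>R (A x + c) \<partial>lborel)"
  proof (rule integral_completion_cong_AE)
    show "AE x in lborel. indicator T x *\<^sub>R v x = indicator T x *\<^sub>R (A x + c)"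
      using AE_interior by eventually_elim (auto simp: v indicator_def)
  qed measurable
  also have "\<dots> = (\<integral>x. (\<Sum>a\<in>V. (indicator T x * bary T a x) *\<^sub>R (A a + c)) \<partial>lborel)"
    by (subst affine_eq_sum_bary[OF A]) (simp add: scaleR_sum_right)
  also have "\<dots> = (\<Sum>a\<in>V. (\<integral>x. (indicator T x * bary T a x) *\<^sub>R (A a + c) \<partial>lborel))"
    by (rule Bochner_Integration.integral_sum) (intro integrable_scaleR_left integrable_bary)
  also have "\<dots> = (\<Sum>a\<in>V. (volume T / (DIM('a) + 1)) *\<^sub>R (A a + c))"
    by (rule sum.cong) (simp_all add: integrable_bary integral_bary)
  finally show ?thesis
    by (simp add: scaleR_sum_right)
qed

end

section \<open>Surface measure of a side\<close>

definition side_area :: "'a::euclidean_space set \<Rightarrow> real" where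
  "side_area K = measure (side_measure K) (space (side_measure K))"

locale simplex_side = full_simplex +
  fixes a
  assumes a: "a \<in> verts T"
begin

definition S where "S = opp_face T a"
text \<open>
  The projection \<open>P\<close> onto the hyperplane of the side is expressed through the barycentric coordinate of the
  opposite vertex, whose slope in normal direction is \<open>\<sigma>\<close>.
\<close>

definition \<nu> where "\<nu> = side_normal S"
definition \<sigma> where "\<sigma> = bary_grad T a \<bullet> \<nu>"
definition P where "P x = x - (bary T a x / \<sigma>) *\<^sub>R \<nu>"

lemma side_normal_properties: "norm \<nu> = 1" "x \<in> S \<Longrightarrow> y \<in> S \<Longrightarrow> \<nu> \<bullet> (y - x) = 0"
proof -
  let ?n = "inverse (norm (bary_grad T a)) *\<^sub>R bary_grad T a"
  have "norm ?n = 1 \<and> (\<forall>x\<in>S. \<forall>y\<in>S. ?n \<bullet> (y - x) = 0)"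
    using bary_grad_nonzero[OF a] bary_grad_inner_opp[OF a] by (simp add: S_def)
  then have "norm \<nu> = 1 \<and> (\<forall>x\<in>S. \<forall>y\<in>S. \<nu> \<bullet> (y - x) = 0)"
    unfolding \<nu>_def side_normal_def by (rule someI)
  then show "norm \<nu> = 1" "x \<in> S \<Longrightarrow> y \<in> S \<Longrightarrow> \<nu> \<bullet> (y - x) = 0"
    by auto
qed

abbreviation "cyl \<equiv> side_cylinder S"
abbreviation "\<mu> \<equiv> distr (restrict_space lborel cyl) borel (closest_point (affine hull S))"

lemma abs_sigma: "\<bar>\<sigma>\<bar> = norm (bary_grad T a)" and sigma_nonzero: "\<sigma> \<noteq> 0"
proof -
  obtain b where "b \<in> V - {a}"
    using verts_minus_nonempty[OF a] by blast
  then obtain r where r: "\<nu> = r *\<^sub>R bary_grad T a"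
    using orthogonal_opp_eq_bary_grad[OF a, of \<nu>] side_normal_properties(2) by (metis S_def)
  have "\<bar>r\<bar> * norm (bary_grad T a) = 1"
    using side_normal_properties(1) unfolding r by simp
  then show *: "\<bar>\<sigma>\<bar> = norm (bary_grad T a)"
    by (simp add: \<sigma>_def r abs_mult dot_square_norm power2_eq_square flip: mult.assoc)
  show "\<sigma> \<noteq> 0"
    using * bary_grad_nonzero[OF a] by auto
qed

lemma bary_P: "bary T c (P x) = bary T c x - (bary T a x / \<sigma>) * (bary_grad T c \<bullet> \<nu>)"
  using bary_diff[of c "P x" x] by (simp add: P_def)

lemma bary_P_same: "bary T a (P x) = 0"
  using sigma_nonzero by (simp add: bary_P flip: \<sigma>_def)

lemma P_in_S_iff: "P x \<in> S \<longleftrightarrow> (\<forall>b\<in>V - {a}. 0 \<le> bary T b (P x))"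
  by (simp add: S_def opp_iff_bary(1)[OF a] bary_P_same)

lemma P_of_S: "P (x + t *\<^sub>R \<nu>) = x" if "x \<in> S"
proof -
  have "bary T a (x + t *\<^sub>R \<nu>) = t * \<sigma>"
    using bary_diff[of a "x + t *\<^sub>R \<nu>" x] that opp_iff_bary(1)[OF a]
    by (simp add: \<sigma>_def S_def)
  then show ?thesis
    using sigma_nonzero by (simp add: P_def)
qed

lemma cylinder_iff: "x \<in> cyl \<longleftrightarrow> 0 \<le> bary T a x / \<sigma> \<and> bary T a x / \<sigma> \<le> 1 \<and> P x \<in> S"
proof
  assume "x \<in> cyl"
  then obtain y t where yt: "x = y + t *\<^sub>R \<nu>" "y \<in> S" "0 \<le> t" "t \<le> 1"
    by (auto simp: side_cylinder_def \<nu>_def)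
  moreover have "bary T a x / \<sigma> = t"
    using bary_diff[of a x y] yt opp_iff_bary(1)[OF a, of y] sigma_nonzero
    by (simp add: \<sigma>_def S_def)
  ultimately show "0 \<le> bary T a x / \<sigma> \<and> bary T a x / \<sigma> \<le> 1 \<and> P x \<in> S"
    by (simp add: P_of_S)
next
  assume "0 \<le> bary T a x / \<sigma> \<and> bary T a x / \<sigma> \<le> 1 \<and> P x \<in> S"
  moreover have "x = P x + (bary T a x / \<sigma>) *\<^sub>R \<nu>"
    by (simp add: P_def)
  ultimately show "x \<in> cyl"
    unfolding side_cylinder_def \<nu>_def by blast
qed

lemma compact_S: "compact S"
  unfolding S_def opp_face_def by (intro finite_imp_compact_convex_hull) simp

lemma compact_cylinder: "compact cyl"
proof -
  have "cyl = (\<lambda>(x, t). x + t *\<^sub>R \<nu>) ` (S \<times> {0..1})"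
    unfolding side_cylinder_def \<nu>_def by (fastforce simp: image_iff)
  also have "compact \<dots>"
    by (intro compact_continuous_image compact_Times compact_S compact_Icc)
      (auto simp: case_prod_beta intro!: continuous_intros)
  finally show ?thesis .
qed

lemma cylinder_borel [measurable]: "cyl \<in> sets borel"
  by (intro borel_closed compact_imp_closed compact_cylinder)

lemma continuous_on_P [continuous_intros]: "continuous_on A P"
  unfolding P_def by (intro continuous_intros) (use sigma_nonzero in auto)

lemma measurable_P [measurable]: "P \<in> borel_measurable borel"
  by (intro borel_measurable_continuous_onI continuous_on_P)

lemma closest_point_eq_P:
  assumes "x \<in> cyl"
  shows "closest_point (affine hull S) x = P x"
proof -
  have PS: "P x \<in> S"
    using assms cylinder_iff by blast
  have "dist x (P x) \<le> dist x z" if "z \<in> affine hull S" for z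
  proof -
    have "affine {z. \<nu> \<bullet> z = \<nu> \<bullet> P x}"
      by (rule affine_hyperplane)
    moreover have "S \<subseteq> {z. \<nu> \<bullet> z = \<nu> \<bullet> P x}"
      using side_normal_properties(2)[OF PS] by (auto simp: inner_diff_right)
    ultimately have "\<nu> \<bullet> z = \<nu> \<bullet> P x"
      using that hull_minimal by blast
    then have "\<nu> \<bullet> (x - P x) = \<nu> \<bullet> (x - z)"
      by (simp add: inner_diff_right)
    moreover have "\<bar>\<nu> \<bullet> (x - z)\<bar> \<le> norm (x - z)"
      using Cauchy_Schwarz_ineq2[of \<nu> "x - z"] side_normal_properties(1) by simp
    moreover have "\<bar>\<nu> \<bullet> (x - P x)\<bar> = norm (x - P x)"
      using side_normal_properties(1) by (simp add: P_def dot_square_norm)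
    ultimately show ?thesis
      by (simp add: dist_norm)
  qed
  then show ?thesis
    using closest_point_unique[of "affine hull S" "P x" x] PS hull_inc[of "P x" S affine]
      affine_imp_convex[OF affine_affine_hull] closed_affine_hull by metis
qed

lemma closest_point_measurable:
  "closest_point (affine hull S) \<in> borel_measurable (restrict_space lborel cyl)"
proof -
  have "P \<in> borel_measurable (restrict_space lborel cyl)"
    by (intro measurable_restrict_space1) simp
  then show ?thesis
    using closest_point_eq_P by (subst measurable_cong[of _ _ P]) (auto simp: space_restrict_space)
qed

text \<open>
  On the cylinder the closest point map agrees with \<open>P\<close>.
\<close>

lemma AE_sideI:
  assumes Q: "{x. Q x} \<in> sets borel" and AE: "AE x in lborel. x \<in> cyl \<longrightarrow> Q (P x)"
  shows "AE x in \<mu>. Q x"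
proof (subst AE_distr_iff[OF closest_point_measurable])
  show "{x \<in> space borel. Q x} \<in> sets borel"
    using Q by simp
  have "AE x in restrict_space lborel cyl. Q (P x)"
    using AE by (subst AE_restrict_space_iff) auto
  then show "AE x in restrict_space lborel cyl. Q (closest_point (affine hull S) x)"
    by (rule AE_mp) (auto simp: closest_point_eq_P space_restrict_space intro!: AE_I2)
qed

text \<open>
  A point of the side outside its relative interior has a vanishing barycentric coordinate; the points
  that \<open>P\<close> maps there lie in finitely many hyperplanes, which are null sets (in dimension one there are
  no such points).  The functions that are prescribed on
  relative interiors only are thus determined almost everywhere.
\<close>

lemma AE_side_rel_interior: "AE x in \<mu>. x \<in> rel_interior S"
proof (rule AE_sideI)
  have "{x. x \<in> rel_interior S} = {x. bary T a x = 0} \<inter> (\<Inter>b\<in>V - {a}. {x. 0 < bary T b x})"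
    by (auto simp: S_def opp_iff_bary(2)[OF a])
  also have "\<dots> \<in> sets borel"
    using verts_minus_nonempty[OF a] by (intro sets.Int sets.finite_INT) measurable
  finally show "{x. x \<in> rel_interior S} \<in> sets borel" .
  have "AE x in lborel. bary T b (P x) \<noteq> 0" if b: "b \<in> V - {a}" for b
  proof -
    define g where "g = bary_grad T b - ((bary_grad T b \<bullet> \<nu>) / \<sigma>) *\<^sub>R bary_grad T a"
    have eq: "bary T b (P x) = bary T b (P 0) + g \<bullet> x" for x
      unfolding bary_P by (simp add: g_def bary_def inner_diff_left inner_diff_right algebra_simps
        add_divide_distrib diff_divide_distrib)
    show ?thesis
    proof (cases "g = 0")
      case True
      have "bary T b (P b) = 1"
        using b a by (auto simp: P_def bary_vertex)
      then have "bary T b (P x) \<noteq> 0" for x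
        using eq[of x] eq[of b] True by simp
      then show ?thesis by simp
    next
      case False
      then have "negligible {x. g \<bullet> x = - bary T b (P 0)}"
        by (intro negligible_hyperplane) simp
      then have "{x. g \<bullet> x = - bary T b (P 0)} \<in> null_sets lborel"
        using closed_hyperplane[of g "- bary T b (P 0)"] by (simp add: negligible_iff_null_sets null_sets_completion_iff)
      from AE_not_in[OF this] show ?thesis
      proof eventually_elim
        case (elim x)
        then show ?case
          using eq[of x] by simp
      qed
    qed
  qed
  then have "AE x in lborel. \<forall>b\<in>V - {a}. bary T b (P x) \<noteq> 0"
    by (intro AE_finite_allI) auto
  then show "AE x in lborel. x \<in> cyl \<longrightarrow> P x \<in> rel_interior S"
  proof eventually_elim
    case (elim x)
    show ?case
    proof
      assume "x \<in> cyl"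
      then have "\<forall>b\<in>V - {a}. 0 \<le> bary T b (P x)"
        using cylinder_iff P_in_S_iff by blast
      with elim have "\<forall>b\<in>V - {a}. 0 < bary T b (P x)"
        by (simp add: less_le)
      then show "P x \<in> rel_interior S"
        by (simp add: S_def opp_iff_bary(2)[OF a] bary_P_same)
    qed
  qed
qed

lemma integral_side:
  fixes w :: "'a \<Rightarrow> real"
  assumes w: "\<And>x. x \<in> rel_interior S \<Longrightarrow> w x = F x" and F: "F \<in> borel_measurable borel"
  shows "(\<integral>x. w x \<partial>side_measure S) = (\<integral>x. indicator cyl x * F (P x) \<partial>lborel)"
proof -
  let ?M = "restrict_space lborel cyl"
  have "(\<integral>x. w x \<partial>side_measure S) = (\<integral>x. F x \<partial>distr ?M borel (closest_point (affine hull S)))"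
    unfolding side_measure_def using AE_side_rel_interior w F
    by (intro integral_completion_cong_AE) (auto elim: AE_mp)
  also have "\<dots> = (\<integral>x. F (closest_point (affine hull S) x) \<partial>?M)"
    by (rule integral_distr[OF closest_point_measurable F])
  also have "\<dots> = (\<integral>x. F (P x) \<partial>?M)"
    by (rule Bochner_Integration.integral_cong) (auto simp: closest_point_eq_P space_restrict_space)
  also have "\<dots> = (\<integral>x. indicator cyl x *\<^sub>R F (P x) \<partial>lborel)"
    by (rule integral_restrict_space) simp
  finally show ?thesis by simp
qed


lemma side_area_eq: "side_area S = measure lborel cyl"
proof -
  have sp: "space (side_measure S) = UNIV"
    by (simp add: side_measure_def)
  have "side_area S = measure \<mu> UNIV"
    unfolding side_area_def sp by (simp add: side_measure_def)
  also have "\<dots> = measure (restrict_space lborel cyl) (space (restrict_space lborel cyl))"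
    by (subst measure_distr[OF closest_point_measurable]) auto
  also have "\<dots> = measure lborel cyl"
    by (subst measure_restrict_space) (auto simp: space_restrict_space)
  finally show ?thesis .
qed

text \<open>
  The relation \<open>|T| = h |S| / d\<close> between volume, height and base, with \<open>h = 1 / |\<nabla>\<lambda>|\<close>.  The affine map
  \<open>b1 + M\<close> carries the standard simplex to \<open>T\<close>.  A shear turns the right cylinder over \<open>S\<close> into an oblique
  one in the direction of the edge \<open>a - b1\<close>, whose preimage under the same map is a coordinate prism.  Both volumes
  are scaled by the same unknown factor \<open>c\<close>, which drops out of their ratio.
\<close>

lemma side_area_eq_volume: "side_area S = DIM('a) * volume T * norm (bary_grad T a)"
proof -
  obtain b1 where b1: "b1 \<in> V" "b1 \<noteq> a"
    using verts_minus_nonempty[OF a] by blast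
  have "card (Basis :: 'a set) = card (V - {b1})"
    using card_verts_minus[OF b1(1)] by simp
  then obtain e where e: "bij_betw e (Basis :: 'a set) (V - {b1})"
    using finite_same_card_bij[of Basis "V - {b1}"] by auto
  then obtain b0 where b0: "b0 \<in> Basis" "e b0 = a"
    using a b1 by (auto simp: bij_betw_def image_iff) (metis DiffI imageE singletonD)
  define M where "M x = (\<Sum>b\<in>Basis. (x \<bullet> b) *\<^sub>R (e b - b1))" for x :: 'a
  have linM: "linear M"
    unfolding M_def by (intro linearI) (auto simp: inner_add_left scaleR_add_left scaleR_sum_right sum.distrib)
  have eV: "e b \<in> V" "e b \<noteq> b1" if "b \<in> Basis" for b
    using e that by (auto simp: bij_betw_def)
  have e_eq: "e b = e b' \<longleftrightarrow> b = b'" if "b \<in> Basis" "b' \<in> Basis" for b b'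
    using e that by (auto simp: bij_betw_def inj_on_def)
  have baryM: "bary T c (b1 + M x) = bary T c b1 + (\<Sum>b\<in>Basis. (x \<bullet> b) * (bary T c (e b) - bary T c b1))" for c x
  proof -
    have "bary_grad T c \<bullet> M x = (\<Sum>b\<in>Basis. (x \<bullet> b) * (bary T c (e b) - bary T c b1))"
      by (simp add: M_def inner_sum_right bary_diff)
    then show ?thesis
      using bary_diff[of c "b1 + M x" b1] by simp
  qed
  have coord: "bary T (e b) (b1 + M x) = x \<bullet> b" if b: "b \<in> Basis" for b x
  proof -
    have "(\<Sum>b'\<in>Basis. (x \<bullet> b') * (bary T (e b) (e b') - bary T (e b) b1)) =
        (\<Sum>b'\<in>Basis. if b = b' then x \<bullet> b' else 0)"
      by (rule sum.cong) (use b b1 eV e_eq in \<open>auto simp: bary_vertex\<close>)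
    moreover have "bary T (e b) b1 = 0"
      using b b1 eV by (simp add: bary_vertex)
    ultimately show ?thesis
      using b baryM[of "e b" x] by simp
  qed
  have coord1: "bary T b1 (b1 + M x) = 1 - (\<Sum>b\<in>Basis. x \<bullet> b)" for x
  proof -
    have "(\<Sum>b\<in>Basis. (x \<bullet> b) * (bary T b1 (e b) - bary T b1 b1)) = (\<Sum>b\<in>Basis. - (x \<bullet> b))"
      by (rule sum.cong) (use b1 eV in \<open>auto simp: bary_vertex\<close>)
    then show ?thesis
      using b1 baryM[of b1 x] by (simp add: bary_vertex sum_negf)
  qed
  have V_eq: "V = insert b1 (e ` Basis)"
    using e b1 by (auto simp: bij_betw_def)
  have Va_eq: "V - {a} = insert b1 (e ` (Basis - {b0}))"
    unfolding V_eq using b0 e_eq b1 by auto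
  have "inj M"
  proof (subst linear_injective_0[OF linM], intro allI impI)
    fix x assume "M x = 0"
    then have "x \<bullet> b = 0" if "b \<in> Basis" for b
      using coord[OF that, of x] eV[OF that] b1 by (simp add: bary_vertex)
    then show "x = 0"
      using euclidean_eqI[of x 0] by simp
  qed
  then obtain c where c: "\<And>A. A \<in> sets borel \<Longrightarrow> emeasure lborel ((\<lambda>x. b1 + M x) -` A) = c * emeasure lborel A"
    using emeasure_affine_vimage[OF linM] by metis

  have "(\<lambda>x. b1 + M x) -` T = convex hull (insert 0 Basis)"
    unfolding std_simplex vimage_def mem_iff_bary V_eq by (auto simp: coord coord1)
  then have std: "c * ennreal (volume T) = ennreal (1 / fact DIM('a))"
    using c[of T] emeasure_std_simplex[where 'a = 'a] emeasure_T by simp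

  \<comment> \<open>The shear fixes the hyperplane of \<open>S\<close> and sends the edge direction \<open>a - b1\<close> to \<open>\<nu> / \<sigma>\<close>.\<close>
  define w where "w = (1 / \<sigma>) *\<^sub>R \<nu> - (a - b1)"
  define Q where "Q = (\<lambda>x. x + bary T a x *\<^sub>R w) -` cyl"
  have w0: "bary_grad T a \<bullet> w = 0"
    using sigma_nonzero vertex_differences[OF a b1(1) _ a] b1
    by (simp add: w_def inner_diff_right flip: \<sigma>_def)
  have bary_eq: "bary T a x = bary T a 0 + bary_grad T a \<bullet> x" for x
    by (simp add: bary_def inner_diff_right)
  have Q_borel: "Q \<in> sets borel"
    unfolding Q_def using measurable_sets_borel[of "\<lambda>x. x + bary T a x *\<^sub>R w" borel "cyl"] by simp
  have emQ: "emeasure lborel Q = emeasure lborel cyl"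
    using emeasure_lborel_vimage_shear[OF w0 bary_grad_nonzero[OF a] cylinder_borel, of "bary T a 0"]
    by (simp only: Q_def bary_eq[symmetric])
  have Q_iff: "x \<in> Q \<longleftrightarrow> 0 \<le> bary T a x / \<sigma> \<and> bary T a x / \<sigma> \<le> 1 \<and>
      (\<forall>b\<in>V - {a}. 0 \<le> bary T b (x - bary T a x *\<^sub>R (a - b1)))" for x
  proof -
    have "bary T a (x + bary T a x *\<^sub>R w) = bary T a x"
      using bary_diff[of a "x + bary T a x *\<^sub>R w" x] w0 by simp
    then have "P (x + bary T a x *\<^sub>R w) = x - bary T a x *\<^sub>R (a - b1)"
      and "bary T a (x + bary T a x *\<^sub>R w) = bary T a x"
      by (simp_all add: P_def w_def algebra_simps)
    then show ?thesis
      using P_in_S_iff[of "x + bary T a x *\<^sub>R w"] by (simp add: Q_def cylinder_iff)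
  qed
  have shift: "b1 + M x - bary T a (b1 + M x) *\<^sub>R (a - b1) = b1 + M (x - (x \<bullet> b0) *\<^sub>R b0)" for x
  proof -
    have "M b0 = (\<Sum>b\<in>Basis. if b = b0 then a - b1 else 0)"
      unfolding M_def using b0 by (intro sum.cong) (auto simp: inner_Basis)
    then have "M b0 = a - b1"
      using b0 by simp
    moreover have "bary T a (b1 + M x) = x \<bullet> b0"
      using coord[OF b0(1)] b0(2) by simp
    ultimately show ?thesis
      by (simp add: linear_diff[OF linM] linear_scale[OF linM])
  qed
  have sum_shift: "(\<Sum>b\<in>Basis. (x - (x \<bullet> b0) *\<^sub>R b0) \<bullet> b) = (\<Sum>b\<in>Basis - {b0}. x \<bullet> b)" for x
  proof -
    have "(\<Sum>b\<in>Basis - {b0}. (x - (x \<bullet> b0) *\<^sub>R b0) \<bullet> b) = (\<Sum>b\<in>Basis - {b0}. x \<bullet> b)"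
      by (rule sum.cong) (use b0(1) in \<open>auto simp: inner_diff_left inner_Basis\<close>)
    then show ?thesis
      using b0(1) sum.remove[OF finite_Basis b0(1), of "\<lambda>b. (x - (x \<bullet> b0) *\<^sub>R b0) \<bullet> b"]
      by (simp add: inner_diff_left)
  qed
  have Q_vimage: "(\<lambda>x. b1 + M x) -` Q = {x. min 0 \<sigma> \<le> x \<bullet> b0 \<and> x \<bullet> b0 \<le> max 0 \<sigma> \<and>
      (\<forall>b\<in>Basis - {b0}. 0 \<le> x \<bullet> b) \<and> (\<Sum>b\<in>Basis - {b0}. x \<bullet> b) \<le> 1}"
  proof -
    have "b1 + M x \<in> Q \<longleftrightarrow> 0 \<le> (x \<bullet> b0) / \<sigma> \<and> (x \<bullet> b0) / \<sigma> \<le> 1 \<and> (\<forall>b\<in>Basis - {b0}. 0 \<le> x \<bullet> b) \<and>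
        (\<Sum>b\<in>Basis - {b0}. x \<bullet> b) \<le> 1" for x
    proof -
      have "(x - (x \<bullet> b0) *\<^sub>R b0) \<bullet> b = x \<bullet> b" if "b \<in> Basis - {b0}" for b
        using that b0 by (auto simp: inner_diff_left inner_Basis)
      moreover have "bary T a (b1 + M x) = x \<bullet> b0"
        using coord[OF b0(1)] b0(2) by simp
      ultimately show ?thesis
        unfolding Q_iff shift Va_eq using sum_shift[of x] by (auto simp: coord coord1)
    qed
    moreover have "0 \<le> r / \<sigma> \<and> r / \<sigma> \<le> 1 \<longleftrightarrow> min 0 \<sigma> \<le> r \<and> r \<le> max 0 \<sigma>" for r
      using sigma_nonzero by (cases "\<sigma> > 0") (auto simp: field_simps min_def max_def)
    ultimately show ?thesis
      by (auto simp: vimage_def)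
  qed
  have "emeasure lborel ((\<lambda>x. b1 + M x) -` Q) = ennreal ((max 0 \<sigma> - min 0 \<sigma>) / fact (DIM('a) - 1))"
    unfolding Q_vimage by (rule emeasure_lborel_prism[OF b0(1)]) simp
  also have "max 0 \<sigma> - min 0 \<sigma> = norm (bary_grad T a)"
    using abs_sigma by auto
  finally have "c * emeasure lborel cyl = ennreal (norm (bary_grad T a) / fact (DIM('a) - 1))"
    using c[OF Q_borel] emQ by simp
  moreover have "emeasure lborel cyl = ennreal (side_area S)"
    using emeasure_bounded_finite[OF compact_imp_bounded[OF compact_cylinder]]
    unfolding side_area_eq by (intro emeasure_eq_ennreal_measure) auto
  ultimately have cyl: "c * ennreal (side_area S) = ennreal (norm (bary_grad T a) / fact (DIM('a) - 1))"
    by simp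
  obtain c' where c': "c = ennreal c'" "0 \<le> c'"
  proof (cases c)
    case top
    then show ?thesis using std volume_pos by (simp add: ennreal_top_mult split: if_splits)
  qed
  have "0 \<le> side_area S"
    by (simp add: side_area_def)
  then have "c' * side_area S = norm (bary_grad T a) / fact (DIM('a) - 1)"
    using cyl c' by (simp add: ennreal_mult[symmetric])
  moreover have "c' * volume T = 1 / fact DIM('a)"
    using std c' volume_pos by (simp add: ennreal_mult[symmetric])
  moreover have "fact DIM('a) = (real DIM('a)) * fact (DIM('a) - 1)"
    by (simp add: fact_reduce)
  moreover define F where "F = (fact (DIM('a) - 1) :: real)"
  moreover have "F \<noteq> 0"
    by (simp add: F_def)
  ultimately have e1: "c' * side_area S * F = norm (bary_grad T a)" and e2: "c' * volume T * (DIM('a) * F) = 1"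
    by simp_all
  have "c' * side_area S * F = norm (bary_grad T a) * (c' * volume T * (DIM('a) * F))"
    using e1 e2 by simp
  then have "(c' * F) * side_area S = (c' * F) * (DIM('a) * volume T * norm (bary_grad T a))"
    by (simp only: mult_ac)
  moreover have "c' * F \<noteq> 0"
    using e2 by auto
  ultimately show ?thesis
    using mult_left_cancel by blast
qed

lemma side_area_pos: "0 < side_area S"
  unfolding side_area_eq_volume using volume_pos bary_grad_nonzero[OF a] by simp


lemma integrable_bary_side: "integrable lborel (\<lambda>x. indicator cyl x * bary T b (P x))"
  using borel_integrable_compact[OF compact_cylinder continuous_on_bary[OF continuous_on_P], of T b] by simp

text \<open>
  The same symmetry argument as for the simplex, applied to the cylinder: the gradient of each
  coordinate is made tangential to the side, so that the reflection commutes with \<open>P\<close>.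
\<close>

lemma integral_bary_side:
  assumes b: "b \<in> V - {a}"
  shows "(\<integral>x. indicator cyl x * bary T b (P x) \<partial>lborel) = side_area S / DIM('a)"
proof -
  let ?I = "\<lambda>b. \<integral>x. indicator cyl x * bary T b (P x) \<partial>lborel"
  have eq: "?I c = ?I b" if c: "c \<in> V - {a}" "c \<noteq> b" for c
  proof -
    define g where "g = bary_grad T b - bary_grad T c - (((bary_grad T b - bary_grad T c) \<bullet> \<nu>) / \<sigma>) *\<^sub>R bary_grad T a"
    define k where "k = bary T b (P 0) - bary T c (P 0)"
    let ?f = "\<lambda>x. x - (k + g \<bullet> x) *\<^sub>R (b - c)"
    have kg: "k + g \<bullet> x = bary T b (P x) - bary T c (P x)" for x
      unfolding k_def bary_P
      by (simp add: g_def bary_def inner_diff_left inner_diff_right algebra_simps add_divide_distrib diff_divide_distrib)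
    have ge: "g \<bullet> (b - c) = 2"
      using vertex_differences[of b c b] vertex_differences[of b c c] vertex_differences[of b c a] a b c
      by (auto simp: g_def inner_diff_left)
    have fa: "bary T a (?f x) = bary T a x" for x
      using bary_diff[of a "?f x" x] vertex_differences[of b c a] a b c by auto
    have Pf: "P (?f x) = P x - (bary T b (P x) - bary T c (P x)) *\<^sub>R (b - c)" for x
      unfolding P_def[of "?f x"] fa unfolding kg by (simp add: P_def algebra_simps)
    have f: "bary T d (P (?f x)) = bary T d (P x) - (bary T b (P x) - bary T c (P x)) * (if d = b then 1 else if d = c then -1 else 0)"
      if "d \<in> V" for d x
      using bary_diff[of d "P (?f x)" "P x"] vertex_differences[of b c d] b c that unfolding Pf
      by (auto simp: algebra_simps)
    have "P (?f x) \<in> S \<longleftrightarrow> P x \<in> S" for x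
    proof -
      have "P (?f x) \<in> S \<longleftrightarrow> 0 \<le> bary T b (P (?f x)) \<and> 0 \<le> bary T c (P (?f x)) \<and> (\<forall>d\<in>V - {a,b,c}. 0 \<le> bary T d (P (?f x)))"
        unfolding P_in_S_iff using b c by blast
      also have "\<dots> \<longleftrightarrow> 0 \<le> bary T c (P x) \<and> 0 \<le> bary T b (P x) \<and> (\<forall>d\<in>V - {a,b,c}. 0 \<le> bary T d (P x))"
        using b c by (simp add: f)
      also have "\<dots> \<longleftrightarrow> P x \<in> S"
        unfolding P_in_S_iff using b c by blast
      finally show ?thesis .
    qed
    then have "?f x \<in> cyl \<longleftrightarrow> x \<in> cyl" for x
      unfolding cylinder_iff fa by simp
    moreover have "bary T b (P (?f x)) = bary T c (P x)" for x
      using b by (simp add: f)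
    ultimately have "indicator cyl (?f x) * bary T b (P (?f x)) = indicator cyl x * bary T c (P x)" for x
      by (simp add: indicator_def)
    then show ?thesis
      using integral_affine_reflection[OF ge, of "\<lambda>x. indicator cyl x * bary T b (P x)" k] by simp
  qed
  have "(\<Sum>c\<in>V - {a}. bary T c (P x)) = 1" for x
    using sum_bary[of "P x"] sum.remove[OF finite_verts a, of "\<lambda>c. bary T c (P x)"] by (simp add: bary_P_same)
  then have "side_area S = (\<integral>x. (\<Sum>c\<in>V - {a}. indicator cyl x * bary T c (P x)) \<partial>lborel)"
    by (simp add: side_area_eq flip: sum_distrib_left)
  also have "\<dots> = (\<Sum>c\<in>V - {a}. ?I c)"
    by (rule Bochner_Integration.integral_sum) (rule integrable_bary_side)
  also have "\<dots> = (\<Sum>c\<in>V - {a}. ?I b)"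
    using eq by (intro sum.cong) auto
  finally show ?thesis
    by (simp add: card_verts_minus[OF a])
qed

lemma side_avg_affine:
  assumes A: "linear A" and w: "\<And>x. x \<in> S \<Longrightarrow> w x = A x + c"
  shows "side_avg S w = (\<Sum>b\<in>verts S. w b) / DIM('a)"
proof -
  have [measurable]: "A \<in> borel_measurable borel"
    using A by (intro borel_measurable_continuous_onI linear_continuous_on linear_conv_bounded_linear[THEN iffD1])
  have "(\<integral>x. w x \<partial>side_measure S) = (\<integral>x. indicator cyl x * (A (P x) + c) \<partial>lborel)"
    using rel_interior_subset by (intro integral_side) (auto intro!: w)
  also have "\<dots> = (\<integral>x. (\<Sum>b\<in>V - {a}. (indicator cyl x * bary T b (P x)) * (A b + c)) \<partial>lborel)"
  proof (rule Bochner_Integration.integral_cong)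
    fix x
    have "A (P x) + c = (\<Sum>b\<in>V. bary T b (P x) * (A b + c))"
      using affine_eq_sum_bary[OF A, of "P x" c] by simp
    also have "\<dots> = (\<Sum>b\<in>V - {a}. bary T b (P x) * (A b + c))"
      using sum.remove[OF finite_verts a, of "\<lambda>b. bary T b (P x) * (A b + c)"] by (simp add: bary_P_same)
    finally show "indicator cyl x * (A (P x) + c) =
        (\<Sum>b\<in>V - {a}. (indicator cyl x * bary T b (P x)) * (A b + c))"
      by (simp add: sum_distrib_left mult.assoc)
  qed simp
  also have "\<dots> = (\<Sum>b\<in>V - {a}. (\<integral>x. (indicator cyl x * bary T b (P x)) * (A b + c) \<partial>lborel))"
    by (rule Bochner_Integration.integral_sum) (intro integrable_mult_left integrable_bary_side)
  also have "\<dots> = (\<Sum>b\<in>V - {a}. (side_area S / DIM('a)) * (A b + c))"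
    by (rule sum.cong) (simp_all add: integrable_bary_side integral_bary_side)
  also have "\<dots> = (\<Sum>b\<in>V - {a}. (side_area S / DIM('a)) * w b)"
    using hull_subset[of "V - {a}" convex] by (intro sum.cong) (auto simp: w S_def opp_face_def)
  also have "\<dots> = side_area S * ((\<Sum>b\<in>V - {a}. w b) / DIM('a))"
    by (simp add: sum_distrib_left flip: sum_divide_distrib)
  finally have "(\<integral>x. w x \<partial>side_measure S) / side_area S = (\<Sum>b\<in>V - {a}. w b) / DIM('a)"
    using side_area_pos by simp
  then show ?thesis
    using verts_opp[OF a] by (simp add: side_avg_def side_area_def flip: S_def)
qed

end

section \<open>Integration by parts on one element\<close>

definition mean :: "'a::euclidean_space set \<Rightarrow> ('a \<Rightarrow> 'b::euclidean_space) \<Rightarrow> 'b" where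
  "mean T v = (1 / measure lebesgue T) *\<^sub>R (\<integral>x. v x \<partial>lebesgue_on T)"

text \<open>
  The gradient and the divergence of the affine function with the given traces at the vertices.  They
  depend on the vertex values only, which keeps all computations on one element linear
  and finite.
\<close>

definition elt_grad :: "'a::euclidean_space set \<Rightarrow> ('a \<Rightarrow> real) \<Rightarrow> 'a" where
  "elt_grad T v = (\<Sum>a\<in>verts T. elt_trace T v a *\<^sub>R bary_grad T a)"

definition elt_div :: "'a::euclidean_space set \<Rightarrow> ('a \<Rightarrow> 'a) \<Rightarrow> real" where
  "elt_div T y = (\<Sum>a\<in>verts T. elt_trace T y a \<bullet> bary_grad T a)"

text \<open>
  The normal component of a Raviart-Thomas field is constant on a side, so one point suffices.
\<close>

definition flux :: "'a::euclidean_space set \<Rightarrow> ('a \<Rightarrow> 'a) \<Rightarrow> 'a set \<Rightarrow> real" where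
  "flux T y S = elt_trace T y (SOME x. x \<in> rel_interior S) \<bullet> outer_normal T S"

text \<open>
  Here \<open>y i \<bullet> G j\<close> for \<open>i \<noteq> j\<close> depends on \<open>j\<close> only, which is what constant normal components on the sides mean.  The
  key observation is that the remaining deviations \<open>\<delta> i = y i \<bullet> G i - \<kappa> i\<close> all coincide, because
  each row \<open>\<Sum>j. y i \<bullet> G j\<close> vanishes; a field with this property is of the form \<open>a + b x\<close>, and
  \<open>\<delta>\<close> plays the role of \<open>b\<close>.
\<close>

lemma vertex_integration_by_parts:
  fixes y G :: "'i \<Rightarrow> 'a::real_inner" and v \<kappa> :: "'i \<Rightarrow> real"
  assumes fin: "finite I" and ne: "I \<noteq> {}" and G0: "(\<Sum>i\<in>I. G i) = 0"
    and \<kappa>: "\<And>i j. i \<in> I \<Longrightarrow> j \<in> I \<Longrightarrow> i \<noteq> j \<Longrightarrow> y i \<bullet> G j = \<kappa> j"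
  shows "(\<Sum>i\<in>I. v i *\<^sub>R G i) \<bullet> (\<Sum>i\<in>I. y i) + (\<Sum>i\<in>I. v i) * (\<Sum>i\<in>I. y i \<bullet> G i) =
      - real (card I) * (\<Sum>j\<in>I. \<kappa> j * (\<Sum>i\<in>I - {j}. v i))"
proof -
  define \<delta> where "\<delta> i = y i \<bullet> G i - \<kappa> i" for i
  have row: "(\<Sum>j\<in>I. \<kappa> j) = - \<delta> i" if i: "i \<in> I" for i
  proof -
    have "0 = (\<Sum>j\<in>I. y i \<bullet> G j)"
      using G0 by (simp flip: inner_sum_right)
    also have "\<dots> = y i \<bullet> G i + (\<Sum>j\<in>I - {i}. y i \<bullet> G j)"
      by (rule sum.remove[OF fin i])
    also have "(\<Sum>j\<in>I - {i}. y i \<bullet> G j) = (\<Sum>j\<in>I - {i}. \<kappa> j)"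
      by (rule sum.cong) (use \<kappa>[OF i] in auto)
    also have "y i \<bullet> G i + (\<Sum>j\<in>I - {i}. \<kappa> j) = \<delta> i + (\<Sum>j\<in>I. \<kappa> j)"
      using sum.remove[OF fin i, of \<kappa>] by (simp add: \<delta>_def)
    finally show ?thesis by simp
  qed
  obtain d where d: "\<And>i. i \<in> I \<Longrightarrow> \<delta> i = d" and \<kappa>_sum: "(\<Sum>j\<in>I. \<kappa> j) = - d"
  proof -
    obtain k where "k \<in> I" using ne by blast
    show ?thesis
    proof (rule that[of "\<delta> k"])
      show "\<delta> i = \<delta> k" if "i \<in> I" for i
        using row[OF that] row[OF \<open>k \<in> I\<close>] by simp
      show "(\<Sum>j\<in>I. \<kappa> j) = - \<delta> k"
        by (rule row[OF \<open>k \<in> I\<close>])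
    qed
  qed
  let ?n = "real (card I)"
  have div: "(\<Sum>i\<in>I. y i \<bullet> G i) = (?n - 1) * d"
  proof -
    have "(\<Sum>i\<in>I. y i \<bullet> G i) = (\<Sum>i\<in>I. \<kappa> i + d)"
      using d by (intro sum.cong) (auto simp: \<delta>_def algebra_simps)
    then show ?thesis
      using \<kappa>_sum by (simp add: sum.distrib algebra_simps)
  qed
  have col: "G i \<bullet> (\<Sum>j\<in>I. y j) = ?n * \<kappa> i + d" if i: "i \<in> I" for i
  proof -
    have "G i \<bullet> (\<Sum>j\<in>I. y j) = (\<Sum>j\<in>I. y j \<bullet> G i)"
      by (simp add: inner_sum_right inner_commute)
    also have "\<dots> = y i \<bullet> G i + (\<Sum>j\<in>I - {i}. y j \<bullet> G i)"
      by (rule sum.remove[OF fin i])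
    also have "(\<Sum>j\<in>I - {i}. y j \<bullet> G i) = (\<Sum>j\<in>I - {i}. \<kappa> i)"
      by (rule sum.cong) (use \<kappa>[OF _ i] in auto)
    also have "\<dots> = (?n - 1) * \<kappa> i"
      using card.remove[OF fin i] by simp
    also have "y i \<bullet> G i + (?n - 1) * \<kappa> i = \<kappa> i + d + (?n - 1) * \<kappa> i"
      using d[OF i] by (simp add: \<delta>_def)
    finally show ?thesis by (simp add: algebra_simps)
  qed
  define s where "s = (\<Sum>i\<in>I. v i)"
  define q where "q = (\<Sum>i\<in>I. \<kappa> i * v i)"
  have "(\<Sum>i\<in>I. v i *\<^sub>R G i) \<bullet> (\<Sum>i\<in>I. y i) = (\<Sum>i\<in>I. v i * (G i \<bullet> (\<Sum>i\<in>I. y i)))"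
    by (simp only: inner_sum_left inner_scaleR_left)
  also have "\<dots> = (\<Sum>i\<in>I. ?n * (\<kappa> i * v i) + d * v i)"
    by (rule sum.cong) (simp_all only: col, simp add: algebra_simps)
  also have "\<dots> = ?n * q + d * s"
    by (simp add: q_def s_def sum.distrib sum_distrib_left)
  finally have grad: "(\<Sum>i\<in>I. v i *\<^sub>R G i) \<bullet> (\<Sum>i\<in>I. y i) = ?n * q + d * s" .
  have "(\<Sum>j\<in>I. \<kappa> j * (\<Sum>i\<in>I - {j}. v i)) = (\<Sum>j\<in>I. \<kappa> j * s - \<kappa> j * v j)"
    by (rule sum.cong) (auto simp: sum_diff1 fin s_def right_diff_distrib)
  also have "\<dots> = - d * s - q"
    by (simp add: sum_subtractf q_def \<kappa>_sum flip: sum_distrib_right)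
  finally have side: "(\<Sum>j\<in>I. \<kappa> j * (\<Sum>i\<in>I - {j}. v i)) = - d * s - q" .
  show ?thesis
    unfolding grad div side s_def[symmetric] by (simp add: algebra_simps)
qed

context full_simplex
begin

text \<open>
  Each point of the closed element is a limit of interior points, where the function is prescribed.
\<close>

lemma elt_trace_eq:
  fixes v :: "'a \<Rightarrow> 'b::real_normed_vector"
  assumes F: "continuous_on UNIV F" and v: "\<And>x. x \<in> interior T \<Longrightarrow> v x = F x" and x: "x \<in> T"
  shows "elt_trace T v x = F x"
  unfolding elt_trace_def
proof (rule tendsto_Lim)
  have "x islimpt interior T"
  proof (cases "x \<in> interior T")
    case True
    then show ?thesis using interior_limit_point[of x "interior T"] by simp
  next
    case False
    then show ?thesis using x closure_interior by (auto simp: closure_def)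
  qed
  then show "at x within interior T \<noteq> bot"
    by (simp add: trivial_limit_within)
  have "(F \<longlongrightarrow> F x) (at x within interior T)"
    using F by (meson UNIV_I continuous_on_def tendsto_within_subset subset_UNIV)
  moreover have "\<forall>\<^sub>F x in at x within interior T. F x = v x"
    by (simp add: eventually_at_filter v)
  ultimately show "(v \<longlongrightarrow> F x) (at x within interior T)"
    by (rule Lim_transform_eventually)
qed

lemma elt_trace_linear_eq:
  fixes A :: "'a \<Rightarrow> 'b::euclidean_space"
  assumes A: "linear A" and v: "\<And>x. x \<in> interior T \<Longrightarrow> v x = A x + c" and x: "x \<in> T"
  shows "elt_trace T v x = A x + c"
  using linear_continuous_on[of A UNIV] A v x
  by (intro elt_trace_eq) (auto simp: linear_conv_bounded_linear intro!: continuous_on_add continuous_on_const)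

lemma elt_trace_vertex:
  fixes A :: "'a \<Rightarrow> 'b::euclidean_space"
  assumes A: "linear A" and v: "\<And>x. x \<in> interior T \<Longrightarrow> v x = A x + c" and "a \<in> V"
  shows "elt_trace T v a = A a + c"
  using elt_trace_linear_eq[OF A v] verts_subset assms(3) by blast

definition affine_on :: "('a \<Rightarrow> 'b::euclidean_space) \<Rightarrow> bool" where
  "affine_on v \<longleftrightarrow> (\<exists>A c. linear A \<and> (\<forall>x\<in>interior T. v x = A x + c))"

lemma mean_affine:
  fixes v :: "'a \<Rightarrow> 'b::euclidean_space"
  assumes "affine_on v"
  shows "mean T v = (1 / (DIM('a) + 1)) *\<^sub>R (\<Sum>a\<in>V. elt_trace T v a)"
proof -
  obtain A c where A: "linear A" "\<And>x. x \<in> interior T \<Longrightarrow> v x = A x + c"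
    using assms by (auto simp: affine_on_def)
  have "(\<Sum>a\<in>V. elt_trace T v a) = (\<Sum>a\<in>V. A a + c)"
    using elt_trace_vertex[OF A] by simp
  moreover have "(\<integral>x. v x \<partial>lebesgue_on T) = (volume T / (DIM('a) + 1)) *\<^sub>R (\<Sum>a\<in>V. A a + c)"
    by (rule integral_affine[OF A])
  ultimately show ?thesis
    unfolding mean_def volume_def[symmetric] using volume_pos by simp
qed

lemma grad_h_affine:
  assumes "affine_on v" and x: "x \<in> interior T"
  shows "grad_h v x = elt_grad T v"
  unfolding grad_h_def
proof (rule the_equality)
  obtain A c where A: "linear A" "\<And>x. x \<in> interior T \<Longrightarrow> v x = A x + c"
    using assms by (auto simp: affine_on_def)
  have Aeq: "A h = h \<bullet> elt_grad T v" for h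
  proof -
    have "A h = (\<Sum>a\<in>V. (bary_grad T a \<bullet> h) *\<^sub>R elt_trace T v a)"
      using linear_eq_sum_bary_grad[OF A(1), of h c] elt_trace_vertex[OF A] by simp
    also have "\<dots> = h \<bullet> elt_grad T v"
      by (simp add: elt_grad_def inner_sum_right inner_commute mult.commute)
    finally show ?thesis .
  qed
  have der: "(v has_derivative A) (at x)"
  proof (rule has_derivative_transform_within_open)
    show "((\<lambda>x. A x + c) has_derivative A) (at x)"
      using linear_imp_has_derivative[OF A(1)] by (auto intro!: derivative_eq_intros)
  qed (use A x in auto)
  then show "GDERIV v x :> elt_grad T v"
    unfolding gderiv_def Aeq[symmetric] .
  fix D assume "GDERIV v x :> D"
  then have "A = (\<lambda>h. h \<bullet> D)"
    using der has_derivative_unique unfolding gderiv_def by blast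
  then have "h \<bullet> D = h \<bullet> elt_grad T v" for h
    using Aeq by metis
  then show "D = elt_grad T v"
    by (metis vector_eq_ldot)
qed

lemma div_h_affine:
  assumes "affine_on y" and x: "x \<in> interior T"
  shows "div_h y x = elt_div T y"
proof -
  obtain A c where A: "linear A" "\<And>x. x \<in> interior T \<Longrightarrow> y x = A x + c"
    using assms by (auto simp: affine_on_def)
  have "(y has_derivative A) (at x)"
  proof (rule has_derivative_transform_within_open)
    show "((\<lambda>x. A x + c) has_derivative A) (at x)"
      using linear_imp_has_derivative[OF A(1)] by (auto intro!: derivative_eq_intros)
  qed (use A x in auto)
  then have "div_h y x = (\<Sum>b\<in>Basis. A b \<bullet> b)"
    by (simp add: div_h_def frechet_derivative_at[symmetric])
  also have "\<dots> = (\<Sum>b\<in>Basis. \<Sum>a\<in>V. (bary_grad T a \<bullet> b) * (elt_trace T y a \<bullet> b))"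
  proof (rule sum.cong)
    fix b
    have "A b = (\<Sum>a\<in>V. (bary_grad T a \<bullet> b) *\<^sub>R elt_trace T y a)"
      using linear_eq_sum_bary_grad[OF A(1), of b c] elt_trace_vertex[OF A] by simp
    then show "A b \<bullet> b = (\<Sum>a\<in>V. (bary_grad T a \<bullet> b) * (elt_trace T y a \<bullet> b))"
      by (simp add: inner_sum_left)
  qed simp
  also have "\<dots> = elt_div T y"
  proof -
    have "(\<Sum>b\<in>Basis. (bary_grad T a \<bullet> b) * (elt_trace T y a \<bullet> b)) = elt_trace T y a \<bullet> bary_grad T a" for a
      by (simp only: euclidean_inner[of "elt_trace T y a" "bary_grad T a"] mult.commute)
    then show ?thesis
      unfolding elt_div_def by (subst sum.swap) simp
  qed
  finally show ?thesis .
qed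

lemma side_avg_trace:
  assumes "affine_on v" and a: "a \<in> V" and w: "\<And>x. x \<in> opp_face T a \<Longrightarrow> w x = elt_trace T v x"
  shows "side_avg (opp_face T a) w = (\<Sum>b\<in>V - {a}. elt_trace T v b) / DIM('a)"
proof -
  obtain A c where A: "linear A" "\<And>x. x \<in> interior T \<Longrightarrow> v x = A x + c"
    using assms by (auto simp: affine_on_def)
  interpret simplex_side T a
    by unfold_locales (rule a)
  have "w x = A x + c" if "x \<in> S" for x
    using w elt_trace_linear_eq[OF A] opp_subset[OF a] that unfolding S_def by auto
  from side_avg_affine[OF A(1) this]
  have "side_avg (opp_face T a) w = (\<Sum>b\<in>V - {a}. w b) / DIM('a)"
    unfolding S_def verts_opp[OF a] .
  also have "(\<Sum>b\<in>V - {a}. w b) = (\<Sum>b\<in>V - {a}. elt_trace T v b)"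
    using hull_subset[of "V - {a}" convex] by (intro sum.cong) (auto simp: w opp_face_def)
  finally show ?thesis .
qed

lemma side_area_opp:
  assumes a: "a \<in> V"
  shows "side_area (opp_face T a) = DIM('a) * volume T * norm (bary_grad T a)"
proof -
  interpret simplex_side T a
    by unfold_locales (rule a)
  show ?thesis
    using side_area_eq_volume by (simp add: S_def)
qed

lemma rel_interior_opp_nonempty: "a \<in> V \<Longrightarrow> rel_interior (opp_face T a) \<noteq> {}"
  using verts_minus_nonempty[of a] rel_interior_eq_empty[of "opp_face T a"] by (simp add: opp_face_def)

text \<open>
  The outer normal of a side is \<open>- \<nabla>\<lambda> / |\<nabla>\<lambda>|\<close>, so constant normal components are the hypothesis of
  \<open>vertex_integration_by_parts\<close>, and \<open>d |T| |\<nabla>\<lambda>|\<close> is the area of the side.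
\<close>

lemma element_integration_by_parts:
  fixes v :: "'a \<Rightarrow> real" and y :: "'a \<Rightarrow> 'a"
  assumes v: "affine_on v" and y: "affine_on y"
    and n: "\<And>S. S facet_of T \<Longrightarrow> \<exists>c. \<forall>x\<in>S. elt_trace T y x \<bullet> outer_normal T S = c"
  shows "volume T * (elt_grad T v \<bullet> mean T y + mean T v * elt_div T y) =
      (\<Sum>S | S facet_of T. side_area S * flux T y S * side_avg S (elt_trace T v))"
proof -
  have fl: "elt_trace T y x \<bullet> outer_normal T (opp_face T a) = flux T y (opp_face T a)" if "a \<in> V" "x \<in> opp_face T a" for a x
  proof -
    have "opp_face T a facet_of T"
      unfolding facet_iff using that(1) by blast
    then obtain c where "\<forall>x\<in>opp_face T a. elt_trace T y x \<bullet> outer_normal T (opp_face T a) = c"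
      using n[of "opp_face T a"] by blast
    moreover have "(SOME x. x \<in> rel_interior (opp_face T a)) \<in> rel_interior (opp_face T a)"
      using rel_interior_opp_nonempty[OF that(1)] by (simp add: some_in_eq)
    then have "(SOME x. x \<in> rel_interior (opp_face T a)) \<in> opp_face T a"
      by (rule subsetD[OF rel_interior_subset])
    ultimately show ?thesis
      using that(2) by (simp add: flux_def)
  qed
  define \<kappa> where "\<kappa> a = - norm (bary_grad T a) * flux T y (opp_face T a)" for a
  have \<kappa>: "elt_trace T y b \<bullet> bary_grad T a = \<kappa> a" if "b \<in> V" "a \<in> V" "b \<noteq> a" for a b
  proof -
    have "b \<in> opp_face T a"
      using that hull_subset[of "V - {a}" convex] by (auto simp: opp_face_def)
    from fl[OF that(2) this] show ?thesis
      using bary_grad_nonzero[OF that(2)] by (simp add: outer_normal_opp[OF that(2)] \<kappa>_def field_simps)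
  qed
  have "V \<noteq> {}"
    using card_verts by auto
  let ?t = "elt_trace T v" and ?y = "elt_trace T y" and ?n = "real (DIM('a) + 1)"
  have "volume T * (elt_grad T v \<bullet> mean T y + mean T v * elt_div T y) =
      volume T / ?n * ((\<Sum>a\<in>V. ?t a *\<^sub>R bary_grad T a) \<bullet> (\<Sum>a\<in>V. ?y a) + (\<Sum>a\<in>V. ?t a) * (\<Sum>a\<in>V. ?y a \<bullet> bary_grad T a))"
    unfolding mean_affine[OF v] mean_affine[OF y] elt_grad_def elt_div_def
    by (simp only: inner_scaleR_right real_scaleR_def divide_inverse mult_1_left distrib_left distrib_right mult_ac)
  also have "\<dots> = - volume T * (\<Sum>a\<in>V. \<kappa> a * (\<Sum>b\<in>V - {a}. ?t b))"
  proof -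
    have cancel: "p / n * (- n * q) = - p * q" if "n \<noteq> 0" for p n q :: real
      using that by simp
    have cV: "real (card V) = ?n"
      by (simp add: card_verts)
    have "(\<Sum>a\<in>V. ?t a *\<^sub>R bary_grad T a) \<bullet> (\<Sum>a\<in>V. ?y a) + (\<Sum>a\<in>V. ?t a) * (\<Sum>a\<in>V. ?y a \<bullet> bary_grad T a) =
        - real (card V) * (\<Sum>a\<in>V. \<kappa> a * (\<Sum>b\<in>V - {a}. ?t b))"
      by (rule vertex_integration_by_parts[OF finite_verts \<open>V \<noteq> {}\<close> sum_bary_grad]) (rule \<kappa>)
    moreover have n0: "?n \<noteq> 0"
      by simp
    ultimately show ?thesis
      by (simp only: cV cancel[OF n0])
  qed
  also have "\<dots> = (\<Sum>a\<in>V. - volume T * (\<kappa> a * (\<Sum>b\<in>V - {a}. ?t b)))"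
    by (simp add: sum_distrib_left)
  also have "\<dots> = (\<Sum>a\<in>V. side_area (opp_face T a) * flux T y (opp_face T a) * side_avg (opp_face T a) ?t)"
    by (rule sum.cong) (auto simp: side_area_opp side_avg_trace[OF v] \<kappa>_def)
  also have "\<dots> = (\<Sum>S | S facet_of T. side_area S * flux T y S * side_avg S ?t)"
    by (rule sum_facets[symmetric])
  finally show ?thesis .
qed

end

section \<open>Sides of the mesh and their neighbours\<close>

text \<open>
  Below the Lipschitz graph there is an open set disjoint from the domain next to every
  boundary point, so a boundary point is never interior to the closure.  Slit domains, for which a
  side could have two neighbours and still belong to the boundary, are excluded in this way.
\<close>

lemma lipschitz_domain_interior_closure:
  assumes "lipschitz_domain \<Omega>"
  shows "interior (closure \<Omega>) = \<Omega>"
proof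
  have op: "open \<Omega>"
    using assms by (simp add: lipschitz_domain_def)
  then show "\<Omega> \<subseteq> interior (closure \<Omega>)"
    by (simp add: interior_maximal closure_subset)
  show "interior (closure \<Omega>) \<subseteq> \<Omega>"
  proof (rule subsetI, rule ccontr)
    fix p assume p: "p \<in> interior (closure \<Omega>)" "p \<notin> \<Omega>"
    then have "p \<in> frontier \<Omega>"
      using op interior_subset by (auto simp: frontier_def interior_open)
    then obtain e r \<gamma> L where *: "norm e = 1" "0 < r" "L-lipschitz_on {x. x \<bullet> e = 0} \<gamma>"
      "\<Omega> \<inter> ball p r = {x \<in> ball p r. \<gamma> (x - (x \<bullet> e) *\<^sub>R e) < x \<bullet> e}"
      using assms unfolding lipschitz_domain_def by blast
    have ee: "e \<bullet> e = 1"
      using *(1) by (simp add: dot_square_norm)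
    define H where "H x = \<gamma> (x - (x \<bullet> e) *\<^sub>R e) - x \<bullet> e" for x
    have "continuous_on UNIV (\<lambda>x. \<gamma> (x - (x \<bullet> e) *\<^sub>R e))"
    proof (rule continuous_on_compose2[OF lipschitz_on_continuous_on[OF *(3)]])
      show "continuous_on UNIV (\<lambda>x. x - (x \<bullet> e) *\<^sub>R e)"
        by (intro continuous_intros)
      show "(\<lambda>x. x - (x \<bullet> e) *\<^sub>R e) ` UNIV \<subseteq> {x. x \<bullet> e = 0}"
        using ee by (auto simp: inner_diff_left)
    qed
    then have contH: "continuous_on UNIV H"
      unfolding H_def by (intro continuous_intros)
    have \<Omega>_iff: "x \<in> \<Omega> \<longleftrightarrow> H x < 0" if "x \<in> ball p r" for x
      using set_eq_iff[THEN iffD1, OF *(4), rule_format, of x] that by (simp add: H_def)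
    define U where "U = {x. 0 < H x} \<inter> ball p r"
    have "open U"
      unfolding U_def using contH by (intro open_Int open_Collect_less continuous_on_const) auto
    moreover have "U \<inter> \<Omega> = {}"
      using \<Omega>_iff by (auto simp: U_def)
    ultimately have "U \<inter> closure \<Omega> = {}"
      using open_Int_closure_eq_empty by blast
    obtain s where s: "0 < s" "ball p s \<subseteq> closure \<Omega>"
      using p(1) by (auto simp: mem_interior)
    define t where "t = min r s / 2"
    have t: "0 < t" "t < r" "t < s"
      using *(2) s(1) by (auto simp: t_def)
    have dist: "dist p (p - t *\<^sub>R e) = t"
      using t(1) *(1) by (simp add: dist_norm)
    have pe: "(p - t *\<^sub>R e) \<bullet> e = p \<bullet> e - t"
      using ee by (simp add: inner_diff_left)
    have proj: "p - t *\<^sub>R e - (p \<bullet> e - t) *\<^sub>R e = p - (p \<bullet> e) *\<^sub>R e"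
      by (simp add: algebra_simps)
    have "H (p - t *\<^sub>R e) = H p + t"
      unfolding H_def pe proj by simp
    moreover have "0 \<le> H p"
      using \<Omega>_iff[of p] p(2) *(2) by auto
    ultimately have "p - t *\<^sub>R e \<in> U"
      using t dist by (simp add: U_def)
    moreover have "p - t *\<^sub>R e \<in> closure \<Omega>"
      using s(2) t dist by auto
    ultimately show False
      using \<open>U \<inter> closure \<Omega> = {}\<close> by blast
  qed
qed

context full_simplex
begin

text \<open>
  Near a relatively interior point of a side only one of the inequalities that define the simplex is active.
\<close>

lemma local_halfspace:
  assumes a: "a \<in> V" and x: "x \<in> rel_interior (opp_face T a)"
  obtains \<epsilon> where "\<epsilon> > 0"
    "\<And>y. y \<in> ball x \<epsilon> \<Longrightarrow> y \<in> T \<longleftrightarrow> 0 \<le> bary_grad T a \<bullet> (y - x)"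
    "\<And>y. y \<in> ball x \<epsilon> \<Longrightarrow> y \<in> interior T \<longleftrightarrow> 0 < bary_grad T a \<bullet> (y - x)"
proof -
  let ?U = "\<Inter>b\<in>V - {a}. {y. 0 < bary T b y}"
  have x': "bary T a x = 0" "\<forall>b\<in>V - {a}. 0 < bary T b x"
    using x unfolding opp_iff_bary(2)[OF a] by blast+
  have "open ?U"
    by (intro open_INT ballI open_Collect_less continuous_intros) simp
  moreover have "x \<in> ?U"
    using x'(2) by simp
  ultimately obtain \<epsilon> where \<epsilon>: "\<epsilon> > 0" "ball x \<epsilon> \<subseteq> ?U"
    using openE by blast
  have ya: "bary T a y = bary_grad T a \<bullet> (y - x)" for y
    using bary_diff[of a y x] x'(1) by simp
  have all_iff: "(\<forall>b\<in>V. Q (bary T b y)) \<longleftrightarrow> Q (bary T a y)" if "\<forall>b\<in>V - {a}. Q (bary T b y)" for Q y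
    using a that by blast
  have pos: "\<forall>b\<in>V - {a}. 0 < bary T b y" if "y \<in> ball x \<epsilon>" for y
    using \<epsilon>(2) that by blast
  show ?thesis
  proof (rule that[OF \<epsilon>(1)])
    fix y assume y: "y \<in> ball x \<epsilon>"
    have "\<forall>b\<in>V - {a}. 0 \<le> bary T b y"
      using pos[OF y] less_imp_le by blast
    then show "y \<in> T \<longleftrightarrow> 0 \<le> bary_grad T a \<bullet> (y - x)"
      using all_iff[of "\<lambda>r. 0 \<le> r" y] mem_iff_bary[of y] ya[of y] by simp
    show "y \<in> interior T \<longleftrightarrow> 0 < bary_grad T a \<bullet> (y - x)"
      using all_iff[of "\<lambda>r. 0 < r" y] pos[OF y] interior_iff_bary[of y] ya[of y] by simp
  qed
qed

lemma facet_nonempty_rel_interior: "S facet_of T \<Longrightarrow> rel_interior S \<noteq> {}"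
  unfolding facet_iff using rel_interior_opp_nonempty by blast

lemma finite_facets: "finite {S. S facet_of T}"
  unfolding facets_eq by simp

end

locale mesh =
  fixes \<Omega> :: "'a::euclidean_space set" and \<T> :: "'a set set"
  assumes lip: "lipschitz_domain \<Omega>" and simplicial: "simplicial_mesh \<Omega> \<T>"
begin

abbreviation "CR \<equiv> crouzeix_raviart \<Omega> \<T>"
abbreviation "RT \<equiv> raviart_thomas \<Omega> \<T>"
abbreviation "\<B> \<equiv> boundary_sides \<Omega> \<T>"

lemma open_domain: "open \<Omega>"
  using lip by (simp add: lipschitz_domain_def)

lemma finite_mesh [simp]: "finite \<T>"
  using simplicial by (simp add: simplicial_mesh_def triangulation_def)

lemma element: "T \<in> \<T> \<Longrightarrow> full_simplex T"
  using simplicial by (auto simp: simplicial_mesh_def full_simplex_def)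

lemma Union_mesh: "\<Union>\<T> = closure \<Omega>"
  using simplicial by (simp add: simplicial_mesh_def)

lemma face_inter: "T \<in> \<T> \<Longrightarrow> T' \<in> \<T> \<Longrightarrow> (T \<inter> T') face_of T"
  using simplicial by (simp add: simplicial_mesh_def triangulation_def)

lemma face_inter': "T \<in> \<T> \<Longrightarrow> T' \<in> \<T> \<Longrightarrow> (T \<inter> T') face_of T'"
  using face_inter[of T' T] by (simp add: Int_commute)

lemma interior_subset_domain: "T \<in> \<T> \<Longrightarrow> interior T \<subseteq> \<Omega>"
  using lipschitz_domain_interior_closure[OF lip] Union_mesh interior_mono[of T "closure \<Omega>"] by auto

lemma interiors_disjoint:
  assumes "T \<in> \<T>" "T' \<in> \<T>" "x \<in> interior T" "x \<in> interior T'"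
  shows "T = T'"
proof -
  have x: "x \<in> T \<inter> T'"
    using assms interior_subset by blast
  have "T \<inter> T' = T"
    using face_of_disjoint_interior[OF face_inter[OF assms(1,2)]] x assms(3) by blast
  moreover have "T \<inter> T' = T'"
    using face_of_disjoint_interior[OF face_inter'[OF assms(1,2)]] x assms(4) by blast
  ultimately show ?thesis by simp
qed

lemma finite_sides [simp]: "finite (sides \<T>)"
proof -
  have "sides \<T> = (\<Union>T\<in>\<T>. {S. S facet_of T})"
    by (auto simp: sides_def)
  also have "finite \<dots>"
    by (intro finite_UN_I finite_mesh full_simplex.finite_facets element)
  finally show ?thesis .
qed

lemma side_nonempty:
  assumes "S \<in> sides \<T>"
  shows "rel_interior S \<noteq> {}"
proof -
  obtain T where T: "T \<in> \<T>" "S facet_of T"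
    using assms unfolding sides_def by blast
  show ?thesis
    by (rule full_simplex.facet_nonempty_rel_interior[OF element[OF T(1)] T(2)])
qed

text \<open>
  By conformity both sides are faces of the same element, and faces of one convex set with a common
  relatively interior point are equal.
\<close>

lemma rel_interiors_disjoint:
  assumes "S \<in> sides \<T>" "S' \<in> sides \<T>" "x \<in> rel_interior S" "x \<in> rel_interior S'"
  shows "S = S'"
proof -
  obtain T where T: "T \<in> \<T>" "S facet_of T"
    using assms(1) unfolding sides_def by blast
  obtain T' where T': "T' \<in> \<T>" "S' facet_of T'"
    using assms(2) unfolding sides_def by blast
  note F = facet_of_imp_face_of[OF T(2)] facet_of_imp_face_of[OF T'(2)]
    facet_of_imp_subset[OF T(2)] facet_of_imp_subset[OF T'(2)]
  have xS: "x \<in> S" "x \<in> S'"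
    using subsetD[OF rel_interior_subset assms(3)] subsetD[OF rel_interior_subset assms(4)] by simp_all
  have "S' \<subseteq> T \<inter> T'"
    using xS F assms(4) by (intro subset_of_face_of[OF face_inter'[OF T(1) T'(1)] F(4)]) blast
  then have "S' face_of T \<inter> T'"
    using F(2) by (intro face_of_subset[OF F(2)]) auto
  then have "S' face_of T"
    using face_inter[OF T(1) T'(1)] face_of_trans by blast
  then show ?thesis
    using face_of_eq[OF F(1)] assms(3,4) by blast
qed

text \<open>
  If two elements lay on the same side of a common side, their interiors would meet.
\<close>

lemma opposite_neighbours:
  assumes T: "T \<in> \<T>" "a \<in> verts T" and T': "T' \<in> \<T>" "a' \<in> verts T'"
    and S: "opp_face T a = opp_face T' a'" and ne: "T \<noteq> T'"
  obtains r where "r < 0" "bary_grad T' a' = r *\<^sub>R bary_grad T a"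
proof -
  interpret T: full_simplex T by (rule element[OF T(1)])
  interpret T': full_simplex T' by (rule element[OF T'(1)])
  obtain b where "b \<in> verts T - {a}"
    using T.verts_minus_nonempty[OF T(2)] by blast
  then obtain r where r: "bary_grad T' a' = r *\<^sub>R bary_grad T a"
    using T.orthogonal_opp_eq_bary_grad[OF T(2) _ \<open>b \<in> verts T - {a}\<close>, of "bary_grad T' a'"] T'.bary_grad_inner_opp[OF T'(2)]
    unfolding S by blast
  have "r < 0"
  proof (rule ccontr)
    assume "\<not> r < 0"
    moreover have "r \<noteq> 0"
      using r T'.bary_grad_nonzero[OF T'(2)] by auto
    ultimately have "r > 0" by simp
    obtain x where x: "x \<in> rel_interior (opp_face T a)"
      using T.rel_interior_opp_nonempty[OF T(2)] by blast
    obtain \<epsilon> where \<epsilon>: "\<epsilon> > 0" "\<And>y. y \<in> ball x \<epsilon> \<Longrightarrow> y \<in> T \<longleftrightarrow> 0 \<le> bary_grad T a \<bullet> (y - x)"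
      "\<And>y. y \<in> ball x \<epsilon> \<Longrightarrow> y \<in> interior T \<longleftrightarrow> 0 < bary_grad T a \<bullet> (y - x)"
      by (rule T.local_halfspace[OF T(2) x]) (rule that)
    obtain \<epsilon>' where \<epsilon>': "\<epsilon>' > 0" "\<And>y. y \<in> ball x \<epsilon>' \<Longrightarrow> y \<in> T' \<longleftrightarrow> 0 \<le> bary_grad T' a' \<bullet> (y - x)"
      "\<And>y. y \<in> ball x \<epsilon>' \<Longrightarrow> y \<in> interior T' \<longleftrightarrow> 0 < bary_grad T' a' \<bullet> (y - x)"
      by (rule T'.local_halfspace[OF T'(2) x[unfolded S]]) (rule that)
    let ?g = "bary_grad T a"
    define t where "t = min \<epsilon> \<epsilon>' / (2 * norm ?g)"
    have g: "?g \<noteq> 0"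
      by (rule T.bary_grad_nonzero[OF T(2)])
    then have t: "t > 0"
      using \<epsilon>(1) \<epsilon>'(1) by (simp add: t_def)
    have "norm (t *\<^sub>R ?g) = min \<epsilon> \<epsilon>' / 2"
      using t g \<epsilon>(1) \<epsilon>'(1) by (simp add: t_def)
    then have "x + t *\<^sub>R ?g \<in> ball x \<epsilon>" "x + t *\<^sub>R ?g \<in> ball x \<epsilon>'"
      using \<epsilon>(1) \<epsilon>'(1) by (auto simp: dist_norm)
    moreover have "0 < ?g \<bullet> (x + t *\<^sub>R ?g - x)" "0 < bary_grad T' a' \<bullet> (x + t *\<^sub>R ?g - x)"
      using t g \<open>r > 0\<close> by (simp_all add: r)
    ultimately have "x + t *\<^sub>R ?g \<in> interior T" "x + t *\<^sub>R ?g \<in> interior T'"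
      using \<epsilon>(3) \<epsilon>'(3) by blast+
    then show False
      using interiors_disjoint[OF T(1) T'(1)] ne by blast
  qed
  then show ?thesis
    using r that by blast
qed

definition neighbours :: "'a set \<Rightarrow> 'a set set" where
  "neighbours S = {T \<in> \<T>. S facet_of T}"

lemma opposite_normals:
  assumes "T \<in> neighbours S" "T' \<in> neighbours S" "T \<noteq> T'"
  shows "outer_normal T' S = - outer_normal T S"
proof -
  have TT: "T \<in> \<T>" "T' \<in> \<T>" "S facet_of T" "S facet_of T'"
    using assms by (auto simp: neighbours_def)
  interpret T: full_simplex T by (rule element[OF TT(1)])
  interpret T': full_simplex T' by (rule element[OF TT(2)])
  obtain a where a: "a \<in> verts T" "S = opp_face T a"
    using TT(3) unfolding T.facet_iff by blast
  obtain a' where a': "a' \<in> verts T'" "S = opp_face T' a'"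
    using TT(4) unfolding T'.facet_iff by blast
  obtain r where r: "r < 0" "bary_grad T' a' = r *\<^sub>R bary_grad T a"
    using opposite_neighbours[OF TT(1) a(1) TT(2) a'(1) trans[OF a(2)[symmetric] a'(2)] assms(3)] by blast
  have "outer_normal T' S = - bary_grad T' a' /\<^sub>R norm (bary_grad T' a')"
    unfolding a'(2) by (rule T'.outer_normal_opp[OF a'(1)])
  also have "\<dots> = bary_grad T a /\<^sub>R norm (bary_grad T a)"
    using r(1) by (simp add: r(2))
  also have "\<dots> = - outer_normal T S"
    unfolding a(2) T.outer_normal_opp[OF a(1)] by simp
  finally show ?thesis .
qed

text \<open>
  A third neighbour would have an outer normal opposite to each of two opposite vectors.  Two neighbours
  together cover a neighbourhood of each relatively interior point of the side.
\<close>

lemma two_neighbours: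
  assumes "T \<in> neighbours S" "T' \<in> neighbours S" "T \<noteq> T'"
  shows "neighbours S = {T, T'}" and "rel_interior S \<subseteq> \<Omega>"
proof -
  have TT: "T \<in> \<T>" "T' \<in> \<T>" "S facet_of T" "S facet_of T'"
    using assms by (auto simp: neighbours_def)
  interpret T: full_simplex T by (rule element[OF TT(1)])
  interpret T': full_simplex T' by (rule element[OF TT(2)])
  obtain a where a: "a \<in> verts T" "S = opp_face T a"
    using TT(3) unfolding T.facet_iff by blast
  obtain a' where a': "a' \<in> verts T'" "S = opp_face T' a'"
    using TT(4) unfolding T'.facet_iff by blast
  obtain r where r: "r < 0" "bary_grad T' a' = r *\<^sub>R bary_grad T a"
    using opposite_neighbours[OF TT(1) a(1) TT(2) a'(1) trans[OF a(2)[symmetric] a'(2)] assms(3)] by blast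
  have "T'' = T \<or> T'' = T'" if "T'' \<in> neighbours S" for T''
  proof (rule ccontr)
    assume *: "\<not> (T'' = T \<or> T'' = T')"
    have n: "outer_normal T'' S = - outer_normal T S" "outer_normal T'' S = - outer_normal T' S"
      "outer_normal T' S = - outer_normal T S"
      using opposite_normals assms that * by blast+
    then have "outer_normal T S = - outer_normal T S"
      by simp
    then have "2 *\<^sub>R outer_normal T S = 0"
      by (metis add.right_inverse scaleR_2)
    then have "outer_normal T S = 0"
      by simp
    then show False
      unfolding a(2) T.outer_normal_opp[OF a(1)] using T.bary_grad_nonzero[OF a(1)] by simp
  qed
  with assms show "neighbours S = {T, T'}"
    by blast
  show "rel_interior S \<subseteq> \<Omega>"
  proof
    fix x assume x: "x \<in> rel_interior S"
    obtain \<epsilon> where \<epsilon>: "\<epsilon> > 0" "\<And>y. y \<in> ball x \<epsilon> \<Longrightarrow> y \<in> T \<longleftrightarrow> 0 \<le> bary_grad T a \<bullet> (y - x)"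
      "\<And>y. y \<in> ball x \<epsilon> \<Longrightarrow> y \<in> interior T \<longleftrightarrow> 0 < bary_grad T a \<bullet> (y - x)"
      by (rule T.local_halfspace[OF a(1) x[unfolded a(2)]]) (rule that)
    obtain \<epsilon>' where \<epsilon>': "\<epsilon>' > 0" "\<And>y. y \<in> ball x \<epsilon>' \<Longrightarrow> y \<in> T' \<longleftrightarrow> 0 \<le> bary_grad T' a' \<bullet> (y - x)"
      "\<And>y. y \<in> ball x \<epsilon>' \<Longrightarrow> y \<in> interior T' \<longleftrightarrow> 0 < bary_grad T' a' \<bullet> (y - x)"
      by (rule T'.local_halfspace[OF a'(1) x[unfolded a'(2)]]) (rule that)
    have "ball x (min \<epsilon> \<epsilon>') \<subseteq> closure \<Omega>"
    proof
      fix y assume "y \<in> ball x (min \<epsilon> \<epsilon>')"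
      then have y: "y \<in> ball x \<epsilon>" "y \<in> ball x \<epsilon>'"
        by simp_all
      have "0 \<le> bary_grad T a \<bullet> (y - x) \<or> 0 \<le> bary_grad T' a' \<bullet> (y - x)"
        using r by (auto simp: zero_le_mult_iff)
      then have "y \<in> T \<or> y \<in> T'"
        using \<epsilon>(2)[OF y(1)] \<epsilon>'(2)[OF y(2)] by blast
      then show "y \<in> closure \<Omega>"
        using TT(1,2) Union_mesh by blast
    qed
    moreover have "x \<in> ball x (min \<epsilon> \<epsilon>')"
      using \<epsilon>(1) \<epsilon>'(1) by simp
    ultimately have "x \<in> interior (closure \<Omega>)"
      using interior_maximal[OF _ open_ball] by blast
    then show "x \<in> \<Omega>"
      using lipschitz_domain_interior_closure[OF lip] by blast
  qed
qed

text \<open>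
  An element \<open>T'\<close> that contains a relatively interior point of \<open>S\<close> meets \<open>T\<close> in a proper face containing
  \<open>S\<close>, hence in \<open>S\<close>, and would be a second neighbour.  So near such a point only \<open>T\<close> is
  available, and it leaves out the half-space beyond \<open>S\<close>.
\<close>

lemma one_neighbour:
  assumes S: "neighbours S = {T}"
  shows "S \<subseteq> frontier \<Omega>"
proof -
  have T: "T \<in> \<T>" "S facet_of T"
    using S by (auto simp: neighbours_def)
  interpret T: full_simplex T by (rule element[OF T(1)])
  obtain a where a: "a \<in> verts T" "S = opp_face T a"
    using T(2) unfolding T.facet_iff by blast
  have "rel_interior S \<subseteq> frontier \<Omega>"
  proof
    fix x assume x: "x \<in> rel_interior S"
    then have xS: "x \<in> S" and xT: "x \<in> T"
      using rel_interior_subset facet_of_imp_subset[OF T(2)] by blast+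
    have others: "x \<notin> T'" if T': "T' \<in> \<T>" "T' \<noteq> T" for T'
    proof
      assume "x \<in> T'"
      interpret T': full_simplex T' by (rule element[OF T'(1)])
      let ?F = "T \<inter> T'"
      have SF: "S \<subseteq> ?F"
        using \<open>x \<in> T'\<close> xT x facet_of_imp_subset[OF T(2)]
        by (intro subset_of_face_of[OF face_inter[OF T(1) T'(1)]]) auto
      have ne: "?F \<noteq> T"
      proof
        assume "?F = T"
        then have "interior T \<subseteq> interior T'"
          by (intro interior_mono) blast
        then show False
          using T.interior_nonempty interiors_disjoint[OF T(1) T'(1)] T'(2) by blast
      qed
      have lt: "aff_dim ?F < aff_dim T"
        by (rule face_of_aff_dim_lt[OF T.convex face_inter[OF T(1) T'(1)] ne])
      have dimS: "aff_dim S = aff_dim T - 1" "S \<noteq> {}"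
        using T(2) by (auto simp: facet_of_def)
      have "S face_of ?F"
        by (rule face_of_subset[OF facet_of_imp_face_of[OF T(2)] SF]) blast
      then have "S = ?F"
        using face_of_aff_dim_lt[of ?F S] lt dimS convex_Int[OF T.convex T'.convex] by force
      moreover have "aff_dim T' = aff_dim T"
        using aff_dim_simplex[OF T.simplex] aff_dim_simplex[OF T'.simplex] by simp
      ultimately have "S facet_of T'"
        using face_inter'[OF T(1) T'(1)] dimS by (simp add: facet_of_def)
      then have "T' \<in> neighbours S"
        using T'(1) by (simp add: neighbours_def)
      then show False
        using S T'(2) by blast
    qed
    obtain \<epsilon> where \<epsilon>: "\<epsilon> > 0" "\<And>y. y \<in> ball x \<epsilon> \<Longrightarrow> y \<in> T \<longleftrightarrow> 0 \<le> bary_grad T a \<bullet> (y - x)"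
      "\<And>y. y \<in> ball x \<epsilon> \<Longrightarrow> y \<in> interior T \<longleftrightarrow> 0 < bary_grad T a \<bullet> (y - x)"
      by (rule T.local_halfspace[OF a(1) x[unfolded a(2)]]) (rule that)
    have "closed (\<Union>(\<T> - {T}))"
      using full_simplex.closed[OF element] by (intro closed_Union) auto
    moreover have "x \<notin> \<Union>(\<T> - {T})"
      using others by blast
    ultimately obtain \<delta> where \<delta>: "\<delta> > 0" "ball x \<delta> \<subseteq> - \<Union>(\<T> - {T})"
      using openE[of "- \<Union>(\<T> - {T})" x] by (auto simp: open_Compl)
    have "x \<notin> \<Omega>"
    proof
      assume "x \<in> \<Omega>"
      then obtain \<eta> where \<eta>: "\<eta> > 0" "ball x \<eta> \<subseteq> \<Omega>"
        using openE[OF open_domain] by blast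
      let ?g = "bary_grad T a"
      define t where "t = min \<epsilon> (min \<delta> \<eta>) / (2 * norm ?g)"
      have g: "?g \<noteq> 0"
        by (rule T.bary_grad_nonzero[OF a(1)])
      have t: "t > 0"
        using \<epsilon>(1) \<delta>(1) \<eta>(1) g by (simp add: t_def)
      define y where "y = x - t *\<^sub>R ?g"
      have "dist x y = min \<epsilon> (min \<delta> \<eta>) / 2"
        using t g \<epsilon>(1) \<delta>(1) \<eta>(1) by (simp add: y_def dist_norm t_def)
      then have y: "y \<in> ball x \<epsilon>" "y \<in> ball x \<delta>" "y \<in> ball x \<eta>"
        using \<epsilon>(1) \<delta>(1) \<eta>(1) by auto
      have "y \<in> closure \<Omega>"
        using y(3) \<eta>(2) closure_subset by blast
      then have "y \<in> T"
        using y(2) \<delta>(2) Union_mesh by blast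
      moreover have "?g \<bullet> (y - x) < 0"
        using t g by (simp add: y_def)
      ultimately show False
        using \<epsilon>(2)[OF y(1)] by simp
    qed
    moreover have "x \<in> closure \<Omega>"
      using xT T(1) Union_mesh by blast
    ultimately show "x \<in> frontier \<Omega>"
      using open_domain by (simp add: frontier_def interior_open)
  qed
  then have "closure (rel_interior S) \<subseteq> frontier \<Omega>"
    by (intro closure_minimal) (auto simp: frontier_closed)
  moreover have "convex S"
    using face_of_imp_convex[OF facet_of_imp_face_of[OF T(2)] ] T.convex by simp
  ultimately show ?thesis
    using convex_closure_rel_interior[of S] closure_subset[of S] by blast
qed

lemma boundary_side_iff:
  assumes S: "S \<in> sides \<T>"
  shows "S \<in> \<B> \<longleftrightarrow> neighbours S = {adjacent \<T> S}"
proof -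
  obtain T where T: "T \<in> neighbours S"
    using S by (auto simp: sides_def neighbours_def)
  then have "adjacent \<T> S \<in> neighbours S"
    unfolding adjacent_def neighbours_def using someI_ex[of "\<lambda>T. T \<in> \<T> \<and> S facet_of T"] by auto
  then have "neighbours S = {adjacent \<T> S}" if "S \<subseteq> frontier \<Omega>"
  proof -
    have "\<not> rel_interior S \<subseteq> \<Omega>"
      using that rel_interior_subset[of S] side_nonempty[OF S] open_domain
      by (auto simp: frontier_def interior_open)
    then show ?thesis
      using two_neighbours(2) \<open>adjacent \<T> S \<in> neighbours S\<close> by blast
  qed
  moreover have "S \<subseteq> frontier \<Omega>" if "neighbours S = {adjacent \<T> S}"
    using one_neighbour[OF that] .
  ultimately show ?thesis
    using S by (auto simp: boundary_sides_def)
qed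

lemma non_boundary_side:
  assumes S: "S \<in> sides \<T>" "S \<notin> \<B>"
  obtains T T' where "T \<noteq> T'" "neighbours S = {T, T'}" "S \<in> interior_sides \<Omega> \<T>"
proof -
  obtain T where T: "T \<in> neighbours S"
    using S by (auto simp: sides_def neighbours_def)
  have "neighbours S \<noteq> {T}"
    using one_neighbour S by (auto simp: boundary_sides_def)
  then obtain T' where T': "T' \<in> neighbours S" "T \<noteq> T'"
    using T by blast
  show ?thesis
    using that[OF T'(2)] two_neighbours[OF T T'] S by (simp add: interior_sides_def)
qed

lemma sum_elements_facets:
  "(\<Sum>T\<in>\<T>. \<Sum>S | S facet_of T. h T S) = (\<Sum>S\<in>sides \<T>. \<Sum>T\<in>neighbours S. h T S)"
proof -
  have "(\<Sum>T\<in>\<T>. \<Sum>S | S facet_of T. h T S) = (\<Sum>T\<in>\<T>. \<Sum>S | S \<in> sides \<T> \<and> S facet_of T. h T S)"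
    by (intro sum.cong) (auto simp: sides_def)
  also have "\<dots> = (\<Sum>S\<in>sides \<T>. \<Sum>T | T \<in> \<T> \<and> S facet_of T. h T S)"
    by (rule sum.swap_restrict) auto
  finally show ?thesis
    by (simp add: neighbours_def)
qed

end

section \<open>Discrete integration by parts on the mesh\<close>

context full_simplex
begin

lemma affine_onE:
  assumes "affine_on v"
  obtains A c where "linear A" "\<And>x. x \<in> interior T \<Longrightarrow> v x = A x + c" "\<And>x. x \<in> T \<Longrightarrow> elt_trace T v x = A x + c"
proof -
  obtain A c where A: "linear A" "\<And>x. x \<in> interior T \<Longrightarrow> v x = A x + c"
    using assms unfolding affine_on_def by blast
  show ?thesis
    by (rule that[OF A]) (use elt_trace_linear_eq[OF A] in auto)
qed

lemma elt_trace_add: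
  fixes v :: "'a \<Rightarrow> 'b::euclidean_space"
  assumes v: "affine_on v" and B: "linear B" and w: "\<And>x. x \<in> interior T \<Longrightarrow> w x = v x + (B x + k)"
  shows "affine_on w" and "x \<in> T \<Longrightarrow> elt_trace T w x = elt_trace T v x + (B x + k)"
proof -
  obtain A c where A: "linear A" "\<And>x. x \<in> interior T \<Longrightarrow> v x = A x + c" "\<And>x. x \<in> T \<Longrightarrow> elt_trace T v x = A x + c"
    by (rule affine_onE[OF v]) (rule that)
  have lin: "linear (\<lambda>x. A x + B x)"
    by (rule linear_compose_add[OF A(1) B])
  have eq: "w x = (A x + B x) + (c + k)" if "x \<in> interior T" for x
    using w[OF that] A(2)[OF that] by (simp add: algebra_simps)
  show "affine_on w"
    unfolding affine_on_def using lin eq by blast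
  show "elt_trace T w x = elt_trace T v x + (B x + k)" if "x \<in> T"
    using elt_trace_linear_eq[OF lin eq that] A(3)[OF that] by (simp add: algebra_simps)
qed

lemma side_avg_vertices:
  assumes S: "S facet_of T" and A: "linear A" and w: "\<And>x. x \<in> S \<Longrightarrow> w x = A x + c"
  shows "side_avg S w = (\<Sum>b\<in>verts S. w b) / DIM('a)"
proof -
  obtain a where a: "a \<in> V" "S = opp_face T a"
    using S unfolding facet_iff by blast
  interpret side: simplex_side T a
    by unfold_locales (rule a)
  have S': "S = side.S"
    unfolding side.S_def by (rule a)
  show ?thesis
    unfolding S' by (rule side.side_avg_affine[OF A]) (use w S' in blast)
qed

lemma facet_measure:
  assumes S: "S facet_of T"
  shows "0 < side_area S"
    and "AE x in side_measure S. x \<in> rel_interior S"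
    and "(\<And>x. x \<in> rel_interior S \<Longrightarrow> w x = k) \<Longrightarrow> (\<integral>x. w x \<partial>side_measure S) = side_area S * k"
proof -
  obtain a where a: "a \<in> V" "S = opp_face T a"
    using S unfolding facet_iff by blast
  interpret side: simplex_side T a
    by unfold_locales (rule a)
  have S': "S = side.S"
    unfolding side.S_def by (rule a)
  show "0 < side_area S"
    unfolding S' by (rule side.side_area_pos)
  show "AE x in side_measure S. x \<in> rel_interior S"
    unfolding S' side_measure_def by (rule AE_completion[OF side.AE_side_rel_interior])
  assume w: "\<And>x. x \<in> rel_interior S \<Longrightarrow> w x = k"
  have "(\<integral>x. w x \<partial>side_measure S) = (\<integral>x. indicator (side_cylinder side.S) x * k \<partial>lborel)"
    unfolding S' using w[unfolded S'] by (intro side.integral_side) auto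
  also have "\<dots> = side_area S * k"
    unfolding S' side.side_area_eq by simp
  finally show "(\<integral>x. w x \<partial>side_measure S) = side_area S * k" .
qed

lemma rel_interior_eq: "rel_interior T = interior T"
  using interior_nonempty rel_interior_nonempty_interior by blast

end

text \<open>
  The value of a function that is constant on the relative interior of an element or side.
\<close>

definition piece :: "('a::euclidean_space \<Rightarrow> 'b) \<Rightarrow> 'a set \<Rightarrow> 'b" where
  "piece w K = w (SOME x. x \<in> rel_interior K)"

lemma piece_eq:
  assumes "\<exists>c. \<forall>x\<in>rel_interior K. w x = c" "x \<in> rel_interior K"
  shows "w x = piece w K"
proof -
  have "(SOME x. x \<in> rel_interior K) \<in> rel_interior K"
    using assms(2) by (rule someI)
  then show ?thesis
    using assms unfolding piece_def by metis
qed

context mesh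
begin

lemma affine_on_element:
  "elt_affine \<T> v \<Longrightarrow> T \<in> \<T> \<Longrightarrow> full_simplex.affine_on T v"
  unfolding elt_affine_def full_simplex.affine_on_def[OF element] by blast

lemma elt_affineI:
  "(\<And>T. T \<in> \<T> \<Longrightarrow> full_simplex.affine_on T v) \<Longrightarrow> elt_affine \<T> v"
  unfolding elt_affine_def by (metis element full_simplex.affine_on_def)

lemma AE_element_interiors: "AE x in lborel. \<forall>T\<in>\<T>. x \<in> T \<longrightarrow> x \<in> interior T"
  using full_simplex.AE_interior[OF element] by (intro AE_finite_allI) auto

lemma domain_lebesgue: "\<Omega> \<in> sets lebesgue"
  using open_domain by simp

lemma integral_domain:
  fixes F :: "'a \<Rightarrow> real"
  assumes F: "\<And>T x. T \<in> \<T> \<Longrightarrow> x \<in> interior T \<Longrightarrow> F x = h T"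
  shows "(\<integral>x. F x \<partial>lebesgue_on \<Omega>) = (\<Sum>T\<in>\<T>. volume T * h T)"
proof -
  have meas: "T \<in> sets borel" if "T \<in> \<T>" for T
    using full_simplex.closed[OF element[OF that]] by (rule borel_closed)
  have "(\<integral>x. F x \<partial>lebesgue_on \<Omega>) = (\<integral>x. indicator \<Omega> x *\<^sub>R F x \<partial>lebesgue)"
    using domain_lebesgue by (intro integral_restrict_space) simp
  also have "\<dots> = (\<integral>x. (\<Sum>T\<in>\<T>. indicator T x * h T) \<partial>lborel)"
  proof (rule integral_completion_cong_AE)
    show "(\<lambda>x. \<Sum>T\<in>\<T>. indicator T x * h T) \<in> borel_measurable lborel"
      using meas by (intro borel_measurable_sum borel_measurable_times borel_measurable_indicator) auto
    show "AE x in lborel. indicator \<Omega> x *\<^sub>R F x = (\<Sum>T\<in>\<T>. indicator T x * h T)"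
      using AE_element_interiors
    proof eventually_elim
      case (elim x)
      show ?case
      proof (cases "x \<in> \<Omega>")
        case True
        then have "x \<in> \<Union>\<T>"
          using Union_mesh closure_subset by blast
        then obtain T where T: "T \<in> \<T>" "x \<in> T"
          by blast
        then have xT: "x \<in> interior T"
          using elim by blast
        have "x \<notin> T'" if "T' \<in> \<T> - {T}" for T'
          using that elim interiors_disjoint[OF _ T(1) _ xT] by blast
        then have "(\<Sum>T'\<in>\<T>. indicator T' x * h T') = h T"
          using T by (subst sum.remove[OF finite_mesh T(1)]) simp
        then show ?thesis
          using True F[OF T(1) xT] by simp
      next
        case False
        have "x \<notin> T" if "T \<in> \<T>" for T
          using that False elim interior_subset_domain by blast
        then show ?thesis
          using False by simp
      qed
    qed
  qed
  also have "\<dots> = (\<Sum>T\<in>\<T>. \<integral>x. indicator T x * h T \<partial>lborel)"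
  proof (rule Bochner_Integration.integral_sum)
    fix T assume T: "T \<in> \<T>"
    have "emeasure lborel T < \<infinity>"
      using emeasure_bounded_finite[OF compact_imp_bounded[OF full_simplex.compact[OF element[OF T]]]] .
    then show "integrable lborel (\<lambda>x. indicator T x * h T)"
      using meas[OF T] by (intro integrable_mult_left) (simp add: integrable_indicator_iff)
  qed
  also have "\<dots> = (\<Sum>T\<in>\<T>. volume T * h T)"
    using meas by (intro sum.cong) (auto simp: volume_def)
  finally show ?thesis .
qed

lemma AE_domainD:
  assumes "AE x in lebesgue_on \<Omega>. Q x" "T \<in> \<T>"
  obtains x where "x \<in> interior T" "Q x"
proof -
  have ae: "AE x in lebesgue. x \<in> \<Omega> \<longrightarrow> Q x"
    using assms(1) domain_lebesgue by (subst (asm) AE_restrict_space_iff) auto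
  have "\<exists>x. x \<in> interior T \<and> Q x"
  proof (rule ccontr)
    assume no: "\<nexists>x. x \<in> interior T \<and> Q x"
    from ae have "AE x in lebesgue. x \<notin> interior T"
      by eventually_elim (use no interior_subset_domain[OF assms(2)] in blast)
    then have "negligible (interior T)"
      by (simp add: negligible_iff_null_sets AE_iff_null_sets)
    then show False
      using open_not_negligible[OF open_interior full_simplex.interior_nonempty[OF element[OF assms(2)]]] by blast
  qed
  then show ?thesis
    using that by blast
qed

lemma AE_domainI:
  assumes "\<And>T x. T \<in> \<T> \<Longrightarrow> x \<in> interior T \<Longrightarrow> Q x"
  shows "AE x in lebesgue_on \<Omega>. Q x"
proof -
  have "AE x in lebesgue. x \<in> \<Omega> \<longrightarrow> Q x"
    using AE_completion[OF AE_element_interiors]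
  proof eventually_elim
    case (elim x)
    show ?case
    proof
      assume "x \<in> \<Omega>"
      then have "x \<in> \<Union>\<T>"
        using Union_mesh closure_subset by blast
      then show "Q x"
        using elim assms by blast
    qed
  qed
  then show ?thesis
    using domain_lebesgue by (subst AE_restrict_space_iff) auto
qed

lemma sidewise_eq:
  assumes "S \<in> sides \<T>" "x \<in> rel_interior S"
  shows "sidewise \<T> w x = w S x"
proof -
  have "x \<notin> rel_interior S'" if "S' \<in> sides \<T> - {S}" for S'
    using that rel_interiors_disjoint[OF assms(1) _ assms(2)] by blast
  then show ?thesis
    unfolding sidewise_def using assms by (subst sum.remove[OF finite_sides assms(1)]) simp
qed

lemma neighboursD: "T \<in> neighbours S \<Longrightarrow> T \<in> \<T>" "T \<in> neighbours S \<Longrightarrow> S facet_of T"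
  by (simp_all add: neighbours_def)

lemma adjacent_neighbour:
  assumes "S \<in> sides \<T>"
  shows "adjacent \<T> S \<in> neighbours S"
proof -
  have "\<exists>T. T \<in> \<T> \<and> S facet_of T"
    using assms unfolding sides_def by blast
  from someI_ex[OF this] show ?thesis
    by (simp add: neighbours_def adjacent_def)
qed

lemma side_area_pos: "S \<in> sides \<T> \<Longrightarrow> 0 < side_area S"
  using full_simplex.facet_measure(1)[OF element] adjacent_neighbour neighboursD by metis

lemma boundary_sides_subset: "\<B> \<subseteq> sides \<T>"
  by (auto simp: boundary_sides_def)

lemma sides_in_subset: "sides_in \<Omega> \<T> \<Gamma> \<subseteq> \<B>"
  by (auto simp: sides_in_def)

definition avg :: "('a \<Rightarrow> real) \<Rightarrow> 'a set \<Rightarrow> real" where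
  "avg v S = side_avg S (elt_trace (adjacent \<T> S) v)"

definition boundary_flux :: "('a \<Rightarrow> 'a) \<Rightarrow> 'a set \<Rightarrow> real" where
  "boundary_flux y S = flux (adjacent \<T> S) y S"

lemma side_proj_eq: "S \<in> sides \<T> \<Longrightarrow> x \<in> rel_interior S \<Longrightarrow> side_proj \<T> v x = avg v S"
  unfolding side_proj_def by (subst sidewise_eq) (auto simp: avg_def)

lemma flux_eq:
  assumes "y \<in> RT" "T \<in> \<T>" "S facet_of T" "x \<in> S"
  shows "elt_trace T y x \<bullet> outer_normal T S = flux T y S"
proof -
  obtain c where c: "\<forall>x\<in>S. elt_trace T y x \<bullet> outer_normal T S = c"
    using assms(1-3) unfolding raviart_thomas_def by blast
  have "rel_interior S \<noteq> {}"
    by (rule full_simplex.facet_nonempty_rel_interior[OF element[OF assms(2)] assms(3)])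
  then have "(SOME x. x \<in> rel_interior S) \<in> rel_interior S"
    by (simp add: some_in_eq)
  then have "(SOME x. x \<in> rel_interior S) \<in> S"
    by (rule subsetD[OF rel_interior_subset])
  then show ?thesis
    using c assms(4) unfolding flux_def by simp
qed

lemma normal_trace_eq:
  assumes "y \<in> RT" "S \<in> sides \<T>" "x \<in> rel_interior S"
  shows "normal_trace \<T> y x = boundary_flux y S"
  unfolding normal_trace_def boundary_flux_def
  using sidewise_eq[OF assms(2,3)] flux_eq[OF assms(1) neighboursD[OF adjacent_neighbour[OF assms(2)]]]
    subsetD[OF rel_interior_subset assms(3)] by simp

lemma side_avg_trace_diff:
  assumes v: "elt_affine \<T> v" and T: "T \<in> neighbours S" "T' \<in> neighbours S"
  shows "side_avg S (\<lambda>x. elt_trace T v x - elt_trace T' v x) =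
      side_avg S (elt_trace T v) - side_avg S (elt_trace T' v)"
proof -
  note TT = neighboursD[OF T(1)] neighboursD[OF T(2)]
  interpret T: full_simplex T by (rule element[OF TT(1)])
  interpret T': full_simplex T' by (rule element[OF TT(3)])
  obtain A c where A: "linear A" "\<And>x. x \<in> interior T \<Longrightarrow> v x = A x + c" "\<And>x. x \<in> T \<Longrightarrow> elt_trace T v x = A x + c"
    by (rule T.affine_onE[OF affine_on_element[OF v TT(1)]]) (rule that)
  obtain A' c' where A': "linear A'" "\<And>x. x \<in> interior T' \<Longrightarrow> v x = A' x + c'" "\<And>x. x \<in> T' \<Longrightarrow> elt_trace T' v x = A' x + c'"
    by (rule T'.affine_onE[OF affine_on_element[OF v TT(3)]]) (rule that)
  have sub: "x \<in> T" "x \<in> T'" if "x \<in> S" for x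
    using that facet_of_imp_subset[OF TT(2)] facet_of_imp_subset[OF TT(4)] by blast+
  have "linear (\<lambda>x. A x - A' x)"
    by (rule linear_compose_sub[OF A(1) A'(1)])
  from T.side_avg_vertices[OF TT(2) this, of _ "c - c'"]
  have "side_avg S (\<lambda>x. elt_trace T v x - elt_trace T' v x) =
      (\<Sum>b\<in>verts S. elt_trace T v b - elt_trace T' v b) / DIM('a)"
    using A(3) A'(3) sub by (simp add: algebra_simps)
  moreover have "side_avg S (elt_trace T v) = (\<Sum>b\<in>verts S. elt_trace T v b) / DIM('a)"
    using A(3) sub by (intro T.side_avg_vertices[OF TT(2) A(1)]) blast
  moreover have "side_avg S (elt_trace T' v) = (\<Sum>b\<in>verts S. elt_trace T' v b) / DIM('a)"
    using A'(3) sub by (intro T'.side_avg_vertices[OF TT(4) A'(1)]) blast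
  ultimately show ?thesis
    by (simp add: sum_subtractf diff_divide_distrib)
qed

text \<open>
  The vanishing average of the jump means that the average on a side can be taken from either neighbour.
\<close>

lemma crouzeix_raviart_iff:
  "v \<in> CR \<longleftrightarrow> elt_affine \<T> v \<and>
    (\<forall>S\<in>sides \<T>. \<forall>T\<in>neighbours S. side_avg S (elt_trace T v) = avg v S)" (is "_ \<longleftrightarrow> ?R")
proof
  assume v: "v \<in> CR"
  then have aff: "elt_affine \<T> v"
    by (simp add: crouzeix_raviart_def)
  have "side_avg S (elt_trace T v) = avg v S" if S: "S \<in> sides \<T>" and T: "T \<in> neighbours S" for S T
  proof (cases "T = adjacent \<T> S")
    case True
    then show ?thesis by (simp add: avg_def)
  next
    case False
    note adj = adjacent_neighbour[OF S]
    have "S \<in> interior_sides \<Omega> \<T>"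
      using two_neighbours(2)[OF T adj False] S by (simp add: interior_sides_def)
    then have "side_avg S (\<lambda>x. elt_trace T v x - elt_trace (adjacent \<T> S) v x) = 0"
      using v neighboursD[OF T] neighboursD[OF adj] False unfolding crouzeix_raviart_def by blast
    then show ?thesis
      using side_avg_trace_diff[OF aff T adj] by (simp add: avg_def)
  qed
  with aff show ?R by blast
next
  assume R: ?R
  have "side_avg S (\<lambda>x. elt_trace T v x - elt_trace T' v x) = 0"
    if "S \<in> interior_sides \<Omega> \<T>" "T \<in> \<T>" "T' \<in> \<T>" "S facet_of T" "S facet_of T'" for S T T'
  proof -
    have S: "S \<in> sides \<T>" "T \<in> neighbours S" "T' \<in> neighbours S"
      using that by (auto simp: interior_sides_def neighbours_def)
    then have "side_avg S (elt_trace T v) = avg v S" "side_avg S (elt_trace T' v) = avg v S"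
      using R by blast+
    then show ?thesis
      using side_avg_trace_diff[OF conjunct1[OF R] S(2,3)] by simp
  qed
  with R show "v \<in> CR"
    unfolding crouzeix_raviart_def by blast
qed

lemma sum_flux:
  assumes y: "y \<in> RT" and S: "S \<in> sides \<T>"
  shows "(\<Sum>T\<in>neighbours S. flux T y S) = (if S \<in> \<B> then boundary_flux y S else 0)"
proof (cases "S \<in> \<B>")
  case True
  then show ?thesis
    using boundary_side_iff[OF S] by (simp add: boundary_flux_def)
next
  case False
  then obtain T T' where T: "T \<noteq> T'" "neighbours S = {T, T'}" "S \<in> interior_sides \<Omega> \<T>"
    by (rule non_boundary_side[OF S]) (rule that)
  obtain x where x: "x \<in> S"
    using side_nonempty[OF S] rel_interior_subset by blast
  have TT: "T \<in> \<T>" "T' \<in> \<T>" "S facet_of T" "S facet_of T'"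
    using T(2) neighboursD[of _ S] by auto
  then have "elt_trace T y x \<bullet> outer_normal T S + elt_trace T' y x \<bullet> outer_normal T' S = 0"
    using y T x unfolding raviart_thomas_def by blast
  then have "flux T y S + flux T' y S = 0"
    using flux_eq[OF y TT(1) TT(3) x] flux_eq[OF y TT(2) TT(4) x] by simp
  then show ?thesis
    using False T by simp
qed

theorem discrete_integration_by_parts:
  assumes v: "v \<in> CR" and y: "y \<in> RT"
  shows "(\<Sum>T\<in>\<T>. volume T * (elt_grad T v \<bullet> mean T y + mean T v * elt_div T y)) =
      (\<Sum>S\<in>\<B>. side_area S * boundary_flux y S * avg v S)"
proof -
  have aff: "elt_affine \<T> v" "elt_affine \<T> y"
    using v y by (simp_all add: crouzeix_raviart_def raviart_thomas_def)
  have "volume T * (elt_grad T v \<bullet> mean T y + mean T v * elt_div T y) =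
      (\<Sum>S | S facet_of T. side_area S * flux T y S * side_avg S (elt_trace T v))" if T: "T \<in> \<T>" for T
    using y T unfolding raviart_thomas_def
    by (intro full_simplex.element_integration_by_parts[OF element[OF T] affine_on_element[OF aff(1) T]
          affine_on_element[OF aff(2) T]]) blast
  then have "(\<Sum>T\<in>\<T>. volume T * (elt_grad T v \<bullet> mean T y + mean T v * elt_div T y)) =
      (\<Sum>T\<in>\<T>. \<Sum>S | S facet_of T. side_area S * flux T y S * side_avg S (elt_trace T v))"
    by (intro sum.cong) auto
  also have "\<dots> = (\<Sum>S\<in>sides \<T>. \<Sum>T\<in>neighbours S. side_area S * flux T y S * side_avg S (elt_trace T v))"
    by (rule sum_elements_facets)
  also have "\<dots> = (\<Sum>S\<in>sides \<T>. if S \<in> \<B> then side_area S * boundary_flux y S * avg v S else 0)"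
  proof (rule sum.cong)
    fix S assume S: "S \<in> sides \<T>"
    have "(\<Sum>T\<in>neighbours S. side_area S * flux T y S * side_avg S (elt_trace T v)) =
        (\<Sum>T\<in>neighbours S. (side_area S * avg v S) * flux T y S)"
      using v S unfolding crouzeix_raviart_iff by (intro sum.cong) auto
    also have "\<dots> = (side_area S * avg v S) * (\<Sum>T\<in>neighbours S. flux T y S)"
      by (simp add: sum_distrib_left)
    finally show "(\<Sum>T\<in>neighbours S. side_area S * flux T y S * side_avg S (elt_trace T v)) =
        (if S \<in> \<B> then side_area S * boundary_flux y S * avg v S else 0)"
      unfolding sum_flux[OF y S] by simp
  qed simp
  also have "\<dots> = (\<Sum>S\<in>\<B>. side_area S * boundary_flux y S * avg v S)"
    using boundary_sides_subset by (simp add: sum.inter_restrict[symmetric] Int_absorb1)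
  finally show ?thesis .
qed

end

section \<open>The density of the dual functional and its gradient\<close>

text \<open>
  For fixed threshold, this is the density of the dual functional; its derivative is the projection
  onto the ball.
\<close>

definition huber :: "real \<Rightarrow> 'a::real_inner \<Rightarrow> real" where
  "huber z s = (if norm s \<le> z then (norm s)\<^sup>2 / 2 else z * norm s - z\<^sup>2 / 2)"

definition ball_proj :: "real \<Rightarrow> 'a::real_inner \<Rightarrow> 'a" where
  "ball_proj z s = (if norm s \<le> z then s else (z / norm s) *\<^sub>R s)"

lemma norm_ball_proj: "0 \<le> z \<Longrightarrow> norm (ball_proj z s) \<le> z"
  by (simp add: ball_proj_def)

lemma ball_proj_variational:
  assumes z: "0 \<le> z" and w: "norm w \<le> z"
  shows "0 \<le> (ball_proj z s - w) \<bullet> (s - ball_proj z s)"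
proof (cases "norm s \<le> z")
  case True
  then show ?thesis by (simp add: ball_proj_def)
next
  case False
  then have s: "0 < norm s" "z < norm s"
    using z by auto
  have "w \<bullet> s \<le> norm w * norm s"
    by (rule norm_cauchy_schwarz)
  also have "\<dots> \<le> z * norm s"
    using w by (intro mult_right_mono) auto
  also have "z * norm s = ball_proj z s \<bullet> s"
    using s False by (simp add: ball_proj_def dot_square_norm power2_eq_square)
  finally have "0 \<le> (ball_proj z s - w) \<bullet> s"
    by (simp add: inner_diff_left)
  moreover have "s - ball_proj z s = (1 - z / norm s) *\<^sub>R s"
    using False by (simp add: ball_proj_def algebra_simps)
  moreover have "0 \<le> 1 - z / norm s"
    using s by simp
  ultimately show ?thesis
    by simp
qed

text \<open>
  The density is the conjugate of \<open>|w|\<^sup>2 / 2\<close> restricted to the ball, and the supremum is attained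
  at the projection.
\<close>

lemma huber_eq:
  assumes z: "0 \<le> z"
  shows "huber z s = ball_proj z s \<bullet> s - (norm (ball_proj z s))\<^sup>2 / 2"
proof (cases "norm s \<le> z")
  case True
  then show ?thesis
    by (simp add: huber_def ball_proj_def dot_square_norm)
next
  case False
  then have "0 < norm s"
    using z by auto
  then show ?thesis
    using False z by (simp add: huber_def ball_proj_def dot_square_norm power2_eq_square)
qed

lemma huber_ge:
  assumes z: "0 \<le> z" and w: "norm w \<le> z"
  shows "w \<bullet> s - (norm w)\<^sup>2 / 2 \<le> huber z s"
proof -
  let ?q = "ball_proj z s"
  have "huber z s - (w \<bullet> s - (norm w)\<^sup>2 / 2) = (?q - w) \<bullet> (s - ?q) + (norm (?q - w))\<^sup>2 / 2"
    unfolding huber_eq[OF z] by (simp add: power2_norm_eq_inner inner_diff_left inner_diff_right inner_commute field_simps)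
  then show ?thesis
    using ball_proj_variational[OF assms, of s] by (smt (verit) divide_nonneg_pos zero_le_power2)
qed

text \<open>
  The derivative is Lipschitz continuous with constant one.  This one-sided expansion replaces
  differentiation of the dual functional at its maximizer.
\<close>

lemma huber_upper_quadratic:
  assumes z: "0 \<le> z"
  shows "huber z (s + h) \<le> huber z s + ball_proj z s \<bullet> h + (norm h)\<^sup>2 / 2"
proof -
  let ?q = "ball_proj z s" and ?r = "ball_proj z (s + h)"
  have "huber z s + ?q \<bullet> h + (norm h)\<^sup>2 / 2 - huber z (s + h) =
      (norm (?q - ?r + h))\<^sup>2 / 2 + (?q - ?r) \<bullet> (s - ?q)"
    unfolding huber_eq[OF z]
    by (simp add: power2_norm_eq_inner inner_diff_left inner_diff_right inner_add_left inner_add_right inner_commute field_simps)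
  then show ?thesis
    using ball_proj_variational[OF z norm_ball_proj[OF z, of "s + h"], of s]
    by (smt (verit) divide_nonneg_pos zero_le_power2)
qed

lemma linear_le_quadratic_zero:
  fixes L C :: real
  assumes "\<And>t. t * L \<le> t\<^sup>2 * C"
  shows "L = 0"
proof (rule ccontr)
  assume L: "L \<noteq> 0"
  have C: "0 \<le> C"
    using assms[of 1] assms[of "-1"] by simp
  define t where "t = L / (C + 1)"
  have "t * L = (C + 1) * t\<^sup>2"
    using C by (simp add: t_def power2_eq_square)
  moreover have "0 < t\<^sup>2"
    using L C by (simp add: t_def)
  ultimately show False
    using assms[of t] by (simp add: algebra_simps)
qed

section \<open>Orthogonal projection onto a finite span\<close>

text \<open>
  Gram-Schmidt, by induction on the number of spanning vectors.  The weighted product is that of the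
  piecewise constant vector fields on the mesh, with the vectors represented as functions.
\<close>

lemma weighted_orthogonal_projection:
  fixes E :: "'s \<Rightarrow> 't \<Rightarrow> 'a::real_inner" and m :: "'t \<Rightarrow> real"
  assumes "finite I" and K: "finite K" and m: "\<And>T. T \<in> K \<Longrightarrow> 0 < m T"
  shows "\<exists>c. \<forall>j\<in>I. (\<Sum>T\<in>K. m T * ((r T - (\<Sum>i\<in>I. c i *\<^sub>R E i T)) \<bullet> E j T)) = 0"
  using assms(1)
proof (induction I arbitrary: r rule: finite_induct)
  case empty
  then show ?case by simp
next
  case (insert k I)
  obtain d where d: "\<And>j. j \<in> I \<Longrightarrow> (\<Sum>T\<in>K. m T * ((E k T - (\<Sum>i\<in>I. d i *\<^sub>R E i T)) \<bullet> E j T)) = 0"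
    using insert.IH[of "E k"] by blast
  obtain c where c: "\<And>j. j \<in> I \<Longrightarrow> (\<Sum>T\<in>K. m T * ((r T - (\<Sum>i\<in>I. c i *\<^sub>R E i T)) \<bullet> E j T)) = 0"
    using insert.IH[of r] by blast
  define e where "e T = E k T - (\<Sum>i\<in>I. d i *\<^sub>R E i T)" for T
  define s where "s T = r T - (\<Sum>i\<in>I. c i *\<^sub>R E i T)" for T
  let ?ip = "\<lambda>x y. \<Sum>T\<in>K. m T * (x T \<bullet> y T)"
  define \<alpha> where "\<alpha> = ?ip s e / ?ip e e"
  define b where "b i = (if i = k then \<alpha> else c i - \<alpha> * d i)" for i
  have res: "r T - (\<Sum>i\<in>insert k I. b i *\<^sub>R E i T) = s T - \<alpha> *\<^sub>R e T" for T
  proof -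
    have "(\<Sum>i\<in>I. b i *\<^sub>R E i T) = (\<Sum>i\<in>I. c i *\<^sub>R E i T - \<alpha> *\<^sub>R (d i *\<^sub>R E i T))"
      using insert.hyps by (intro sum.cong) (auto simp: b_def scaleR_diff_left)
    also have "\<dots> = (\<Sum>i\<in>I. c i *\<^sub>R E i T) - \<alpha> *\<^sub>R (\<Sum>i\<in>I. d i *\<^sub>R E i T)"
      by (simp add: sum_subtractf scaleR_sum_right)
    finally show ?thesis
      using insert.hyps by (simp add: b_def s_def e_def algebra_simps)
  qed
  have lin: "?ip (\<lambda>T. s T - \<alpha> *\<^sub>R e T) y = ?ip s y - \<alpha> * ?ip e y" for y
    by (simp add: inner_diff_left right_diff_distrib sum_subtractf sum_distrib_left mult.left_commute)
  have I0: "?ip (\<lambda>T. s T - \<alpha> *\<^sub>R e T) (E j) = 0" if "j \<in> I" for j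
    unfolding lin using c[OF that] d[OF that] by (simp add: s_def e_def)
  have e0: "?ip (\<lambda>T. s T - \<alpha> *\<^sub>R e T) e = 0"
  proof (cases "?ip e e = 0")
    case True
    have "\<forall>T\<in>K. m T * (e T \<bullet> e T) = 0"
      using sum_nonneg_eq_0_iff[OF K, of "\<lambda>T. m T * (e T \<bullet> e T)"] m True by (simp add: less_imp_le)
    then have "\<forall>T\<in>K. e T = 0"
      using m by fastforce
    then show ?thesis by simp
  next
    case False
    then show ?thesis
      unfolding lin by (simp add: \<alpha>_def)
  qed
  have "?ip (\<lambda>T. s T - \<alpha> *\<^sub>R e T) (E k) = ?ip (\<lambda>T. s T - \<alpha> *\<^sub>R e T) e +
      (\<Sum>i\<in>I. d i * ?ip (\<lambda>T. s T - \<alpha> *\<^sub>R e T) (E i))"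
  proof -
    have ip_k: "?ip x (E k) = ?ip x e + (\<Sum>i\<in>I. d i * ?ip x (E i))" for x
    proof -
      have "x T \<bullet> E k T = x T \<bullet> e T + (\<Sum>i\<in>I. d i * (x T \<bullet> E i T))" for T
        by (simp add: e_def inner_diff_right inner_sum_right)
      then have "?ip x (E k) = ?ip x e + (\<Sum>T\<in>K. \<Sum>i\<in>I. d i * (m T * (x T \<bullet> E i T)))"
        by (simp add: distrib_left sum.distrib sum_distrib_left mult.left_commute)
      also have "(\<Sum>T\<in>K. \<Sum>i\<in>I. d i * (m T * (x T \<bullet> E i T))) = (\<Sum>i\<in>I. d i * ?ip x (E i))"
        by (subst sum.swap) (simp add: sum_distrib_left)
      finally show ?thesis .
    qed
    show ?thesis
      by (rule ip_k)
  qed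
  then have k0: "?ip (\<lambda>T. s T - \<alpha> *\<^sub>R e T) (E k) = 0"
    using e0 I0 by simp
  show ?case
    by (rule exI[of _ b], unfold res) (use I0 k0 in auto)
qed

section \<open>The discrete functionals as finite sums\<close>

context mesh
begin

lemma sides_in_sides: "S \<in> sides_in \<Omega> \<T> \<Gamma> \<Longrightarrow> S \<in> sides \<T>"
  by (simp add: sides_in_def boundary_sides_def)

text \<open>
  The boundary sides outside of \<open>\<Gamma>\<close> contribute nothing, because their relative interiors miss \<open>\<Gamma>\<close>
  and their relative boundaries are null sets.
\<close>

lemma bd_integral_eq:
  assumes \<Gamma>: "\<And>S. S \<in> \<B> \<Longrightarrow> S \<in> sides_in \<Omega> \<T> \<Gamma> \<or> rel_interior S \<inter> \<Gamma> = {}"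
    and w: "\<And>S x. S \<in> sides_in \<Omega> \<T> \<Gamma> \<Longrightarrow> x \<in> rel_interior S \<Longrightarrow> w x = k S"
  shows "bd_integral \<Omega> \<T> \<Gamma> w = (\<Sum>S\<in>sides_in \<Omega> \<T> \<Gamma>. side_area S * k S)"
proof -
  have "(LINT x:\<Gamma>|side_measure S. w x) = (if S \<in> sides_in \<Omega> \<T> \<Gamma> then side_area S * k S else 0)"
    if S: "S \<in> \<B>" for S
  proof -
    have "S \<in> sides \<T>"
      using S boundary_sides_subset by blast
    note adj = neighboursD[OF adjacent_neighbour[OF this]]
    have "(LINT x:\<Gamma>|side_measure S. w x) = side_area S * (if S \<in> sides_in \<Omega> \<T> \<Gamma> then k S else 0)"
      unfolding set_lebesgue_integral_def
    proof (rule full_simplex.facet_measure(3)[OF element[OF adj(1)] adj(2)])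
      fix x assume x: "x \<in> rel_interior S"
      show "indicator \<Gamma> x *\<^sub>R w x = (if S \<in> sides_in \<Omega> \<T> \<Gamma> then k S else 0)"
      proof (cases "S \<in> sides_in \<Omega> \<T> \<Gamma>")
        case True
        then have "x \<in> \<Gamma>"
          using x by (auto simp: sides_in_def)
        then show ?thesis
          using True w x by simp
      next
        case False
        then have "x \<notin> \<Gamma>"
          using \<Gamma>[OF S] x by blast
        then show ?thesis
          using False by simp
      qed
    qed
    then show ?thesis by simp
  qed
  then have "bd_integral \<Omega> \<T> \<Gamma> w = (\<Sum>S\<in>\<B>. if S \<in> sides_in \<Omega> \<T> \<Gamma> then side_area S * k S else 0)"
    unfolding bd_integral_def by (intro sum.cong) auto
  also have "\<dots> = (\<Sum>S\<in>sides_in \<Omega> \<T> \<Gamma>. side_area S * k S)"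
    using sides_in_subset finite_subset[OF boundary_sides_subset finite_sides]
    by (simp add: sum.inter_restrict[symmetric] Int_absorb1)
  finally show ?thesis .
qed

lemma bd_AE_D:
  assumes "bd_AE \<Omega> \<T> \<Gamma> Q" "S \<in> sides_in \<Omega> \<T> \<Gamma>"
  obtains x where "x \<in> rel_interior S" "Q x"
proof -
  have S: "S \<in> \<B>" "rel_interior S \<subseteq> \<Gamma>"
    using assms(2) by (auto simp: sides_in_def)
  have "S \<in> sides \<T>"
    using S boundary_sides_subset by blast
  note adj = neighboursD[OF adjacent_neighbour[OF this]]
  note meas = full_simplex.facet_measure[OF element[OF adj(1)] adj(2)]
  have ae: "AE x in side_measure S. x \<in> \<Gamma> \<longrightarrow> Q x"
    using assms(1) S(1) unfolding bd_AE_def by blast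
  have "\<exists>x. x \<in> rel_interior S \<and> Q x"
  proof (rule ccontr)
    assume no: "\<nexists>x. x \<in> rel_interior S \<and> Q x"
    from ae meas(2) have "AE x in side_measure S. False"
      by eventually_elim (use no S(2) in blast)
    then have "emeasure (side_measure S) (space (side_measure S)) = 0"
      using emeasure_eq_0_AE[of "\<lambda>_. True" "side_measure S"] by simp
    then have "side_area S = 0"
      by (simp add: side_area_def measure_def)
    then show False
      using meas(1) by simp
  qed
  then show ?thesis
    using that by blast
qed

lemma bd_AE_I:
  assumes \<Gamma>: "\<And>S. S \<in> \<B> \<Longrightarrow> S \<in> sides_in \<Omega> \<T> \<Gamma> \<or> rel_interior S \<inter> \<Gamma> = {}"
    and Q: "\<And>S x. S \<in> sides_in \<Omega> \<T> \<Gamma> \<Longrightarrow> x \<in> rel_interior S \<Longrightarrow> Q x"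
  shows "bd_AE \<Omega> \<T> \<Gamma> Q"
  unfolding bd_AE_def
proof
  fix S assume S: "S \<in> \<B>"
  have "S \<in> sides \<T>"
    using S boundary_sides_subset by blast
  note adj = neighboursD[OF adjacent_neighbour[OF this]]
  have "AE x in side_measure S. x \<in> rel_interior S"
    by (rule full_simplex.facet_measure(2)[OF element[OF adj(1)] adj(2)])
  then show "AE x in side_measure S. x \<in> \<Gamma> \<longrightarrow> Q x"
    by eventually_elim (use \<Gamma>[OF S] Q in blast)
qed

lemma sum_indicator_interior:
  fixes h :: "'a set \<Rightarrow> 'b::real_vector"
  assumes T: "T \<in> \<T>" "x \<in> interior T"
  shows "(\<Sum>T\<in>\<T>. indicator (interior T) x *\<^sub>R h T) = h T"
proof -
  have "x \<notin> interior T'" if "T' \<in> \<T> - {T}" for T'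
    using that interiors_disjoint[OF _ T(1) _ T(2)] by blast
  then show ?thesis
    using T by (subst sum.remove[OF finite_mesh T(1)]) simp
qed

lemma elt_proj_eq:
  assumes T: "T \<in> \<T>" "x \<in> interior T"
  shows "elt_proj \<T> v x = mean T v"
  unfolding elt_proj_def mean_def by (rule sum_indicator_interior[OF T])

lemma volume_pos: "T \<in> \<T> \<Longrightarrow> 0 < volume T"
  by (rule full_simplex.volume_pos[OF element])

lemma piece_element:
  assumes "elt_const \<T> w" "T \<in> \<T>" "x \<in> interior T"
  shows "w x = piece w T"
  using assms full_simplex.rel_interior_eq[OF element[OF assms(2)]]
  by (intro piece_eq) (auto simp: elt_const_def)

lemma piece_side:
  assumes "side_const \<S> w" "S \<in> \<S>" "x \<in> rel_interior S"
  shows "w x = piece w S"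
  using assms by (intro piece_eq) (auto simp: side_const_def)

end

locale discrete_problem = mesh +
  fixes \<Gamma>D \<Gamma>N :: "'a set" and f g \<zeta> uD :: "'a \<Rightarrow> real"
  assumes partition: "bd_partition \<Omega> \<T> \<Gamma>D \<Gamma>N"
    and f: "elt_const \<T> f" and \<zeta>: "elt_const \<T> \<zeta>"
    and g: "side_const (sides_in \<Omega> \<T> \<Gamma>N) g" and uD: "side_const (sides_in \<Omega> \<T> \<Gamma>D) uD"
begin

abbreviation "Kcr \<equiv> K_cr \<Omega> \<T> \<Gamma>D \<zeta> uD"
abbreviation "Krt \<equiv> K_rt \<Omega> \<T> \<Gamma>N f g"
abbreviation "\<S>D \<equiv> sides_in \<Omega> \<T> \<Gamma>D"
abbreviation "\<S>N \<equiv> sides_in \<Omega> \<T> \<Gamma>N"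

lemma D_or_N:
  assumes "S \<in> \<B>"
  shows "S \<in> \<S>D \<longleftrightarrow> S \<notin> \<S>N"
  using partition assms unfolding bd_partition_def by blast

lemma D_alternative: "S \<in> \<B> \<Longrightarrow> S \<in> \<S>D \<or> rel_interior S \<inter> \<Gamma>D = {}"
  and N_alternative: "S \<in> \<B> \<Longrightarrow> S \<in> \<S>N \<or> rel_interior S \<inter> \<Gamma>N = {}"
proof -
  assume S: "S \<in> \<B>"
  have disj: "\<Gamma>D \<inter> \<Gamma>N = {}"
    using partition unfolding bd_partition_def by blast
  have "rel_interior S \<subseteq> \<Gamma>D" if "S \<in> \<S>D"
    using that by (simp add: sides_in_def)
  moreover have "rel_interior S \<subseteq> \<Gamma>N" if "S \<in> \<S>N"
    using that by (simp add: sides_in_def)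
  ultimately show "S \<in> \<S>D \<or> rel_interior S \<inter> \<Gamma>D = {}" "S \<in> \<S>N \<or> rel_interior S \<inter> \<Gamma>N = {}"
    using D_or_N[OF S] disj by blast+
qed

lemma sum_boundary: "(\<Sum>S\<in>\<B>. h S) = (\<Sum>S\<in>\<S>D. h S) + (\<Sum>S\<in>\<S>N. h S)"
proof -
  have fin: "finite (\<B>)"
    by (rule finite_subset[OF boundary_sides_subset finite_sides])
  have "\<B> = \<S>D \<union> \<S>N"
    using D_or_N sides_in_subset by blast
  moreover have "\<S>D \<inter> \<S>N = {}"
    using D_or_N sides_in_subset by blast
  moreover have "finite \<S>D" "finite \<S>N"
    using finite_subset[OF sides_in_subset fin] by blast+
  ultimately show ?thesis
    by (simp add: sum.union_disjoint)
qed

text \<open>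
  The two functionals on their effective domains, in terms of the finitely many numbers that determine
  them.
\<close>

definition primal :: "('a \<Rightarrow> real) \<Rightarrow> real" where
  "primal v = 1 / 2 * (\<Sum>T\<in>\<T>. volume T * (norm (elt_grad T v))\<^sup>2) - (\<Sum>T\<in>\<T>. volume T * (piece f T * mean T v))
     - (\<Sum>S\<in>\<S>N. side_area S * (piece g S * avg v S))"

definition dual :: "('a \<Rightarrow> 'a) \<Rightarrow> real" where
  "dual y = - (\<Sum>T\<in>\<T>. volume T * huber (piece \<zeta> T) (mean T y)) + (\<Sum>S\<in>\<S>D. side_area S * (boundary_flux y S * piece uD S))"

lemma grad_h_eq: "v \<in> CR \<Longrightarrow> T \<in> \<T> \<Longrightarrow> x \<in> interior T \<Longrightarrow> grad_h v x = elt_grad T v"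
  using full_simplex.grad_h_affine[OF element affine_on_element] by (simp add: crouzeix_raviart_def)

lemma div_h_eq: "y \<in> RT \<Longrightarrow> T \<in> \<T> \<Longrightarrow> x \<in> interior T \<Longrightarrow> div_h y x = elt_div T y"
  using full_simplex.div_h_affine[OF element affine_on_element] by (simp add: raviart_thomas_def)

lemma K_cr_iff:
  "v \<in> Kcr \<longleftrightarrow> v \<in> CR \<and>
    (\<forall>T\<in>\<T>. norm (elt_grad T v) \<le> piece \<zeta> T) \<and> (\<forall>S\<in>\<S>D. avg v S = piece uD S)" (is "_ \<longleftrightarrow> ?R")
proof
  assume v: "v \<in> Kcr"
  then have cr: "v \<in> CR" and ae: "AE x in lebesgue_on \<Omega>. norm (grad_h v x) \<le> \<zeta> x"
    and bd: "bd_AE \<Omega> \<T> \<Gamma>D (\<lambda>x. side_proj \<T> v x = uD x)"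
    unfolding K_cr_def by blast+
  have "norm (elt_grad T v) \<le> piece \<zeta> T" if T: "T \<in> \<T>" for T
  proof -
    obtain x where "x \<in> interior T" "norm (grad_h v x) \<le> \<zeta> x"
      by (rule AE_domainD[OF ae T])
    then show ?thesis
      using grad_h_eq[OF cr T] piece_element[OF \<zeta> T] by simp
  qed
  moreover have "avg v S = piece uD S" if S: "S \<in> \<S>D" for S
  proof -
    obtain x where x: "x \<in> rel_interior S" "side_proj \<T> v x = uD x"
      by (rule bd_AE_D[OF bd S])
    then show ?thesis
      using side_proj_eq[of S x v] piece_side[OF uD S x(1)] sides_in_sides[OF S] by simp
  qed
  ultimately show ?R
    using cr by blast
next
  assume R: ?R
  then have cr: "v \<in> CR" by blast
  have "AE x in lebesgue_on \<Omega>. norm (grad_h v x) \<le> \<zeta> x"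
    by (rule AE_domainI) (use R grad_h_eq[OF cr] piece_element[OF \<zeta>] in auto)
  moreover have "bd_AE \<Omega> \<T> \<Gamma>D (\<lambda>x. side_proj \<T> v x = uD x)"
  proof (rule bd_AE_I[OF D_alternative])
    fix S x assume S: "S \<in> \<S>D" "x \<in> rel_interior S"
    then show "side_proj \<T> v x = uD x"
      using R side_proj_eq[of S x v] piece_side[OF uD S] sides_in_sides[OF S(1)] by simp
  qed
  ultimately show "v \<in> Kcr"
    unfolding K_cr_def using cr by blast
qed

lemma K_rt_iff:
  "y \<in> Krt \<longleftrightarrow> y \<in> RT \<and>
    (\<forall>T\<in>\<T>. elt_div T y = - piece f T) \<and> (\<forall>S\<in>\<S>N. boundary_flux y S = piece g S)" (is "_ \<longleftrightarrow> ?R")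
proof
  assume y: "y \<in> Krt"
  then have rt: "y \<in> RT" and ae: "AE x in lebesgue_on \<Omega>. div_h y x = - f x"
    and bd: "bd_AE \<Omega> \<T> \<Gamma>N (\<lambda>x. normal_trace \<T> y x = g x)"
    unfolding K_rt_def by blast+
  have "elt_div T y = - piece f T" if T: "T \<in> \<T>" for T
  proof -
    obtain x where "x \<in> interior T" "div_h y x = - f x"
      by (rule AE_domainD[OF ae T])
    then show ?thesis
      using div_h_eq[OF rt T] piece_element[OF f T] by simp
  qed
  moreover have "boundary_flux y S = piece g S" if S: "S \<in> \<S>N" for S
  proof -
    obtain x where x: "x \<in> rel_interior S" "normal_trace \<T> y x = g x"
      by (rule bd_AE_D[OF bd S])
    then show ?thesis
      using normal_trace_eq[OF rt, of S x] piece_side[OF g S x(1)] sides_in_sides[OF S] by simp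
  qed
  ultimately show ?R
    using rt by blast
next
  assume R: ?R
  then have rt: "y \<in> RT" by blast
  have "AE x in lebesgue_on \<Omega>. div_h y x = - f x"
    by (rule AE_domainI) (use R div_h_eq[OF rt] piece_element[OF f] in auto)
  moreover have "bd_AE \<Omega> \<T> \<Gamma>N (\<lambda>x. normal_trace \<T> y x = g x)"
  proof (rule bd_AE_I[OF N_alternative])
    fix S x assume S: "S \<in> \<S>N" "x \<in> rel_interior S"
    then show "normal_trace \<T> y x = g x"
      using R normal_trace_eq[OF rt, of S x] piece_side[OF g S] sides_in_sides[OF S(1)] by simp
  qed
  ultimately show "y \<in> Krt"
    unfolding K_rt_def using rt by blast
qed

lemma I_cr_eq:
  assumes v: "v \<in> Kcr"
  shows "I_cr \<Omega> \<T> \<Gamma>D \<Gamma>N f g \<zeta> uD v = ereal (primal v)"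
proof -
  have cr: "v \<in> CR"
    using v K_cr_iff by blast
  have "(\<integral>x. (norm (grad_h v x))\<^sup>2 \<partial>lebesgue_on \<Omega>) = (\<Sum>T\<in>\<T>. volume T * (norm (elt_grad T v))\<^sup>2)"
    by (rule integral_domain) (simp add: grad_h_eq[OF cr])
  moreover have "(\<integral>x. f x * elt_proj \<T> v x \<partial>lebesgue_on \<Omega>) = (\<Sum>T\<in>\<T>. volume T * (piece f T * mean T v))"
    by (rule integral_domain) (simp add: elt_proj_eq piece_element[OF f])
  moreover have "bd_integral \<Omega> \<T> \<Gamma>N (\<lambda>x. g x * side_proj \<T> v x) = (\<Sum>S\<in>\<S>N. side_area S * (piece g S * avg v S))"
  proof (rule bd_integral_eq[OF N_alternative])
    fix S x assume S: "S \<in> \<S>N" "x \<in> rel_interior S"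
    then show "g x * side_proj \<T> v x = piece g S * avg v S"
      using side_proj_eq[of S x v] piece_side[OF g S] sides_in_sides[OF S(1)] by simp
  qed
  ultimately show ?thesis
    using v by (simp add: I_cr_def primal_def)
qed

lemma D_rt_eq:
  assumes y: "y \<in> Krt"
  shows "D_rt \<Omega> \<T> \<Gamma>D \<Gamma>N f g \<zeta> uD y = ereal (dual y)"
proof -
  have rt: "y \<in> RT"
    using y K_rt_iff by blast
  have "(\<integral>x. phi_star \<zeta> x (elt_proj \<T> y x) \<partial>lebesgue_on \<Omega>) = (\<Sum>T\<in>\<T>. volume T * huber (piece \<zeta> T) (mean T y))"
    by (rule integral_domain) (simp add: elt_proj_eq piece_element[OF \<zeta>] phi_star_def huber_def)
  moreover have "bd_integral \<Omega> \<T> \<Gamma>D (\<lambda>x. normal_trace \<T> y x * uD x) = (\<Sum>S\<in>\<S>D. side_area S * (boundary_flux y S * piece uD S))"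
  proof (rule bd_integral_eq[OF D_alternative])
    fix S x assume S: "S \<in> \<S>D" "x \<in> rel_interior S"
    then show "normal_trace \<T> y x * uD x = boundary_flux y S * piece uD S"
      using normal_trace_eq[OF rt, of S x] piece_side[OF uD S] sides_in_sides[OF S(1)] by simp
  qed
  ultimately show ?thesis
    using y by (simp add: D_rt_def dual_def)
qed

text \<open>
  The data terms cancel by integration by parts, which leaves the Fenchel-Young defects.
\<close>

lemma duality_gap:
  assumes v: "v \<in> Kcr" and y: "y \<in> Krt"
  shows "primal v - dual y =
    (\<Sum>T\<in>\<T>. volume T * ((norm (elt_grad T v))\<^sup>2 / 2 + huber (piece \<zeta> T) (mean T y) - elt_grad T v \<bullet> mean T y))"
proof -
  have V: "v \<in> CR" "\<And>S. S \<in> \<S>D \<Longrightarrow> avg v S = piece uD S"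
    using v unfolding K_cr_iff by blast+
  have Y: "y \<in> RT" "\<And>T. T \<in> \<T> \<Longrightarrow> elt_div T y = - piece f T" "\<And>S. S \<in> \<S>N \<Longrightarrow> boundary_flux y S = piece g S"
    using y unfolding K_rt_iff by blast+
  have "(\<Sum>T\<in>\<T>. volume T * (elt_grad T v \<bullet> mean T y - piece f T * mean T v)) =
      (\<Sum>T\<in>\<T>. volume T * (elt_grad T v \<bullet> mean T y + mean T v * elt_div T y))"
    by (rule sum.cong) (simp_all add: Y(2))
  also have "\<dots> = (\<Sum>S\<in>\<S>D. side_area S * boundary_flux y S * avg v S) + (\<Sum>S\<in>\<S>N. side_area S * boundary_flux y S * avg v S)"
    unfolding discrete_integration_by_parts[OF V(1) Y(1)] sum_boundary ..
  also have "(\<Sum>S\<in>\<S>D. side_area S * boundary_flux y S * avg v S) = (\<Sum>S\<in>\<S>D. side_area S * (boundary_flux y S * piece uD S))"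
    by (rule sum.cong) (simp_all add: V(2))
  also have "(\<Sum>S\<in>\<S>N. side_area S * boundary_flux y S * avg v S) = (\<Sum>S\<in>\<S>N. side_area S * (piece g S * avg v S))"
    by (rule sum.cong) (simp_all add: Y(3))
  finally have ibp: "(\<Sum>T\<in>\<T>. volume T * (elt_grad T v \<bullet> mean T y)) - (\<Sum>T\<in>\<T>. volume T * (piece f T * mean T v)) =
      (\<Sum>S\<in>\<S>D. side_area S * (boundary_flux y S * piece uD S)) + (\<Sum>S\<in>\<S>N. side_area S * (piece g S * avg v S))"
    by (simp add: right_diff_distrib sum_subtractf)
  have "(\<Sum>T\<in>\<T>. volume T * ((norm (elt_grad T v))\<^sup>2 / 2 + huber (piece \<zeta> T) (mean T y) - elt_grad T v \<bullet> mean T y)) =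
      1 / 2 * (\<Sum>T\<in>\<T>. volume T * (norm (elt_grad T v))\<^sup>2) + (\<Sum>T\<in>\<T>. volume T * huber (piece \<zeta> T) (mean T y))
      - (\<Sum>T\<in>\<T>. volume T * (elt_grad T v \<bullet> mean T y))"
    by (simp add: distrib_left right_diff_distrib sum.distrib sum_subtractf sum_divide_distrib)
  with ibp show ?thesis
    by (simp add: primal_def dual_def)
qed

lemma weak_duality:
  assumes v: "v \<in> Kcr" and y: "y \<in> Krt"
  shows "dual y \<le> primal v"
proof -
  have "0 \<le> volume T * ((norm (elt_grad T v))\<^sup>2 / 2 + huber (piece \<zeta> T) (mean T y) - elt_grad T v \<bullet> mean T y)"
    if T: "T \<in> \<T>" for T
  proof -
    have n: "norm (elt_grad T v) \<le> piece \<zeta> T"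
      using v T unfolding K_cr_iff by blast
    then have "0 \<le> piece \<zeta> T"
      using norm_ge_zero order_trans by blast
    from huber_ge[OF this n, of "mean T y"] show ?thesis
      using volume_pos[OF T] by (intro mult_nonneg_nonneg) auto
  qed
  then have "0 \<le> primal v - dual y"
    unfolding duality_gap[OF v y] by (rule sum_nonneg)
  then show ?thesis by simp
qed

end

section \<open>Strong duality\<close>

context mesh
begin

text \<open>
  The gradient on \<open>T\<close> of the Crouzeix-Raviart basis function of the side \<open>S\<close>.
\<close>

definition side_grad :: "'a set \<Rightarrow> 'a set \<Rightarrow> 'a" where
  "side_grad S T = (if S facet_of T then (side_area S / volume T) *\<^sub>R outer_normal T S else 0)"

text \<open>
  The Crouzeix-Raviart function with prescribed averages on the sides: \<open>1 - d \<lambda>\<close> has average one on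
  the side opposite to the vertex of \<open>\<lambda>\<close> and average zero on the other sides of the element.
\<close>

definition cr_interpolant :: "('a set \<Rightarrow> real) \<Rightarrow> 'a \<Rightarrow> real" where
  "cr_interpolant c x =
     (\<Sum>T\<in>\<T>. indicator (interior T) x * (\<Sum>a\<in>verts T. c (opp_face T a) * (1 - DIM('a) * bary T a x)))"

definition const_field :: "('a set \<Rightarrow> 'a) \<Rightarrow> 'a \<Rightarrow> 'a" where
  "const_field p x = (\<Sum>T\<in>\<T>. indicator (interior T) x *\<^sub>R p T)"

lemma cr_interpolant_eq:
  assumes T: "T \<in> \<T>" "x \<in> interior T"
  shows "cr_interpolant c x = (\<Sum>a\<in>verts T. c (opp_face T a) * (1 - DIM('a) * bary T a x))"
  unfolding cr_interpolant_def using sum_indicator_interior[OF T, where 'b = real] by simp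

lemma const_field_eq:
  assumes T: "T \<in> \<T>" "x \<in> interior T"
  shows "const_field p x = p T"
  unfolding const_field_def by (rule sum_indicator_interior[OF T])

lemma add_cr_interpolant_element:
  fixes c :: "'a set \<Rightarrow> real"
  assumes v: "elt_affine \<T> v" and T: "T \<in> \<T>"
  defines "w \<equiv> \<lambda>x. v x + cr_interpolant c x"
  shows "full_simplex.affine_on T w"
    and "elt_grad T w = elt_grad T v + (\<Sum>S\<in>sides \<T>. c S *\<^sub>R side_grad S T)"
    and "S facet_of T \<Longrightarrow> side_avg S (elt_trace T w) = side_avg S (elt_trace T v) + c S"
proof -
  interpret full_simplex T by (rule element[OF T])
  let ?d = "real DIM('a)"
  define C where "C = (\<Sum>a\<in>V. c (opp_face T a))"
  define L where "L x = (\<Sum>a\<in>V. c (opp_face T a) * (1 - ?d * bary T a x))" for x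
  define G where "G = (\<Sum>a\<in>V. (- ?d * c (opp_face T a)) *\<^sub>R bary_grad T a)"
  have L_eq: "L x = G \<bullet> x + L 0" for x
  proof -
    have "L x = (\<Sum>a\<in>V. (- ?d * c (opp_face T a)) * (bary_grad T a \<bullet> x) + c (opp_face T a) * (1 - ?d * bary T a 0))"
      unfolding L_def by (rule sum.cong) (simp_all add: bary_def inner_diff_right algebra_simps)
    then show ?thesis
      by (simp only: sum.distrib G_def inner_sum_left inner_scaleR_left L_def)
  qed
  have aff: "affine_on v"
    by (rule affine_on_element[OF v T])
  have lin: "linear (\<lambda>x. G \<bullet> x)"
    by (rule bounded_linear.linear[OF bounded_linear_inner_right])
  have w_eq: "w x = v x + (G \<bullet> x + L 0)" if "x \<in> interior T" for x
    unfolding w_def cr_interpolant_eq[OF T that] L_def[symmetric] using L_eq[of x] by simp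
  show affw: "affine_on w"
    by (rule elt_trace_add(1)[OF aff lin w_eq])
  have trace: "elt_trace T w x = elt_trace T v x + L x" if "x \<in> T" for x
    using elt_trace_add(2)[OF aff lin w_eq that] L_eq[of x] by simp
  have L_vertex: "L b = C - ?d * c (opp_face T b)" if b: "b \<in> V" for b
  proof -
    have "L b = (\<Sum>a\<in>V. c (opp_face T a) - (if a = b then ?d * c (opp_face T a) else 0))"
      unfolding L_def using b by (intro sum.cong) (auto simp: bary_vertex algebra_simps)
    then show ?thesis
      using b by (simp add: sum_subtractf C_def)
  qed
  have trace_vertex: "elt_trace T w b = elt_trace T v b + (C - ?d * c (opp_face T b))" if "b \<in> V" for b
    using trace L_vertex[OF that] verts_subset that by auto
  have side_grad_opp: "side_grad (opp_face T a) T = - ?d *\<^sub>R bary_grad T a" if a: "a \<in> V" for a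
  proof -
    have "opp_face T a facet_of T"
      unfolding facet_iff using a by blast
    then show ?thesis
      using volume_pos bary_grad_nonzero[OF a]
      by (simp add: side_grad_def side_area_opp[OF a] outer_normal_opp[OF a])
  qed
  have "(\<Sum>S\<in>sides \<T>. c S *\<^sub>R side_grad S T) = (\<Sum>S | S facet_of T. c S *\<^sub>R side_grad S T)"
    by (rule sum.mono_neutral_right[OF finite_sides]) (use T in \<open>auto simp: sides_def side_grad_def\<close>)
  also have "\<dots> = (\<Sum>a\<in>V. c (opp_face T a) *\<^sub>R side_grad (opp_face T a) T)"
    by (rule sum_facets)
  also have "\<dots> = G"
    unfolding G_def by (rule sum.cong) (simp_all add: side_grad_opp)
  finally have grad: "(\<Sum>S\<in>sides \<T>. c S *\<^sub>R side_grad S T) = G" .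
  have "elt_grad T w = (\<Sum>b\<in>V. elt_trace T v b *\<^sub>R bary_grad T b + (C *\<^sub>R bary_grad T b + (- ?d * c (opp_face T b)) *\<^sub>R bary_grad T b))"
    unfolding elt_grad_def by (rule sum.cong) (simp_all add: trace_vertex scaleR_add_left scaleR_diff_left)
  also have "\<dots> = elt_grad T v + (C *\<^sub>R (\<Sum>b\<in>V. bary_grad T b) + G)"
    by (simp only: sum.distrib elt_grad_def G_def scaleR_sum_right)
  finally show "elt_grad T w = elt_grad T v + (\<Sum>S\<in>sides \<T>. c S *\<^sub>R side_grad S T)"
    by (simp add: grad sum_bary_grad)
  assume "S facet_of T"
  then obtain a where a: "a \<in> V" "S = opp_face T a"
    unfolding facet_iff by blast
  have cv: "real (card (V - {a})) = ?d"
    by (simp add: card_verts_minus[OF a(1)])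
  have "(\<Sum>b\<in>V - {a}. elt_trace T w b) = (\<Sum>b\<in>V - {a}. elt_trace T v b + (C - ?d * c (opp_face T b)))"
    by (rule sum.cong) (simp_all add: trace_vertex)
  also have "\<dots> = (\<Sum>b\<in>V - {a}. elt_trace T v b) + (?d * C - ?d * (\<Sum>b\<in>V - {a}. c (opp_face T b)))"
    using cv by (simp add: sum.distrib sum_subtractf sum_distrib_left)
  also have "(\<Sum>b\<in>V - {a}. c (opp_face T b)) = C - c S"
    unfolding C_def a(2) using sum.remove[OF finite_verts a(1), of "\<lambda>b. c (opp_face T b)"] by simp
  finally have "(\<Sum>b\<in>V - {a}. elt_trace T w b) = (\<Sum>b\<in>V - {a}. elt_trace T v b) + ?d * c S"
    by (simp add: algebra_simps)
  then show "side_avg S (elt_trace T w) = side_avg S (elt_trace T v) + c S"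
    unfolding a(2) side_avg_trace[OF affw a(1) refl] side_avg_trace[OF aff a(1) refl]
    by (simp add: add_divide_distrib)
qed

lemma add_cr_interpolant:
  fixes c :: "'a set \<Rightarrow> real"
  assumes v: "v \<in> CR"
  defines "w \<equiv> \<lambda>x. v x + cr_interpolant c x"
  shows "w \<in> CR"
    and "T \<in> \<T> \<Longrightarrow> elt_grad T w = elt_grad T v + (\<Sum>S\<in>sides \<T>. c S *\<^sub>R side_grad S T)"
    and "S \<in> sides \<T> \<Longrightarrow> avg w S = avg v S + c S"
proof -
  have v': "elt_affine \<T> v" "\<And>S T. S \<in> sides \<T> \<Longrightarrow> T \<in> neighbours S \<Longrightarrow> side_avg S (elt_trace T v) = avg v S"
    using v unfolding crouzeix_raviart_iff by blast+
  note elem = add_cr_interpolant_element[OF v'(1), where c = c, folded w_def]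
  have side: "side_avg S (elt_trace T w) = avg v S + c S" if "S \<in> sides \<T>" "T \<in> neighbours S" for S T
    using elem(3)[OF neighboursD[OF that(2)]] v'(2)[OF that] by simp
  show avg: "avg w S = avg v S + c S" if "S \<in> sides \<T>" for S
    using side[OF that adjacent_neighbour[OF that]] by (simp add: avg_def)
  show "elt_grad T w = elt_grad T v + (\<Sum>S\<in>sides \<T>. c S *\<^sub>R side_grad S T)" if "T \<in> \<T>" for T
    by (rule elem(2)[OF that])
  have "elt_affine \<T> w"
    by (rule elt_affineI) (rule elem(1))
  then show "w \<in> CR"
    unfolding crouzeix_raviart_iff using side avg by simp
qed

lemma interior_side_not_boundary:
  assumes "S \<in> interior_sides \<Omega> \<T>"
  shows "S \<in> sides \<T>" "S \<notin> \<B>"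
proof -
  show S: "S \<in> sides \<T>"
    using assms by (simp add: interior_sides_def)
  obtain x where x: "x \<in> rel_interior S"
    using side_nonempty[OF S] by blast
  then have "x \<in> \<Omega>" "x \<in> S"
    using assms rel_interior_subset by (auto simp: interior_sides_def)
  then show "S \<notin> \<B>"
    using open_domain by (auto simp: boundary_sides_def frontier_def interior_open)
qed

text \<open>
  The jump of the normal component on an interior side, the normal component on a boundary side.
\<close>

definition normal_balance :: "('a set \<Rightarrow> 'a) \<Rightarrow> 'a set \<Rightarrow> real" where
  "normal_balance p S = (\<Sum>T\<in>neighbours S. p T \<bullet> outer_normal T S)"

text \<open>
  Element-wise constant fields without normal jumps are divergence-free directions in the
  Raviart-Thomas space.
\<close>

lemma add_const_field:
  fixes p :: "'a set \<Rightarrow> 'a" and t :: real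
  assumes y: "y \<in> RT"
    and p: "\<forall>S\<in>sides \<T> - \<B>. normal_balance p S = 0"
  defines "w \<equiv> \<lambda>x. y x + t *\<^sub>R const_field p x"
  shows "w \<in> RT"
    and "T \<in> \<T> \<Longrightarrow> mean T w = mean T y + t *\<^sub>R p T"
    and "T \<in> \<T> \<Longrightarrow> elt_div T w = elt_div T y"
    and "S \<in> \<B> \<Longrightarrow> boundary_flux w S = boundary_flux y S + t * normal_balance p S"
proof -
  have aff: "elt_affine \<T> y"
    using y by (simp add: raviart_thomas_def)
  have lin0: "linear (\<lambda>x::'a. 0::'a)"
    by (rule linear_zero)
  have w_eq: "w x = y x + (0 + t *\<^sub>R p T)" if "T \<in> \<T>" "x \<in> interior T" for T x
    by (simp add: w_def const_field_eq[OF that])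
  have affw: "full_simplex.affine_on T w" if "T \<in> \<T>" for T
    by (rule full_simplex.elt_trace_add(1)[OF element[OF that] affine_on_element[OF aff that] lin0 w_eq[OF that]])
  have trace: "elt_trace T w x = elt_trace T y x + t *\<^sub>R p T" if "T \<in> \<T>" "x \<in> T" for T x
    using full_simplex.elt_trace_add(2)[OF element[OF that(1)] affine_on_element[OF aff that(1)] lin0 w_eq[OF that(1)] that(2)]
    by simp
  have sub: "x \<in> T" if "S facet_of T" "x \<in> S" for S T x
    using facet_of_imp_subset[OF that(1)] that(2) by blast
  have normal: "elt_trace T w x \<bullet> outer_normal T S = flux T y S + t * (p T \<bullet> outer_normal T S)"
    if "T \<in> \<T>" "S facet_of T" "x \<in> S" for T S x
    using trace[OF that(1) sub[OF that(2,3)]] flux_eq[OF y that] by (simp add: inner_add_left)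
  have jump: "elt_trace T w x \<bullet> outer_normal T S + elt_trace T' w x \<bullet> outer_normal T' S = 0"
    if S: "S \<in> interior_sides \<Omega> \<T>" and T: "T \<in> \<T>" "S facet_of T" and T': "T' \<in> \<T>" "S facet_of T'"
      and "T \<noteq> T'" "x \<in> S" for S T T' x
  proof -
    note S' = interior_side_not_boundary[OF S]
    have "T \<in> neighbours S" "T' \<in> neighbours S"
      using T T' by (simp_all add: neighbours_def)
    then have "neighbours S = {T, T'}"
      by (rule two_neighbours(1)) fact
    moreover have "normal_balance p S = 0"
      using p S' by blast
    ultimately have "p T \<bullet> outer_normal T S + p T' \<bullet> outer_normal T' S = 0" "flux T y S + flux T' y S = 0"
      using sum_flux[OF y S'(1)] S'(2) \<open>T \<noteq> T'\<close> by (simp_all add: normal_balance_def)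
    moreover have "flux T y S + t * (p T \<bullet> outer_normal T S) + (flux T' y S + t * (p T' \<bullet> outer_normal T' S)) =
        (flux T y S + flux T' y S) + t * (p T \<bullet> outer_normal T S + p T' \<bullet> outer_normal T' S)"
      by (simp add: algebra_simps)
    ultimately show ?thesis
      unfolding normal[OF T \<open>x \<in> S\<close>] normal[OF T' \<open>x \<in> S\<close>] by simp
  qed
  have "elt_affine \<T> w"
    by (rule elt_affineI) (rule affw)
  moreover have "\<exists>c. \<forall>x\<in>S. elt_trace T w x \<bullet> outer_normal T S = c" if "T \<in> \<T>" "S facet_of T" for T S
    using normal[OF that] by blast
  ultimately show rt: "w \<in> RT"
    unfolding raviart_thomas_def using jump by blast
  show "mean T w = mean T y + t *\<^sub>R p T" if T: "T \<in> \<T>"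
  proof -
    interpret full_simplex T by (rule element[OF T])
    have "(\<Sum>a\<in>V. elt_trace T w a) = (\<Sum>a\<in>V. elt_trace T y a + t *\<^sub>R p T)"
      by (rule sum.cong) (use trace[OF T] verts_subset in auto)
    also have "\<dots> = (\<Sum>a\<in>V. elt_trace T y a) + real (DIM('a) + 1) *\<^sub>R (t *\<^sub>R p T)"
      by (simp add: sum.distrib card_verts sum_constant_scaleR)
    finally show ?thesis
      unfolding mean_affine[OF affw[OF T]] mean_affine[OF affine_on_element[OF aff T]]
      by (simp add: scaleR_add_right)
  qed
  show "elt_div T w = elt_div T y" if T: "T \<in> \<T>"
  proof -
    interpret full_simplex T by (rule element[OF T])
    have "elt_div T w = (\<Sum>a\<in>V. elt_trace T y a \<bullet> bary_grad T a + (t *\<^sub>R p T) \<bullet> bary_grad T a)"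
      unfolding elt_div_def by (rule sum.cong) (use trace[OF T] verts_subset in \<open>auto simp: inner_add_left\<close>)
    also have "\<dots> = elt_div T y + (t *\<^sub>R p T) \<bullet> (\<Sum>a\<in>V. bary_grad T a)"
      by (simp only: sum.distrib elt_div_def inner_sum_right)
    finally show ?thesis
      by (simp add: sum_bary_grad)
  qed
  show "boundary_flux w S = boundary_flux y S + t * normal_balance p S" if S: "S \<in> \<B>"
  proof -
    have S': "S \<in> sides \<T>"
      using S boundary_sides_subset by blast
    note adj = neighboursD[OF adjacent_neighbour[OF S']]
    obtain x where x: "x \<in> S"
      using side_nonempty[OF S'] rel_interior_subset by blast
    have "neighbours S = {adjacent \<T> S}"
      using boundary_side_iff[OF S'] S by blast
    then show ?thesis
      using normal[OF adj x] flux_eq[OF rt adj x] by (simp add: boundary_flux_def normal_balance_def)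
  qed
qed

end

context discrete_problem
begin

text \<open>
  The Euler equation of the dual problem in the direction of \<open>p\<close>: along the line \<open>z + t p\<close> the dual functional
  is bounded below by a quadratic polynomial that agrees with it at \<open>t = 0\<close>, and its linear term must vanish.
\<close>

lemma dual_stationary:
  assumes z: "z \<in> Krt" and max: "\<And>y. y \<in> Krt \<Longrightarrow> dual y \<le> dual z"
    and pos: "\<And>T. T \<in> \<T> \<Longrightarrow> 0 \<le> piece \<zeta> T"
    and p: "\<And>S. S \<in> sides \<T> \<Longrightarrow> S \<notin> \<S>D \<Longrightarrow> normal_balance p S = 0"
  shows "(\<Sum>T\<in>\<T>. volume T * (ball_proj (piece \<zeta> T) (mean T z) \<bullet> p T)) =
    (\<Sum>S\<in>\<S>D. side_area S * (normal_balance p S * piece uD S))"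
proof -
  have Z: "z \<in> RT" "\<And>T. T \<in> \<T> \<Longrightarrow> elt_div T z = - piece f T" "\<And>S. S \<in> \<S>N \<Longrightarrow> boundary_flux z S = piece g S"
    using z unfolding K_rt_iff by blast+
  have p_int: "\<forall>S\<in>sides \<T> - \<B>. normal_balance p S = 0"
    using p sides_in_subset by blast
  have p_N: "normal_balance p S = 0" if "S \<in> \<S>N" for S
    using p[OF sides_in_sides[OF that]] D_or_N that sides_in_subset by blast
  let ?q = "\<lambda>T. ball_proj (piece \<zeta> T) (mean T z)"
  let ?A = "\<Sum>T\<in>\<T>. volume T * (?q T \<bullet> p T)"
  let ?B = "\<Sum>S\<in>\<S>D. side_area S * (normal_balance p S * piece uD S)"
  let ?C = "\<Sum>T\<in>\<T>. volume T * ((norm (p T))\<^sup>2 / 2)"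
  have "?B - ?A = 0"
  proof (rule linear_le_quadratic_zero)
    fix t :: real
    let ?w = "\<lambda>x. z x + t *\<^sub>R const_field p x"
    note w = add_const_field[OF Z(1) p_int, where t = t]
    have bd: "S \<in> \<B>" if "S \<in> sides_in \<Omega> \<T> \<Gamma>" for S \<Gamma>
      using that sides_in_subset by blast
    have "?w \<in> Krt"
      unfolding K_rt_iff using w(1) by (simp add: w(3) w(4)[OF bd] Z p_N)
    then have "dual ?w \<le> dual z"
      by (rule max)
    moreover have "dual ?w = - (\<Sum>T\<in>\<T>. volume T * huber (piece \<zeta> T) (mean T z + t *\<^sub>R p T)) +
        (\<Sum>S\<in>\<S>D. side_area S * ((boundary_flux z S + t * normal_balance p S) * piece uD S))"
      unfolding dual_def by (intro arg_cong2[where f = "(+)"] arg_cong[where f = uminus] sum.cong) (simp_all add: w(2) w(4)[OF bd])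
    moreover have "(\<Sum>S\<in>\<S>D. side_area S * ((boundary_flux z S + t * normal_balance p S) * piece uD S)) =
        (\<Sum>S\<in>\<S>D. side_area S * (boundary_flux z S * piece uD S)) + t * ?B"
      by (simp add: sum_distrib_left sum.distrib[symmetric] algebra_simps)
    moreover have "(\<Sum>T\<in>\<T>. volume T * huber (piece \<zeta> T) (mean T z + t *\<^sub>R p T)) \<le>
        (\<Sum>T\<in>\<T>. volume T * huber (piece \<zeta> T) (mean T z)) + t * ?A + t\<^sup>2 * ?C"
    proof -
      have "(\<Sum>T\<in>\<T>. volume T * huber (piece \<zeta> T) (mean T z + t *\<^sub>R p T)) \<le>
        (\<Sum>T\<in>\<T>. volume T * huber (piece \<zeta> T) (mean T z) + t * (volume T * (?q T \<bullet> p T)) + t\<^sup>2 * (volume T * ((norm (p T))\<^sup>2 / 2)))"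
      proof (rule sum_mono)
        fix T assume T: "T \<in> \<T>"
        have "volume T * huber (piece \<zeta> T) (mean T z + t *\<^sub>R p T) \<le>
            volume T * (huber (piece \<zeta> T) (mean T z) + ?q T \<bullet> (t *\<^sub>R p T) + (norm (t *\<^sub>R p T))\<^sup>2 / 2)"
          by (intro mult_left_mono huber_upper_quadratic pos T less_imp_le volume_pos)
        then show "volume T * huber (piece \<zeta> T) (mean T z + t *\<^sub>R p T) \<le>
            volume T * huber (piece \<zeta> T) (mean T z) + t * (volume T * (?q T \<bullet> p T)) + t\<^sup>2 * (volume T * ((norm (p T))\<^sup>2 / 2))"
          by (simp add: power_mult_distrib algebra_simps)
      qed
      then show ?thesis
        by (simp only: sum.distrib sum_distrib_left)
    qed
    ultimately have "t * ?B - t * ?A \<le> t\<^sup>2 * ?C"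
      unfolding dual_def by linarith
    then show "t * (?B - ?A) \<le> t\<^sup>2 * ?C"
      by (simp only: right_diff_distrib)
  qed
  then show ?thesis by simp
qed

text \<open>
  The remainder \<open>p\<close> of the projection of \<open>q - \<nabla>u\<close> onto the gradients of the basis functions of the sides outside of
  \<open>\<Gamma>\<^sub>D\<close> is an admissible direction for the dual problem.  Stationarity shows that it is orthogonal to \<open>q - \<nabla>u\<close>,
  hence to itself.
\<close>

theorem strong_duality:
  assumes u: "u \<in> Kcr" and min: "\<And>v. v \<in> Kcr \<Longrightarrow> primal u \<le> primal v"
    and z: "z \<in> Krt" and max: "\<And>y. y \<in> Krt \<Longrightarrow> dual y \<le> dual z"
  shows "primal u = dual z"
proof -
  have U: "u \<in> CR" "\<And>T. T \<in> \<T> \<Longrightarrow> norm (elt_grad T u) \<le> piece \<zeta> T"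
    "\<And>S. S \<in> \<S>D \<Longrightarrow> avg u S = piece uD S"
    using u unfolding K_cr_iff by blast+
  have Z: "z \<in> RT"
    using z unfolding K_rt_iff by blast
  have pos: "0 \<le> piece \<zeta> T" if "T \<in> \<T>" for T
    using U(2)[OF that] norm_ge_zero order_trans by blast
  define q where "q T = ball_proj (piece \<zeta> T) (mean T z)" for T
  define I where "I = sides \<T> - \<S>D"
  have finI: "finite I"
    by (simp add: I_def)
  have "\<exists>c. \<forall>S\<in>I. (\<Sum>T\<in>\<T>. volume T * ((q T - elt_grad T u - (\<Sum>i\<in>I. c i *\<^sub>R side_grad i T)) \<bullet> side_grad S T)) = 0"
    by (rule weighted_orthogonal_projection[OF finI finite_mesh]) (rule volume_pos)
  then obtain c0 where c0: "\<And>S. S \<in> I \<Longrightarrow>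
      (\<Sum>T\<in>\<T>. volume T * ((q T - elt_grad T u - (\<Sum>i\<in>I. c0 i *\<^sub>R side_grad i T)) \<bullet> side_grad S T)) = 0"
    by blast
  define c where "c S = (if S \<in> I then c0 S else 0)" for S
  define p where "p T = q T - elt_grad T u - (\<Sum>S\<in>sides \<T>. c S *\<^sub>R side_grad S T)" for T
  have c_sum: "(\<Sum>i\<in>I. c0 i *\<^sub>R side_grad i T) = (\<Sum>S\<in>sides \<T>. c S *\<^sub>R side_grad S T)" for T
    by (rule sum.mono_neutral_cong_left) (auto simp: I_def c_def)
  have orth: "(\<Sum>T\<in>\<T>. volume T * (p T \<bullet> side_grad S T)) = 0" if "S \<in> I" for S
    using c0[OF that] unfolding c_sum p_def .
  \<comment> \<open>Testing with the basis function of \<open>S\<close> computes the normal jump of \<open>p\<close> on \<open>S\<close>.\<close>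
  have test: "(\<Sum>T\<in>\<T>. volume T * (p T \<bullet> side_grad S T)) = side_area S * normal_balance p S" for S
  proof -
    have "(\<Sum>T\<in>\<T>. volume T * (p T \<bullet> side_grad S T)) = (\<Sum>T\<in>\<T>. if S facet_of T then side_area S * (p T \<bullet> outer_normal T S) else 0)"
    proof (rule sum.cong)
      fix T assume "T \<in> \<T>"
      then show "volume T * (p T \<bullet> side_grad S T) = (if S facet_of T then side_area S * (p T \<bullet> outer_normal T S) else 0)"
        using volume_pos[of T] by (simp add: side_grad_def)
    qed simp
    also have "\<dots> = (\<Sum>T\<in>neighbours S. side_area S * (p T \<bullet> outer_normal T S))"
      unfolding neighbours_def by (rule sum.inter_filter[symmetric]) simp
    finally show ?thesis
      by (simp add: normal_balance_def sum_distrib_left)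
  qed
  have balance: "normal_balance p S = 0" if "S \<in> sides \<T>" "S \<notin> \<S>D" for S
    using orth[of S] test[of S] side_area_pos[OF that(1)] that by (simp add: I_def)
  have p_int: "\<forall>S\<in>sides \<T> - \<B>. normal_balance p S = 0"
    using balance sides_in_subset by blast
  have p_N: "normal_balance p S = 0" if "S \<in> \<S>N" for S
    using balance[OF sides_in_sides[OF that]] D_or_N that sides_in_subset by blast

  have qp: "(\<Sum>T\<in>\<T>. volume T * (q T \<bullet> p T)) = (\<Sum>S\<in>\<S>D. side_area S * (normal_balance p S * piece uD S))"
    unfolding q_def by (rule dual_stationary[OF z]) (auto intro: max pos balance)
  have up: "(\<Sum>T\<in>\<T>. volume T * (elt_grad T u \<bullet> p T)) = (\<Sum>S\<in>\<S>D. side_area S * (normal_balance p S * piece uD S))"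
  proof -
    \<comment> \<open>Subtracting the integration by parts formulas for \<open>z + p\<close> and \<open>z\<close> gives the formula for \<open>p\<close>.\<close>
    let ?w = "\<lambda>x. z x + 1 *\<^sub>R const_field p x"
    note w = add_const_field[OF Z p_int, where t = 1]
    have "(\<Sum>T\<in>\<T>. volume T * (elt_grad T u \<bullet> p T)) =
        (\<Sum>T\<in>\<T>. volume T * (elt_grad T u \<bullet> mean T ?w + mean T u * elt_div T ?w)) -
        (\<Sum>T\<in>\<T>. volume T * (elt_grad T u \<bullet> mean T z + mean T u * elt_div T z))"
      unfolding sum_subtractf[symmetric] by (rule sum.cong) (simp_all add: w(2,3)[simplified] inner_add_right algebra_simps)
    also have "\<dots> = (\<Sum>S\<in>\<B>. side_area S * boundary_flux ?w S * avg u S) -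
        (\<Sum>S\<in>\<B>. side_area S * boundary_flux z S * avg u S)"
      unfolding discrete_integration_by_parts[OF U(1) w(1)] discrete_integration_by_parts[OF U(1) Z] ..
    also have "\<dots> = (\<Sum>S\<in>\<B>. side_area S * (normal_balance p S * avg u S))"
      unfolding sum_subtractf[symmetric] by (rule sum.cong) (simp_all add: w(4)[simplified] algebra_simps)
    also have "\<dots> = (\<Sum>S\<in>\<S>D. side_area S * (normal_balance p S * piece uD S))"
      unfolding sum_boundary using U(3) p_N by simp
    finally show ?thesis .
  qed
  have sp: "(\<Sum>T\<in>\<T>. volume T * ((\<Sum>S\<in>sides \<T>. c S *\<^sub>R side_grad S T) \<bullet> p T)) = 0"
  proof -
    have "(\<Sum>T\<in>\<T>. volume T * ((\<Sum>S\<in>sides \<T>. c S *\<^sub>R side_grad S T) \<bullet> p T)) =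
        (\<Sum>T\<in>\<T>. \<Sum>S\<in>sides \<T>. c S * (volume T * (p T \<bullet> side_grad S T)))"
      by (simp add: inner_sum_left inner_sum_right sum_distrib_left inner_commute mult.left_commute)
    also have "\<dots> = (\<Sum>S\<in>sides \<T>. c S * (\<Sum>T\<in>\<T>. volume T * (p T \<bullet> side_grad S T)))"
      by (subst sum.swap) (simp add: sum_distrib_left)
    also have "\<dots> = 0"
      by (rule sum.neutral) (auto simp: c_def orth)
    finally show ?thesis .
  qed
  have "(\<Sum>T\<in>\<T>. volume T * (p T \<bullet> p T)) =
      (\<Sum>T\<in>\<T>. volume T * (q T \<bullet> p T) - volume T * (elt_grad T u \<bullet> p T)
        - volume T * ((\<Sum>S\<in>sides \<T>. c S *\<^sub>R side_grad S T) \<bullet> p T))"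
    by (rule sum.cong) (simp_all add: p_def[of _] inner_diff_left right_diff_distrib)
  also have "\<dots> = 0"
    by (simp only: sum_subtractf qp up sp)
  finally have "\<forall>T\<in>\<T>. volume T * (p T \<bullet> p T) = 0"
    using sum_nonneg_eq_0_iff[OF finite_mesh, of "\<lambda>T. volume T * (p T \<bullet> p T)"] volume_pos by (simp add: less_imp_le)
  then have p0: "p T = 0" if "T \<in> \<T>" for T
    using that volume_pos[OF that] by auto

  define w where "w x = u x + cr_interpolant c x" for x
  note W = add_cr_interpolant[OF U(1), where c = c, folded w_def]
  have gradw: "elt_grad T w = q T" if "T \<in> \<T>" for T
    using W(2)[OF that] p0[OF that] by (simp add: p_def algebra_simps)
  have "norm (elt_grad T w) \<le> piece \<zeta> T" if "T \<in> \<T>" for T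
    unfolding gradw[OF that] q_def by (rule norm_ball_proj[OF pos[OF that]])
  moreover have "avg w S = piece uD S" if "S \<in> \<S>D" for S
    using W(3)[OF sides_in_sides[OF that]] U(3)[OF that] that by (simp add: c_def I_def)
  ultimately have wK: "w \<in> Kcr"
    unfolding K_cr_iff using W(1) by blast
  have "primal w - dual z = 0"
    unfolding duality_gap[OF wK z]
  proof (rule sum.neutral, rule ballI)
    fix T assume T: "T \<in> \<T>"
    show "volume T * ((norm (elt_grad T w))\<^sup>2 / 2 + huber (piece \<zeta> T) (mean T z) - elt_grad T w \<bullet> mean T z) = 0"
      unfolding gradw[OF T] huber_eq[OF pos[OF T]] q_def by simp
  qed
  then show ?thesis
    using min[OF wK] weak_duality[OF u z] by simp
qed

end

theorem theorem6p5:
  fixes \<Omega> \<Gamma>D \<Gamma>N :: "'a::euclidean_space set" and \<T> :: "'a set set"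
    and f g \<zeta> uD u v :: "'a \<Rightarrow> real" and z y :: "'a \<Rightarrow> 'a"
  assumes "bounded \<Omega>" and "lipschitz_domain \<Omega>"
    and "simplicial_mesh \<Omega> \<T>"
    and "bd_partition \<Omega> \<T> \<Gamma>D \<Gamma>N"
    and "admissible_data \<Omega> \<T> \<Gamma>D \<Gamma>N f g \<zeta> uD"
    and "u \<in> K_cr \<Omega> \<T> \<Gamma>D \<zeta> uD"
    and "is_arg_min (I_cr \<Omega> \<T> \<Gamma>D \<Gamma>N f g \<zeta> uD) (\<lambda>w. w \<in> crouzeix_raviart \<Omega> \<T>) u"
    and "z \<in> K_rt \<Omega> \<T> \<Gamma>N f g"
    and "is_arg_max (D_rt \<Omega> \<T> \<Gamma>D \<Gamma>N f g \<zeta> uD) (\<lambda>w. w \<in> raviart_thomas \<Omega> \<T>) z"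
    and "v \<in> K_cr \<Omega> \<T> \<Gamma>D \<zeta> uD"
    and "y \<in> K_rt \<Omega> \<T> \<Gamma>N f g"
  shows "rho_tot_sq \<Omega> \<T> \<Gamma>D \<Gamma>N f g \<zeta> uD u z v y = eta_gap_sq \<Omega> \<T> \<Gamma>D \<Gamma>N f g \<zeta> uD v y"
proof -
  interpret discrete_problem \<Omega> \<T> \<Gamma>D \<Gamma>N f g \<zeta> uD
    using assms by unfold_locales (auto simp: admissible_data_def)
  have "primal u = dual z"
  proof (rule strong_duality)
    fix w assume w: "w \<in> K_cr \<Omega> \<T> \<Gamma>D \<zeta> uD"
    then have "w \<in> crouzeix_raviart \<Omega> \<T>"
      unfolding K_cr_iff by blast
    then have "I_cr \<Omega> \<T> \<Gamma>D \<Gamma>N f g \<zeta> uD u \<le> I_cr \<Omega> \<T> \<Gamma>D \<Gamma>N f g \<zeta> uD w"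
      using assms(7) by (auto simp: is_arg_min_def not_less)
    then show "primal u \<le> primal w"
      using I_cr_eq[OF w] I_cr_eq[OF assms(6)] by simp
  next
    fix w assume w: "w \<in> K_rt \<Omega> \<T> \<Gamma>N f g"
    then have "w \<in> raviart_thomas \<Omega> \<T>"
      unfolding K_rt_iff by blast
    then have "D_rt \<Omega> \<T> \<Gamma>D \<Gamma>N f g \<zeta> uD w \<le> D_rt \<Omega> \<T> \<Gamma>D \<Gamma>N f g \<zeta> uD z"
      using assms(9) by (auto simp: is_arg_max_def not_less)
    then show "dual w \<le> dual z"
      using D_rt_eq[OF w] D_rt_eq[OF assms(8)] by simp
  qed (fact assms)+
  then show ?thesis
    unfolding rho_tot_sq_def eta_gap_sq_def I_cr_eq[OF assms(6)] I_cr_eq[OF assms(10)]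
      D_rt_eq[OF assms(8)] D_rt_eq[OF assms(11)] by simp
qed

end
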